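(* If $\Gamma$ acts on a proper $\delta$-hyperbolic, roughly geodesic and $\epsilon$-good space $(X,d)$ with compact quotient and $d$ is of conditionally negative type, then $\mathcal R_t$ is positive for all $0<t\le\frac12$.
   Context: Setting. $\Gamma$ is a non-elementary Gromov hyperbolic group acting on $X$ by isometries, properly discontinuously and cocompactly. $(X,d)$ is a proper metric space with basepoint $o$; the Gromov product is $(x,y)_p=\frac12(d(x,p)+d(y,p)-d(x,y))$. $(X,d)$ is $\delta$-hyperbolic if for some $\delta\ge0$, $(x,y)_o\ge\min\{(x,z)_o,(z,y)_o\}-\delta$ for all $x,y,z$; roughly geodesic if there is $C_X>0$ such that any $x,y\in X$ are joined by a map $r:[a,b]\to X$, $r(a)=x$, $r(b)=y$, with $|t-s|-C_X\le d(r(t),r(s))\le|t-s|+C_X$; and $\epsilon$-good ($\epsilon>0$) if for every basepoint $p$ the Gromov product $(\cdot,\cdot)_p$ extends continuously to $\overline X=X\cup\partial X$, where $\partial X$ is the Gromov boundary, and $d_{p,\epsilon}(\xi,\eta)=e^{-\epsilon(\xi,\eta)_p}$ is a metric on $\partial X$. The metric $d$ is of conditionally negative type if $\sum_{i,j}\lambda_i\lambda_jd(x_i,x_j)\le0$ for all $n\geq 1$, $x_1,\dots,x_n\in X$ and real $\lambda_1,\dots,\lambda_n$ with $\sum\lambda_i=0$. $Q=\limsup_{r\to\infty}\frac1r\log|\Gamma o\cap B(o,r)|$, $D=Q/\epsilon$, and $\nu_o$ is the $D$-dimensional Hausdorff measure of $(\partial X,d_{o,\epsilon})$ normalized to be a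 probability. On $L^2(\partial X,\nu_o)$, for $t>0$: $\mathcal I_t(v)(\xi)=\int_{\partial X}\frac{v(\eta)}{d_{o,\epsilon}(\xi,\eta)^{(1-2t)D}}d\nu_o(\eta)$ (a bounded self-adjoint operator), $\sigma_t=\mathcal I_t(\mathbf 1_{\partial X})$ (a continuous positive function; $\mathbf 1_{\partial X}$ is the constant function $1$), and the Riesz operator is $\mathcal R_t(v)=\sigma_t^{-1}\mathcal I_t(v)$. $\mathcal R_t$ is called positive if its spectrum is contained in $[0,\infty)$; equivalently, $\mathcal I_t$ is a positive operator on $L^2(\partial X,\nu_o)$. *)

theory Defs
  imports "HOL-Analysis.Analysis" "HOL-Algebra.Elementary_Groups" "HOL-Algebra.Group_Action"
begin

section \<open>Gromov products and the standing geometric hypotheses\<close>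

definition gromov_product :: "('a \<Rightarrow> 'a \<Rightarrow> real) \<Rightarrow> 'a \<Rightarrow> 'a \<Rightarrow> 'a \<Rightarrow> real" where
  "gromov_product d p x y = (d x p + d y p - d x y) / 2"

definition hyperbolic_on :: "'a set \<Rightarrow> ('a \<Rightarrow> 'a \<Rightarrow> real) \<Rightarrow> 'a \<Rightarrow> real \<Rightarrow> bool" where
  "hyperbolic_on S d p \<delta> \<longleftrightarrow> 0 \<le> \<delta> \<and>
     (\<forall>x\<in>S. \<forall>y\<in>S. \<forall>z\<in>S.
        gromov_product d p x y \<ge> min (gromov_product d p x z) (gromov_product d p z y) - \<delta>)"

definition proper_metric :: "'x::metric_space itself \<Rightarrow> bool" where
  "proper_metric TYPE('x) \<longleftrightarrow> (\<forall>(x::'x) r. compact (cball x r))"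

definition roughly_geodesic :: "'x::metric_space itself \<Rightarrow> bool" where
  "roughly_geodesic TYPE('x) \<longleftrightarrow>
     (\<exists>C>0. \<forall>x y::'x. \<exists>a b (r::real \<Rightarrow> 'x). a \<le> b \<and> r a = x \<and> r b = y \<and>
        (\<forall>s\<in>{a..b}. \<forall>t\<in>{a..b}.
           \<bar>t - s\<bar> - C \<le> dist (r t) (r s) \<and> dist (r t) (r s) \<le> \<bar>t - s\<bar> + C))"

definition cond_negative_type :: "('a \<Rightarrow> 'a \<Rightarrow> real) \<Rightarrow> bool" where
  "cond_negative_type d \<longleftrightarrow>
     (\<forall>n\<ge>1. \<forall>(x::nat \<Rightarrow> 'a) (l::nat \<Rightarrow> real). (\<Sum>i<n. l i) = 0 \<longrightarrow>
        (\<Sum>i<n. \<Sum>j<n. l i * l j * d (x i) (x j)) \<le> 0)"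


section \<open>Hyperbolic groups and their actions\<close>

definition word_length :: "('g, 'm) monoid_scheme \<Rightarrow> 'g set \<Rightarrow> 'g \<Rightarrow> nat" where
  "word_length G S g =
     (LEAST n. \<exists>w. length w = n \<and> set w \<subseteq> S \<union> m_inv G ` S \<and>
        foldr (\<lambda>a b. a \<otimes>\<^bsub>G\<^esub> b) w \<one>\<^bsub>G\<^esub> = g)"

definition word_dist :: "('g, 'm) monoid_scheme \<Rightarrow> 'g set \<Rightarrow> 'g \<Rightarrow> 'g \<Rightarrow> real" where
  "word_dist G S g h = real (word_length G S (inv\<^bsub>G\<^esub> g \<otimes>\<^bsub>G\<^esub> h))"

definition hyperbolic_group :: "('g, 'm) monoid_scheme \<Rightarrow> bool" where
  "hyperbolic_group G \<longleftrightarrow> group G \<and>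
     (\<exists>S. finite S \<and> S \<subseteq> carrier G \<and> generate G S = carrier G \<and>
        (\<exists>\<delta>. hyperbolic_on (carrier G) (word_dist G S) \<one>\<^bsub>G\<^esub> \<delta>))"

text \<open>Elementary means virtually cyclic; finite groups are included, via the trivial subgroup.\<close>

definition elementary_group :: "('g, 'm) monoid_scheme \<Rightarrow> bool" where
  "elementary_group G \<longleftrightarrow>
     (\<exists>H. subgroup H G \<and> cyclic_group (G\<lparr>carrier := H\<rparr>) \<and> finite (rcosets\<^bsub>G\<^esub> H))"

definition isometric_action ::
    "('g, 'm) monoid_scheme \<Rightarrow> ('g \<Rightarrow> 'x \<Rightarrow> 'x::metric_space) \<Rightarrow> bool" where
  "isometric_action G \<phi> \<longleftrightarrow> group_action G UNIV \<phi> \<and>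
     (\<forall>g\<in>carrier G. \<forall>x y. dist (\<phi> g x) (\<phi> g y) = dist x y)"

definition properly_discontinuous ::
    "('g, 'm) monoid_scheme \<Rightarrow> ('g \<Rightarrow> 'x \<Rightarrow> 'x::metric_space) \<Rightarrow> bool" where
  "properly_discontinuous G \<phi> \<longleftrightarrow>
     (\<forall>K. compact K \<longrightarrow> finite {g \<in> carrier G. \<phi> g ` K \<inter> K \<noteq> {}})"

definition cocompact ::
    "('g, 'm) monoid_scheme \<Rightarrow> ('g \<Rightarrow> 'x \<Rightarrow> 'x::metric_space) \<Rightarrow> bool" where
  "cocompact G \<phi> \<longleftrightarrow> (\<exists>K. compact K \<and> (\<Union>g\<in>carrier G. \<phi> g ` K) = UNIV)"

text \<open>The critical exponent of the orbit growth. The limit superior is finite for a properly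
  discontinuous cocompact action of a finitely generated group, so nothing is lost in the
  conversion to a real number.\<close>

definition growth_exponent ::
    "('g, 'm) monoid_scheme \<Rightarrow> ('g \<Rightarrow> 'x \<Rightarrow> 'x::metric_space) \<Rightarrow> 'x \<Rightarrow> real" where
  "growth_exponent G \<phi> x0 = real_of_ereal
     (Limsup at_top (\<lambda>r::real. ereal (ln (real (card (orbit G \<phi> x0 \<inter> ball x0 r))) / r)))"


section \<open>The Gromov boundary and the bordification\<close>

text \<open>In a hyperbolic space it does not matter whether the conditions below are required
  for all basepoints or for one; asking for all makes the notions basepoint-free.\<close>

definition tends_to_infinity :: "(nat \<Rightarrow> 'x::metric_space) \<Rightarrow> bool" where
  "tends_to_infinity s \<longleftrightarrow>
     (\<forall>p. LIM (i, j) sequentially \<times>\<^sub>F sequentially. gromov_product dist p (s i) (s j) :> at_top)"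

definition asymptotic :: "((nat \<Rightarrow> 'x::metric_space) \<times> (nat \<Rightarrow> 'x)) set" where
  "asymptotic = {(s, t). tends_to_infinity s \<and> tends_to_infinity t \<and>
     (\<forall>p. LIM (i, j) sequentially \<times>\<^sub>F sequentially. gromov_product dist p (s i) (t j) :> at_top)}"

definition gromov_boundary :: "(nat \<Rightarrow> 'x::metric_space) set set" where
  "gromov_boundary = {s. tends_to_infinity s} // asymptotic"

text \<open>The bordification is the disjoint union of \<open>X\<close> (left summand) and the boundary
  (those elements of the right summand that are in \<^const>\<open>gromov_boundary\<close>).\<close>

type_synonym 'x bord = "'x + (nat \<Rightarrow> 'x) set"

definition bordification :: "'x::metric_space bord set" where
  "bordification = range Inl \<union> Inr ` gromov_boundary"

fun represents :: "(nat \<Rightarrow> 'x::metric_space) \<Rightarrow> 'x bord \<Rightarrow> bool" where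
  "represents s (Inl x) \<longleftrightarrow> s \<longlonglongrightarrow> x"
| "represents s (Inr \<xi>) \<longleftrightarrow> s \<in> \<xi>"

text \<open>The usual, in general discontinuous, extension of the Gromov product:
  the supremum of \<open>liminf (s i, t j)\<^sub>p\<close> over all sequences \<open>s\<close>, \<open>t\<close> representing the two points.
  It serves to define the neighbourhoods of boundary points.\<close>

definition gromov_sup :: "'x::metric_space \<Rightarrow> 'x bord \<Rightarrow> 'x bord \<Rightarrow> ereal" where
  "gromov_sup p z w =
     Sup {Liminf (sequentially \<times>\<^sub>F sequentially) (\<lambda>(i, j). ereal (gromov_product dist p (s i) (t j)))
          | s t. represents s z \<and> represents t w}"

definition bord_open :: "'x::metric_space bord set \<Rightarrow> bool" where
  "bord_open U \<longleftrightarrow> U \<subseteq> bordification \<and> open {x. Inl x \<in> U} \<and>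
     (\<forall>\<xi>. Inr \<xi> \<in> U \<longrightarrow>
        (\<forall>p. \<exists>r::real. \<forall>w\<in>bordification. gromov_sup p (Inr \<xi>) w > ereal r \<longrightarrow> w \<in> U))"

lemma istopology_bord_open: "istopology bord_open"
  unfolding istopology_def
proof (intro conjI allI impI)
  fix S T :: "'x::metric_space bord set"
  assume S: "bord_open S" and T: "bord_open T"
  have "{x. Inl x \<in> S \<inter> T} = {x. Inl x \<in> S} \<inter> {x. Inl x \<in> T}"
    by auto
  then have o: "open {x. Inl x \<in> S \<inter> T}"
    using S T by (auto simp: bord_open_def)
  have "\<exists>r::real. \<forall>w\<in>bordification. gromov_sup p (Inr \<xi>) w > ereal r \<longrightarrow> w \<in> S \<inter> T"
    if *: "Inr \<xi> \<in> S \<inter> T" for \<xi> and p :: 'x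
  proof -
    obtain r1 :: real where r1: "\<forall>w\<in>bordification. gromov_sup p (Inr \<xi>) w > ereal r1 \<longrightarrow> w \<in> S"
      using S IntD1[OF *] unfolding bord_open_def by blast
    obtain r2 :: real where r2: "\<forall>w\<in>bordification. gromov_sup p (Inr \<xi>) w > ereal r2 \<longrightarrow> w \<in> T"
      using T IntD2[OF *] unfolding bord_open_def by blast
    have le: "ereal r1 \<le> ereal (max r1 r2)" "ereal r2 \<le> ereal (max r1 r2)"
      by auto
    show ?thesis
      using r1 r2 le by (intro exI[of _ "max r1 r2"]) (blast intro: le_less_trans)
  qed
  with o S show "bord_open (S \<inter> T)"
    unfolding bord_open_def by blast
next
  fix \<K> :: "'x::metric_space bord set set"
  assume K: "\<forall>K\<in>\<K>. bord_open K"
  have "{x. Inl x \<in> \<Union>\<K>} = (\<Union>K\<in>\<K>. {x. Inl x \<in> K})"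
    by auto
  then have "open {x. Inl x \<in> \<Union>\<K>}"
    using K by (auto simp: bord_open_def)
  with K show "bord_open (\<Union>\<K>)"
    unfolding bord_open_def by (meson Union_iff Union_least)
qed

definition bord_topology :: "'x::metric_space bord topology" where
  "bord_topology = topology bord_open"

definition gromov_extension :: "'x::metric_space \<Rightarrow> ('x bord \<times> 'x bord \<Rightarrow> ereal) \<Rightarrow> bool" where
  "gromov_extension p F \<longleftrightarrow>
     continuous_map (prod_topology bord_topology bord_topology) euclidean F \<and>
     (\<forall>x y. F (Inl x, Inl y) = ereal (gromov_product dist p x y))"

text \<open>The Gromov product on the boundary is the value of the continuous extension, which is
  unique on the bordification because \<open>X\<close> is dense in it.\<close>

definition bdry_product ::
    "'x::metric_space \<Rightarrow> (nat \<Rightarrow> 'x) set \<Rightarrow> (nat \<Rightarrow> 'x) set \<Rightarrow> ereal" where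
  "bdry_product p \<xi> \<eta> = (SOME F. gromov_extension p F) (Inr \<xi>, Inr \<eta>)"

text \<open>\<open>exp (- \<epsilon> (\<xi>, \<eta>)\<^sub>p)\<close> with the convention \<open>exp (- \<infinity>) = 0\<close>. The value \<open>0\<close> off the boundary
  is needed because \<^const>\<open>Metric_space\<close> asks for nonnegativity and symmetry everywhere.\<close>

definition visual_dist ::
    "'x::metric_space \<Rightarrow> real \<Rightarrow> (nat \<Rightarrow> 'x) set \<Rightarrow> (nat \<Rightarrow> 'x) set \<Rightarrow> real" where
  "visual_dist p \<epsilon> \<xi> \<eta> =
     (if \<xi> \<in> gromov_boundary \<and> \<eta> \<in> gromov_boundary \<and> bdry_product p \<xi> \<eta> \<noteq> \<infinity>
      then exp (- \<epsilon> * real_of_ereal (bdry_product p \<xi> \<eta>)) else 0)"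

definition eps_good :: "'x::metric_space itself \<Rightarrow> real \<Rightarrow> bool" where
  "eps_good TYPE('x) \<epsilon> \<longleftrightarrow> 0 < \<epsilon> \<and>
     (\<forall>p::'x. (\<exists>F. gromov_extension p F) \<and> Metric_space gromov_boundary (visual_dist p \<epsilon>))"


section \<open>Hausdorff measure\<close>

definition ediam :: "('a \<Rightarrow> 'a \<Rightarrow> real) \<Rightarrow> 'a set \<Rightarrow> ennreal" where
  "ediam d U = (SUP x\<in>U. SUP y\<in>U. ennreal (d x y))"

text \<open>\<open>diam(U)^s\<close> for sets of finite diameter, where the empty set counts \<open>0\<close> and \<open>0^0 = 1\<close>.\<close>

definition diam_power :: "('a \<Rightarrow> 'a \<Rightarrow> real) \<Rightarrow> real \<Rightarrow> 'a set \<Rightarrow> ennreal" where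
  "diam_power d s U =
     (if U = {} then 0 else if s = 0 then 1 else ennreal (enn2real (ediam d U) powr s))"

definition hausdorff_outer :: "'a set \<Rightarrow> ('a \<Rightarrow> 'a \<Rightarrow> real) \<Rightarrow> real \<Rightarrow> 'a set \<Rightarrow> ennreal" where
  "hausdorff_outer M d s A =
     (SUP \<delta>\<in>{0::real<..}.
        INF U\<in>{U::nat \<Rightarrow> 'a set. A \<subseteq> (\<Union>n. U n) \<and> (\<forall>n. U n \<subseteq> M \<and> ediam d (U n) \<le> ennreal \<delta>)}.
          \<Sum>n. diam_power d s (U n))"

definition hausdorff_measure :: "'a set \<Rightarrow> ('a \<Rightarrow> 'a \<Rightarrow> real) \<Rightarrow> real \<Rightarrow> 'a measure" where
  "hausdorff_measure M d s =
     measure_of M {U. openin (Metric_space.mtopology M d) U} (hausdorff_outer M d s)"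

definition boundary_measure :: "'x::metric_space \<Rightarrow> real \<Rightarrow> real \<Rightarrow> (nat \<Rightarrow> 'x) set measure" where
  "boundary_measure p \<epsilon> D =
     (let H = hausdorff_measure gromov_boundary (visual_dist p \<epsilon>) D in uniform_measure H (space H))"


section \<open>Operators on \<open>L\<^sup>2\<close>\<close>

text \<open>Elements of the complex Hilbert space \<open>L\<^sup>2(M)\<close> are represented by square integrable
  functions, with equality almost everywhere. A map that is linear almost everywhere and bounded
  for the \<open>L\<^sup>2\<close> norm respects this equality, so it is the same as a bounded operator on the
  classes.\<close>

definition L2 :: "'a measure \<Rightarrow> ('a \<Rightarrow> complex) set" where
  "L2 M = {v \<in> borel_measurable M. integrable M (\<lambda>x. (cmod (v x))\<^sup>2)}"

definition L2_norm_of :: "'a measure \<Rightarrow> ('a \<Rightarrow> complex) \<Rightarrow> real" where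
  "L2_norm_of M v = sqrt (\<integral>x. (cmod (v x))\<^sup>2 \<partial>M)"

definition L2_bounded :: "'a measure \<Rightarrow> (('a \<Rightarrow> complex) \<Rightarrow> ('a \<Rightarrow> complex)) \<Rightarrow> bool" where
  "L2_bounded M T \<longleftrightarrow>
     (\<forall>v\<in>L2 M. T v \<in> L2 M) \<and>
     (\<forall>v\<in>L2 M. \<forall>w\<in>L2 M. \<forall>a b.
        AE x in M. T (\<lambda>y. a * v y + b * w y) x = a * T v x + b * T w x) \<and>
     (\<exists>C. \<forall>v\<in>L2 M. L2_norm_of M (T v) \<le> C * L2_norm_of M v)"

text \<open>A scalar \<open>z\<close> is outside the spectrum iff \<open>T - z\<close> has a bounded two-sided inverse \<open>S\<close>.\<close>

definition L2_spectrum :: "'a measure \<Rightarrow> (('a \<Rightarrow> complex) \<Rightarrow> ('a \<Rightarrow> complex)) \<Rightarrow> complex set" where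
  "L2_spectrum M T = {z. \<not> (\<exists>S. L2_bounded M S \<and>
     (\<forall>v\<in>L2 M. (\<lambda>x. T v x - z * v x) \<in> L2 M \<and>
        (AE x in M. S (\<lambda>y. T v y - z * v y) x = v x) \<and>
        (AE x in M. T (S v) x - z * S v x = v x)))}"

definition L2_positive :: "'a measure \<Rightarrow> (('a \<Rightarrow> complex) \<Rightarrow> ('a \<Rightarrow> complex)) \<Rightarrow> bool" where
  "L2_positive M T \<longleftrightarrow> L2_spectrum M T \<subseteq> \<real>\<^sub>\<ge>\<^sub>0"


section \<open>The Riesz operator\<close>

text \<open>At \<open>\<eta> = \<xi>\<close> the integrand is \<open>0\<close> by the library conventions for \<open>powr\<close> and division,
  also for \<open>t = 1/2\<close>. This is harmless: the Hausdorff measure of positive dimension has no atoms.\<close>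

definition riesz_potential ::
    "'x::metric_space \<Rightarrow> real \<Rightarrow> real \<Rightarrow> real \<Rightarrow>
     ((nat \<Rightarrow> 'x) set \<Rightarrow> complex) \<Rightarrow> (nat \<Rightarrow> 'x) set \<Rightarrow> complex" where
  "riesz_potential p \<epsilon> D t v \<xi> =
     (\<integral>\<eta>. v \<eta> / complex_of_real (visual_dist p \<epsilon> \<xi> \<eta> powr ((1 - 2 * t) * D))
        \<partial>boundary_measure p \<epsilon> D)"

definition riesz_operator ::
    "'x::metric_space \<Rightarrow> real \<Rightarrow> real \<Rightarrow> real \<Rightarrow>
     ((nat \<Rightarrow> 'x) set \<Rightarrow> complex) \<Rightarrow> (nat \<Rightarrow> 'x) set \<Rightarrow> complex" where
  "riesz_operator p \<epsilon> D t v \<xi> =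
     riesz_potential p \<epsilon> D t v \<xi> / riesz_potential p \<epsilon> D t (\<lambda>_. 1) \<xi>"

end

theory Submission
  imports Defs
begin

text \<open>
  Suppose first that \<open>D > 0\<close> and that the Hausdorff measure of the boundary is positive and finite.
  Write \<open>(x, y)\<close> for the Gromov product based at \<open>x0\<close> and put \<open>a = (1 - 2 t) D\<close>, so that
  \<open>0 \<le> a < D\<close> and the kernel of the Riesz potential is \<open>exp (\<epsilon> a (\<xi>, \<eta>))\<close> off the diagonal.

  \<^emph>\<open>Positivity of the form.\<close> The metric is of conditionally negative type, so the Gromov product
  is a positive semidefinite kernel on \<open>X\<close> (\<open>psd_kernel_gromov_product\<close>), and then so is
  \<open>exp (s (x, y))\<close> for \<open>s \<ge> 0\<close>, by the Schur product theorem (\<open>psd_kernel_exp\<close>). To carry this to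
  the boundary, where the Gromov product is infinite on the diagonal, each boundary point \<open>\<xi>\<close> is replaced by
  an orbit point \<open>x\<^sub>n(\<xi>)\<close> at distance about \<open>n\<close> from \<open>x0\<close> in the direction of \<open>\<xi>\<close>, chosen measurably
  from countably many candidates (\<open>interior_approximation\<close>). The kernels \<open>exp (s (x\<^sub>n(\<xi>), x\<^sub>n(\<eta>)))\<close>
  are bounded and have nonnegative quadratic forms. They converge to the Riesz kernel off the
  diagonal because the Gromov product extends continuously, and hyperbolicity bounds them by a
  constant times the Riesz kernel. Dominated convergence gives \<open>riesz_form_nonneg\<close>.

  \<^emph>\<open>Boundedness.\<close> The function \<open>\<sigma>\<^sub>t\<close> lies between two positive constants. It is at least \<open>1\<close> since
  visual distances are at most \<open>1\<close> and points are null sets. It is bounded above because \<open>a < D\<close> and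
  balls satisfy \<open>\<nu>(B(\<xi>, r)) \<le> A r\<^sup>D\<close> (\<open>ball_measure_upper_bound\<close>): if \<open>g x0\<close> lies near the ray from
  \<open>x0\<close> to \<open>\<xi>\<close> at distance \<open>ln (1 / r) / \<epsilon>\<close> from \<open>x0\<close>, then the action of the inverse of \<open>g\<close> expands
  \<open>B(\<xi>, r)\<close> by a factor comparable to \<open>1 / r\<close>, so the Hausdorff measure of the ball is at most a
  constant times \<open>r\<^sup>D\<close> times the total mass, which is finite.

  \<^emph>\<open>From the form to the spectrum.\<close> The Riesz operator is the transition operator of a reversible
  Markov kernel. With respect to \<open>\<sigma>\<^sub>t d\<nu>\<close>, whose \<open>L\<^sup>2\<close> norm is equivalent to the given one, it is a
  symmetric contraction with nonnegative form (\<open>L2_positive_averaging\<close>). For such an operator \<open>T\<close>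
  and \<open>z\<close> outside \<open>[0, \<infinity>)\<close> there is \<open>w\<close> with \<open>\<parallel>w - T\<parallel> < \<bar>w - z\<bar>\<close>, and \<open>T - z\<close> is inverted by a
  Neumann series (\<open>L2_positive_of_form\<close>).

  \<^emph>\<open>Degenerate parameters.\<close> If the Hausdorff measure of the boundary is \<open>0\<close> or infinite, then
  its normalization is the null measure and all operators vanish. If \<open>D = 0\<close> and it
  is finite, then the boundary is a finite set, because every point has mass at least \<open>1\<close>. Two boundary points would then be fixed by a
  subgroup of finite index, on which the Busemann function is a homomorphism to the reals with
  finite preimages of bounded sets, and the group would be virtually cyclic
  (\<open>elementary_of_finite_boundary\<close>). With at most one boundary point the kernel is zero.
\<close>

section \<open>Positive semidefinite kernels\<close>

definition psd_kernel :: "('i \<Rightarrow> 'i \<Rightarrow> real) \<Rightarrow> bool" where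
  "psd_kernel k \<longleftrightarrow> (\<forall>i j. k i j = k j i) \<and>
     (\<forall>I c. finite I \<longrightarrow> 0 \<le> (\<Sum>i\<in>I. \<Sum>j\<in>I. c i * c j * k i j))"

lemma psd_kernelD: "psd_kernel k \<Longrightarrow> finite I \<Longrightarrow> 0 \<le> (\<Sum>i\<in>I. \<Sum>j\<in>I. c i * c j * k i j)"
  by (auto simp: psd_kernel_def)

text \<open>Every positive semidefinite matrix is a Gram matrix. The vectors are produced by the Cholesky
  algorithm: split off the rank one matrix of the pivot row and apply induction to what remains.\<close>

lemma psd_matrix_gram:
  fixes A :: "'i \<Rightarrow> 'i \<Rightarrow> real"
  assumes "finite I" "\<And>i j. A i j = A j i" "\<And>c. 0 \<le> (\<Sum>i\<in>I. \<Sum>j\<in>I. c i * c j * A i j)"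
  shows "\<exists>(m::nat) u. \<forall>i\<in>I. \<forall>j\<in>I. A i j = (\<Sum>k<m. u k i * u k j)"
  using assms
proof (induction I arbitrary: A rule: finite_induct)
  case empty
  then show ?case by auto
next
  case (insert a I)
  have sum_insert: "(\<Sum>i\<in>insert a I. \<Sum>j\<in>insert a I. c i * c j * A i j) =
      c a * c a * A a a + 2 * c a * (\<Sum>i\<in>I. c i * A i a) + (\<Sum>i\<in>I. \<Sum>j\<in>I. c i * c j * A i j)" for c
  proof -
    have "(\<Sum>j\<in>I. c a * c j * A a j) = c a * (\<Sum>i\<in>I. c i * A i a)"
      by (simp add: sum_distrib_left insert.prems(1)[of a] mult_ac)
    moreover have "(\<Sum>i\<in>I. c i * c a * A i a) = c a * (\<Sum>i\<in>I. c i * A i a)"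
      by (simp add: sum_distrib_left mult_ac)
    ultimately show ?thesis
      using insert.hyps by (simp add: sum.distrib)
  qed
  have aa: "0 \<le> A a a"
  proof -
    let ?c = "\<lambda>i. if i = a then 1 else 0 :: real"
    have "(\<Sum>i\<in>I. ?c i * A i a) = 0" "(\<Sum>i\<in>I. \<Sum>j\<in>I. ?c i * ?c j * A i j) = 0"
      using insert.hyps by (auto intro!: sum.neutral)
    then show ?thesis
      using insert.prems(2)[of ?c] unfolding sum_insert by simp
  qed
  have zero: "A i a = 0" if "A a a = 0" "i \<in> I" for i
  proof (rule ccontr)
    assume nz: "A i a \<noteq> 0"
    have "0 \<le> s * (2 * A i a) + A i i" for s
    proof -
      let ?c = "\<lambda>j. if j = a then s else if j = i then 1 else 0"
      have ne: "i \<noteq> a" using that insert.hyps by auto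
      have e1: "(\<Sum>j\<in>I. ?c j * A j a) = A i a"
        using insert.hyps that ne by (subst sum.remove[OF _ that(2)]) (auto intro!: sum.neutral split: if_splits)
      have inner: "(\<Sum>j\<in>I. ?c k * ?c j * A k j) = ?c k * A k i" if "k \<in> I" for k
        using insert.hyps \<open>i \<in> I\<close> ne by (subst sum.remove[OF _ \<open>i \<in> I\<close>]) (auto intro!: sum.neutral split: if_splits)
      have e2: "(\<Sum>k\<in>I. \<Sum>j\<in>I. ?c k * ?c j * A k j) = A i i"
        apply (subst sum.cong[OF refl inner], assumption)
        using insert.hyps that ne by (subst sum.remove[OF _ that(2)]) (auto intro!: sum.neutral split: if_splits)
      show ?thesis
        using insert.prems(2)[of ?c] that(1) unfolding sum_insert e1 e2 by (simp add: mult_ac)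
    qed
    from this[of "- (A i i + 1) / (2 * A i a)"] nz show False
      by (simp only: nonzero_eq_divide_eq[symmetric] nonzero_divide_eq_eq eq_divide_eq_1 times_divide_eq_left nonzero_mult_div_cancel_right mult_eq_0_iff) simp
  qed
  \<comment> \<open>The Schur complement of the pivot. If \<open>A a a = 0\<close> then the whole row vanishes, and division by
    zero gives the right matrix.\<close>
  define B where "B i j = A i j - A i a * A a j / A a a" for i j
  have "0 \<le> (\<Sum>i\<in>I. \<Sum>j\<in>I. c i * c j * B i j)" for c
  proof -
    define S where "S = (\<Sum>i\<in>I. c i * A i a)"
    \<comment> \<open>At this value the form is minimal as a function of the coordinate \<open>a\<close>.\<close>
    let ?c = "\<lambda>i. if i = a then - S / A a a else c i"
    have e: "(\<Sum>i\<in>I. ?c i * A i a) = S" "(\<Sum>i\<in>I. \<Sum>j\<in>I. ?c i * ?c j * A i j) = (\<Sum>i\<in>I. \<Sum>j\<in>I. c i * c j * A i j)"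
      using insert.hyps by (auto simp: S_def intro!: sum.cong)
    have SS: "S * S / A a a = (\<Sum>i\<in>I. \<Sum>j\<in>I. c i * c j * (A i a * A a j / A a a))"
      unfolding S_def sum_product sum_divide_distrib
    proof (intro sum.cong refl)
      fix i j
      show "c i * A i a * (c j * A j a) / A a a = c i * c j * (A i a * A a j / A a a)"
        using insert.prems(1)[of a j] by simp
    qed
    have sq: "(- S / A a a) * (- S / A a a) * A a a + 2 * (- S / A a a) * S = - (S * S / A a a)"
      by (cases "A a a = 0") (simp_all add: field_simps)
    have "0 \<le> (\<Sum>i\<in>I. \<Sum>j\<in>I. c i * c j * A i j) - S * S / A a a"
      using insert.prems(2)[of ?c] sq unfolding sum_insert e by simp
    also have "\<dots> = (\<Sum>i\<in>I. \<Sum>j\<in>I. c i * c j * B i j)"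
      unfolding SS sum_subtractf[symmetric] B_def by (intro sum.cong refl) (simp add: algebra_simps)
    finally show ?thesis .
  qed
  moreover have "B i j = B j i" for i j
    using insert.prems(1)[of i j] insert.prems(1)[of i a] insert.prems(1)[of j a] by (simp add: B_def)
  ultimately obtain m :: nat and u where u: "\<forall>i\<in>I. \<forall>j\<in>I. B i j = (\<Sum>k<m. u k i * u k j)"
    using insert.IH[of B] by blast
  define v where "v k i = (if k < m then if i = a then 0 else u k i else A i a / sqrt (A a a))" for k i
  have "A i j = (\<Sum>k<Suc m. v k i * v k j)" if "i \<in> insert a I" "j \<in> insert a I" for i j
  proof -
    have "(\<Sum>k<Suc m. v k i * v k j) = (\<Sum>k<m. if i = a \<or> j = a then 0 else u k i * u k j) + A i a * A j a / A a a"
      using aa by (auto simp: v_def intro!: sum.cong)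
    also have "\<dots> = A i j"
    proof (cases "i = a \<or> j = a")
      case True
      have "A i j = A i a * A j a / A a a"
      proof (cases "A a a = 0")
        case True
        have "A i a = 0" if "i \<in> insert a I" for i
          using zero[OF True] that True by auto
        then show ?thesis
          using True that \<open>i = a \<or> j = a\<close> insert.prems(1)[of i j] by auto
      next
        case False
        then show ?thesis
          using \<open>i = a \<or> j = a\<close> insert.prems(1)[of i j] by auto
      qed
      then show ?thesis using True by simp
    next
      case False
      then have "B i j = (\<Sum>k<m. u k i * u k j)" using u that by auto
      then show ?thesis using False using insert.prems(1)[of a j] by (simp add: B_def)
    qed
    finally show ?thesis by simp
  qed
  then show ?case by blast
qed

text \<open>The Schur product theorem: writing one factor as a Gram matrix turns the quadratic form of the
  product into a sum of quadratic forms of the other factor, one for each coordinate vector.\<close>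

lemma psd_kernel_mult:
  assumes "psd_kernel k" "psd_kernel l"
  shows "psd_kernel (\<lambda>i j. k i j * l i j)"
  unfolding psd_kernel_def
proof (intro conjI allI impI)
  show "k i j * l i j = k j i * l j i" for i j
    using assms by (simp add: psd_kernel_def)
  fix I :: "'a set" and c :: "'a \<Rightarrow> real"
  assume I: "finite I"
  obtain m :: nat and u where u: "\<forall>i\<in>I. \<forall>j\<in>I. k i j = (\<Sum>n<m. u n i * u n j)"
    using psd_matrix_gram[OF I, of k] assms(1) I by (auto simp: psd_kernel_def)
  have "(\<Sum>i\<in>I. \<Sum>j\<in>I. c i * c j * (k i j * l i j))
      = (\<Sum>i\<in>I. \<Sum>j\<in>I. \<Sum>n<m. (c i * u n i) * (c j * u n j) * l i j)"
    using u by (intro sum.cong refl) (simp add: sum_distrib_left sum_distrib_right mult_ac)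
  also have "\<dots> = (\<Sum>n<m. \<Sum>i\<in>I. \<Sum>j\<in>I. (c i * u n i) * (c j * u n j) * l i j)"
    by (subst (2) sum.swap, subst sum.swap) simp
  also have "\<dots> \<ge> 0"
    by (rule sum_nonneg) (rule psd_kernelD[OF assms(2) I])
  finally show "0 \<le> (\<Sum>i\<in>I. \<Sum>j\<in>I. c i * c j * (k i j * l i j))" .
qed

lemma psd_kernel_exp:
  assumes "psd_kernel k" "0 \<le> s"
  shows "psd_kernel (\<lambda>i j. exp (s * k i j))"
  unfolding psd_kernel_def
proof (intro conjI allI impI)
  show "exp (s * k i j) = exp (s * k j i)" for i j
    using assms by (simp add: psd_kernel_def)
  have pow: "psd_kernel (\<lambda>i j. k i j ^ n)" for n
  proof (induction n)
    case 0
    have "(\<Sum>i\<in>I. \<Sum>j\<in>I. c i * c j) = (\<Sum>i\<in>I. c i)\<^sup>2" for I and c :: "'a \<Rightarrow> real"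
      by (simp add: power2_eq_square sum_product)
    then show ?case by (simp add: psd_kernel_def)
  next
    case (Suc n)
    then show ?case using psd_kernel_mult[OF assms(1)] by simp
  qed
  fix I :: "'a set" and c :: "'a \<Rightarrow> real"
  assume I: "finite I"
  have sums: "(\<lambda>n. \<Sum>i\<in>I. \<Sum>j\<in>I. c i * c j * ((s * k i j) ^ n /\<^sub>R fact n)) sums
      (\<Sum>i\<in>I. \<Sum>j\<in>I. c i * c j * exp (s * k i j))"
    by (intro sums_sum sums_mult exp_converges)
  have nonneg: "0 \<le> (\<Sum>i\<in>I. \<Sum>j\<in>I. c i * c j * ((s * k i j) ^ n /\<^sub>R fact n))" for n
  proof -
    have "(\<Sum>i\<in>I. \<Sum>j\<in>I. c i * c j * ((s * k i j) ^ n /\<^sub>R fact n)) =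
      s ^ n / fact n * (\<Sum>i\<in>I. \<Sum>j\<in>I. c i * c j * k i j ^ n)"
      by (simp add: sum_distrib_left power_mult_distrib divide_inverse mult_ac)
    then show ?thesis using psd_kernelD[OF pow I, of c n] assms(2) by simp
  qed
  show "0 \<le> (\<Sum>i\<in>I. \<Sum>j\<in>I. c i * c j * exp (s * k i j))"
    by (rule sums_le[OF _ sums_zero sums]) (rule nonneg)
qed

text \<open>Schoenberg's correspondence. A finite family of points with arbitrary weights becomes a family
  of total weight zero when the basepoint is added with the opposite weight; the negative type
  inequality for this family is the claim.\<close>

lemma psd_kernel_gromov_product:
  fixes p :: "'x::metric_space"
  assumes "cond_negative_type (dist :: 'x \<Rightarrow> 'x \<Rightarrow> real)"
  shows "psd_kernel (gromov_product dist p)"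
  unfolding psd_kernel_def
proof (intro conjI allI impI)
  show "gromov_product dist p i j = gromov_product dist p j i" for i j
    by (simp add: gromov_product_def dist_commute)
  fix I :: "'x set" and c :: "'x \<Rightarrow> real"
  assume I: "finite I"
  obtain h where h: "bij_betw h {..<card I} I"
    using ex_bij_betw_nat_finite[OF I] by (auto simp: atLeast0LessThan)
  define n where "n = card I"
  define S where "S = (\<Sum>i\<in>I. c i)"
  \<comment> \<open>Index \<open>n\<close> is the basepoint.\<close>
  define x where "x i = (if i < n then h i else p)" for i
  define l where "l i = (if i < n then c (h i) else - S)" for i
  have re: "(\<Sum>i<n. f (h i)) = (\<Sum>i\<in>I. f i)" for f :: "'x \<Rightarrow> real"
    using sum.reindex_bij_betw[OF h, of f] by (simp add: n_def)
  have "(\<Sum>i<Suc n. l i) = 0"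
    by (simp add: l_def S_def re)
  then have "(\<Sum>i<Suc n. \<Sum>j<Suc n. l i * l j * dist (x i) (x j)) \<le> 0"
    using assms[unfolded cond_negative_type_def, rule_format, of "Suc n" l x] by simp
  also have "(\<Sum>i<Suc n. \<Sum>j<Suc n. l i * l j * dist (x i) (x j)) =
     (\<Sum>i<n. \<Sum>j<n. c (h i) * c (h j) * dist (h i) (h j)) - 2 * S * (\<Sum>i<n. c (h i) * dist (h i) p)"
    by (simp add: x_def l_def sum.distrib sum_subtractf sum_distrib_left sum_negf mult_ac dist_commute)
  also have "\<dots> = (\<Sum>i\<in>I. \<Sum>j\<in>I. c i * c j * dist i j) - 2 * S * (\<Sum>i\<in>I. c i * dist i p)"
    by (simp only: re[of "\<lambda>j. c (h _) * c j * dist (h _) j"] re[of "\<lambda>i. \<Sum>j\<in>I. c i * c j * dist i j"] re[of "\<lambda>i. c i * dist i p"])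
  finally have le: "(\<Sum>i\<in>I. \<Sum>j\<in>I. c i * c j * dist i j) \<le> 2 * S * (\<Sum>i\<in>I. c i * dist i p)" by simp
  have e1: "(\<Sum>i\<in>I. \<Sum>j\<in>I. c i * c j * dist i p) = S * (\<Sum>i\<in>I. c i * dist i p)"
    unfolding S_def sum_product by (subst sum.swap) (simp add: mult_ac)
  have e2: "(\<Sum>i\<in>I. \<Sum>j\<in>I. c i * c j * dist j p) = S * (\<Sum>i\<in>I. c i * dist i p)"
    unfolding S_def sum_product by (simp add: mult_ac)
  have "2 * (\<Sum>i\<in>I. \<Sum>j\<in>I. c i * c j * gromov_product dist p i j) =
      (\<Sum>i\<in>I. \<Sum>j\<in>I. c i * c j * dist i p) + (\<Sum>i\<in>I. \<Sum>j\<in>I. c i * c j * dist j p) - (\<Sum>i\<in>I. \<Sum>j\<in>I. c i * c j * dist i j)"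
    unfolding sum_distrib_left sum.distrib[symmetric] sum_subtractf[symmetric]
    by (intro sum.cong refl) (simp add: gromov_product_def field_simps)
  then show "0 \<le> (\<Sum>i\<in>I. \<Sum>j\<in>I. c i * c j * gromov_product dist p i j)"
    using le e1 e2 by simp
qed

text \<open>The points \<open>f i\<close> may coincide, in which case their weights are added.\<close>

lemma psd_kernel_compose:
  assumes "psd_kernel k"
  shows "psd_kernel (\<lambda>i j. k (f i) (f j))"
  unfolding psd_kernel_def
proof (intro conjI allI impI)
  show "k (f i) (f j) = k (f j) (f i)" for i j
    using assms by (simp add: psd_kernel_def)
  fix I :: "'b set" and c :: "'b \<Rightarrow> real"
  assume I: "finite I"
  define b where "b x = (\<Sum>i | i \<in> I \<and> f i = x. c i)" for x
  have "(\<Sum>i\<in>I. \<Sum>j\<in>I. c i * c j * k (f i) (f j)) =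
    (\<Sum>x\<in>f ` I. \<Sum>y\<in>f ` I. b x * b y * k x y)"
  proof -
    have "(\<Sum>i\<in>I. \<Sum>j\<in>I. c i * c j * k (f i) (f j)) =
       (\<Sum>x\<in>f ` I. \<Sum>i | i \<in> I \<and> f i = x. \<Sum>j\<in>I. c i * c j * k (f i) (f j))"
      using I by (intro sum.image_gen)
    also have "\<dots> = (\<Sum>x\<in>f ` I. \<Sum>i | i \<in> I \<and> f i = x. \<Sum>y\<in>f ` I. \<Sum>j | j \<in> I \<and> f j = y. c i * c j * k x y)"
      using I by (intro sum.cong refl) (auto simp: sum.image_gen[OF I, of _ f] intro!: sum.cong)
    also have "\<dots> = (\<Sum>x\<in>f ` I. \<Sum>y\<in>f ` I. \<Sum>i | i \<in> I \<and> f i = x. \<Sum>j | j \<in> I \<and> f j = y. c i * c j * k x y)"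
      by (intro sum.cong refl) (rule sum.swap)
    also have "\<dots> = (\<Sum>x\<in>f ` I. \<Sum>y\<in>f ` I. b x * b y * k x y)"
      by (simp only: b_def sum_product) (simp only: sum_distrib_right)
    finally show ?thesis .
  qed
  then show "0 \<le> (\<Sum>i\<in>I. \<Sum>j\<in>I. c i * c j * k (f i) (f j))"
    using psd_kernelD[OF assms] I by simp
qed

section \<open>Operators on square integrable functions\<close>

lemma norm_add_square_le: "(cmod (a + b))\<^sup>2 \<le> 2 * (cmod a)\<^sup>2 + 2 * (cmod b)\<^sup>2"
proof -
  have "(cmod (a + b))\<^sup>2 \<le> (cmod a + cmod b)\<^sup>2"
    by (intro power_mono norm_triangle_ineq) simp
  also have "\<dots> \<le> 2 * (cmod a)\<^sup>2 + 2 * (cmod b)\<^sup>2"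
    using zero_le_power2[of "cmod a - cmod b"] by (simp add: power2_eq_square algebra_simps)
  finally show ?thesis .
qed

lemma borel_measurable_cnj [measurable (raw)]:
  assumes [measurable]: "f \<in> borel_measurable M"
  shows "(\<lambda>x. cnj (f x)) \<in> borel_measurable M"
  by (rule borel_measurable_continuous_on[OF _ assms]) (intro continuous_intros)

lemma L2_borel_measurable: "v \<in> L2 M \<Longrightarrow> v \<in> borel_measurable M"
  and L2_integrable_square: "v \<in> L2 M \<Longrightarrow> integrable M (\<lambda>x. (cmod (v x))\<^sup>2)"
  by (auto simp: L2_def)

lemma L2_norm_of_square: "(L2_norm_of M v)\<^sup>2 = (\<integral>x. (cmod (v x))\<^sup>2 \<partial>M)"
  by (simp add: L2_norm_of_def)

lemma L2_norm_of_nonneg: "0 \<le> L2_norm_of M v"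
  by (simp add: L2_norm_of_def)

lemma L2_lincomb:
  assumes "u \<in> L2 M" "v \<in> L2 M"
  shows "(\<lambda>x. a * u x + b * v x) \<in> L2 M"
proof -
  note [measurable] = assms[THEN L2_borel_measurable]
  have "integrable M (\<lambda>x. (cmod (a * u x + b * v x))\<^sup>2)"
  proof (rule Bochner_Integration.integrable_bound)
    show "integrable M (\<lambda>x. 2 * ((cmod a)\<^sup>2 * (cmod (u x))\<^sup>2) + 2 * ((cmod b)\<^sup>2 * (cmod (v x))\<^sup>2))"
      using assms by (simp add: L2_integrable_square)
    show "AE x in M. norm ((cmod (a * u x + b * v x))\<^sup>2)
        \<le> norm (2 * ((cmod a)\<^sup>2 * (cmod (u x))\<^sup>2) + 2 * ((cmod b)\<^sup>2 * (cmod (v x))\<^sup>2))"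
    proof (rule AE_I2)
      fix x
      show "norm ((cmod (a * u x + b * v x))\<^sup>2)
        \<le> norm (2 * ((cmod a)\<^sup>2 * (cmod (u x))\<^sup>2) + 2 * ((cmod b)\<^sup>2 * (cmod (v x))\<^sup>2))"
        using norm_add_square_le[of "a * u x" "b * v x"] by (simp add: norm_mult power_mult_distrib)
    qed
  qed measurable
  then show ?thesis by (simp add: L2_def)
qed

lemma L2_diff: "u \<in> L2 M \<Longrightarrow> v \<in> L2 M \<Longrightarrow> (\<lambda>x. u x - v x) \<in> L2 M"
  using L2_lincomb[of u M v 1 "-1"] by simp

lemma L2_zero: "(\<lambda>_. 0) \<in> L2 M"
  by (simp add: L2_def)

lemma L2_sum: "finite I \<Longrightarrow> (\<And>i. i \<in> I \<Longrightarrow> f i \<in> L2 M) \<Longrightarrow> (\<lambda>x. \<Sum>i\<in>I. f i x) \<in> L2 M"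
proof (induction I rule: finite_induct)
  case (insert i I)
  then show ?case using L2_lincomb[of "f i" M "\<lambda>x. \<Sum>i\<in>I. f i x" 1 1] by simp
qed (simp add: L2_zero)

lemma L2_integrable_mult_cnj:
  assumes "u \<in> L2 M" "v \<in> L2 M"
  shows "integrable M (\<lambda>x. u x * cnj (v x))"
proof (rule Bochner_Integration.integrable_bound)
  note [measurable] = assms[THEN L2_borel_measurable]
  show "integrable M (\<lambda>x. (cmod (u x))\<^sup>2 + (cmod (v x))\<^sup>2)"
    using assms by (simp add: L2_integrable_square)
  have "cmod a * cmod b \<le> (cmod a)\<^sup>2 + (cmod b)\<^sup>2" for a b
    using sum_squares_bound[of "cmod a" "cmod b"] mult_nonneg_nonneg[OF norm_ge_zero[of a] norm_ge_zero[of b]]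
    by linarith
  then show "AE x in M. norm (u x * cnj (v x)) \<le> norm ((cmod (u x))\<^sup>2 + (cmod (v x))\<^sup>2)"
    by (auto simp: norm_mult)
qed (use assms[THEN L2_borel_measurable] in measurable)

lemma L2_nn_integral_bound:
  assumes [measurable]: "v \<in> borel_measurable M" and "0 \<le> B"
    and bound: "(\<integral>\<^sup>+x. ennreal ((cmod (v x))\<^sup>2) \<partial>M) \<le> ennreal B"
  shows "v \<in> L2 M" "(\<integral>x. (cmod (v x))\<^sup>2 \<partial>M) \<le> B"
proof -
  have int: "integrable M (\<lambda>x. (cmod (v x))\<^sup>2)"
    using bound by (intro integrableI_bounded) (auto simp: le_less_trans[OF _ ennreal_less_top])
  then show "v \<in> L2 M" by (simp add: L2_def)
  show "(\<integral>x. (cmod (v x))\<^sup>2 \<partial>M) \<le> B"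
    using bound nn_integral_eq_integral[OF int] \<open>0 \<le> B\<close> by (simp add: ennreal_le_iff)
qed

lemma L2_boundedD:
  assumes "L2_bounded M T"
  shows "v \<in> L2 M \<Longrightarrow> T v \<in> L2 M"
    and "v \<in> L2 M \<Longrightarrow> w \<in> L2 M \<Longrightarrow> AE x in M. T (\<lambda>y. a * v y + b * w y) x = a * T v x + b * T w x"
  using assms by (auto simp: L2_bounded_def)

lemma L2_bounded_square:
  assumes "L2_bounded M T"
  obtains c where "0 < c" "\<And>v. v \<in> L2 M \<Longrightarrow> (\<integral>x. (cmod (T v x))\<^sup>2 \<partial>M) \<le> c\<^sup>2 * (\<integral>x. (cmod (v x))\<^sup>2 \<partial>M)"
proof -
  obtain C where C: "\<And>v. v \<in> L2 M \<Longrightarrow> L2_norm_of M (T v) \<le> C * L2_norm_of M v"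
    using assms unfolding L2_bounded_def by blast
  have "(\<integral>x. (cmod (T v x))\<^sup>2 \<partial>M) \<le> (max C 1)\<^sup>2 * (\<integral>x. (cmod (v x))\<^sup>2 \<partial>M)" if "v \<in> L2 M" for v
  proof -
    have "L2_norm_of M (T v) \<le> max C 1 * L2_norm_of M v"
      using C[OF that] mult_right_mono[of C "max C 1" "L2_norm_of M v"] L2_norm_of_nonneg[of M v] by simp
    then have "(L2_norm_of M (T v))\<^sup>2 \<le> (max C 1 * L2_norm_of M v)\<^sup>2"
      by (intro power_mono L2_norm_of_nonneg)
    then show ?thesis by (simp add: power_mult_distrib L2_norm_of_square)
  qed
  then show ?thesis using that[of "max C 1"] by simp
qed

lemma L2_boundedI:
  assumes "\<And>v. v \<in> L2 M \<Longrightarrow> T v \<in> L2 M"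
    and "\<And>v w a b. v \<in> L2 M \<Longrightarrow> w \<in> L2 M \<Longrightarrow>
       AE x in M. T (\<lambda>y. a * v y + b * w y) x = a * T v x + b * T w x"
    and "0 \<le> c" "\<And>v. v \<in> L2 M \<Longrightarrow> (\<integral>x. (cmod (T v x))\<^sup>2 \<partial>M) \<le> c\<^sup>2 * (\<integral>x. (cmod (v x))\<^sup>2 \<partial>M)"
  shows "L2_bounded M T"
proof -
  have "L2_norm_of M (T v) \<le> c * L2_norm_of M v" if "v \<in> L2 M" for v
    using real_sqrt_le_mono[OF assms(4)[OF that]] \<open>0 \<le> c\<close>
    by (simp add: L2_norm_of_def real_sqrt_mult)
  then show ?thesis using assms(1,2) by (auto simp: L2_bounded_def)
qed

lemma L2_square_eq_0_AE:
  assumes "v \<in> L2 M" "(\<integral>x. (cmod (v x))\<^sup>2 \<partial>M) \<le> 0"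
  shows "AE x in M. v x = 0"
proof -
  have "(\<integral>x. (cmod (v x))\<^sup>2 \<partial>M) = 0"
    using assms(2) by (intro antisym) auto
  then show ?thesis
    using integral_nonneg_eq_0_iff_AE[OF L2_integrable_square[OF assms(1)]] by simp
qed

lemma L2_bounded_cong_AE:
  assumes T: "L2_bounded M T" and uv: "u \<in> L2 M" "v \<in> L2 M" "AE x in M. u x = v x"
  shows "AE x in M. T u x = T v x"
proof -
  obtain c where c: "\<And>v. v \<in> L2 M \<Longrightarrow> (\<integral>x. (cmod (T v x))\<^sup>2 \<partial>M) \<le> c\<^sup>2 * (\<integral>x. (cmod (v x))\<^sup>2 \<partial>M)"
    using L2_bounded_square[OF T] by blast
  have d: "(\<lambda>x. 1 * u x + (-1) * v x) \<in> L2 M"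
    using uv by (intro L2_lincomb)
  have "(\<integral>x. (cmod (1 * u x + (-1) * v x))\<^sup>2 \<partial>M) = 0"
    using uv(3) by (intro integral_eq_zero_AE) auto
  then have "AE x in M. T (\<lambda>x. 1 * u x + (-1) * v x) x = 0"
    using L2_square_eq_0_AE[OF L2_boundedD(1)[OF T d]] c[OF d] by simp
  with L2_boundedD(2)[OF T uv(1,2), of 1 "-1"] show ?thesis
    by eventually_elim simp
qed

text \<open>The Cauchy--Schwarz inequality with the geometric weights \<open>q\<^sup>n\<close> and \<open>q\<^sup>-\<^sup>n\<close>. It converts
  geometric decay of \<open>L\<^sup>2\<close> norms into almost everywhere convergence with a rate.\<close>

lemma weighted_series_tail_bound:
  fixes c :: "nat \<Rightarrow> complex"
  assumes q: "0 < q" "q < 1" and sm: "summable (\<lambda>n. (cmod (c n))\<^sup>2 / q ^ n)"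
  shows "summable c"
    and "(cmod (suminf c - (\<Sum>n<N. c n)))\<^sup>2 \<le> q ^ N / (1 - q) * (\<Sum>n. (cmod (c n))\<^sup>2 / q ^ n)"
proof -
  define g where "g n = (cmod (c n))\<^sup>2 / q ^ n" for n
  have gsum: "summable g" and g0: "0 \<le> g n" for n
    using sm q by (simp_all add: g_def[abs_def])
  have le: "cmod (c n) \<le> (q ^ n + g n) / 2" for n
  proof -
    have "2 * cmod (c n) * q ^ n \<le> (cmod (c n))\<^sup>2 + (q ^ n)\<^sup>2"
      using sum_squares_bound[of "cmod (c n)" "q ^ n"] by simp
    then have "2 * cmod (c n) \<le> ((cmod (c n))\<^sup>2 + (q ^ n)\<^sup>2) / q ^ n"
      using q by (simp add: field_simps)
    also have "\<dots> = g n + q ^ n"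
      using q by (simp add: g_def power2_eq_square field_simps)
    finally show ?thesis by simp
  qed
  have "summable (\<lambda>n. cmod (c n))"
  proof (rule summable_comparison_test')
    show "summable (\<lambda>n. (q ^ n + g n) / 2)"
      using q gsum by (intro summable_divide summable_add summable_geometric) auto
    show "norm (cmod (c n)) \<le> (q ^ n + g n) / 2" for n
      using le[of n] by simp
  qed
  then show sc: "summable c" by (rule summable_norm_cancel)
  have fin: "(cmod ((\<Sum>n<N + K. c n) - (\<Sum>n<N. c n)))\<^sup>2 \<le> q ^ N / (1 - q) * suminf g" for K
  proof -
    have "(\<Sum>n<N + K. c n) - (\<Sum>n<N. c n) = (\<Sum>n\<in>{N..<N + K}. c n)"
      using sum_diff_nat_ivl[of 0 N "N + K" c] by (simp add: lessThan_atLeast0)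
    also have "cmod \<dots> \<le> (\<Sum>n\<in>{N..<N + K}. cmod (c n))"
      by (rule norm_sum)
    finally have "(cmod ((\<Sum>n<N + K. c n) - (\<Sum>n<N. c n)))\<^sup>2 \<le> (\<Sum>n\<in>{N..<N + K}. cmod (c n))\<^sup>2"
      by (intro power_mono) auto
    also have "(\<Sum>n\<in>{N..<N + K}. cmod (c n)) = (\<Sum>n\<in>{N..<N + K}. sqrt (q ^ n) * sqrt (g n))"
      using q by (intro sum.cong refl) (simp add: g_def real_sqrt_divide)
    also have "\<dots>\<^sup>2 \<le> (\<Sum>n\<in>{N..<N + K}. (sqrt (q ^ n))\<^sup>2) * (\<Sum>n\<in>{N..<N + K}. (sqrt (g n))\<^sup>2)"
      by (rule Cauchy_Schwarz_ineq_sum)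
    also have "\<dots> = (\<Sum>n\<in>{N..<N + K}. q ^ n) * (\<Sum>n\<in>{N..<N + K}. g n)"
      using q g0 by simp
    also have "\<dots> \<le> q ^ N / (1 - q) * suminf g"
    proof (intro mult_mono)
      have "(\<Sum>n\<in>{N..<N + K}. q ^ n) = q ^ N * (\<Sum>n<K. q ^ n)"
        by (subst sum.atLeastLessThan_shift_0)
           (simp add: power_add sum_distrib_left atLeast0LessThan)
      also have "\<dots> \<le> q ^ N * (1 / (1 - q))"
        using q sum_le_suminf[OF summable_geometric[of q], of "{..<K}"] suminf_geometric[of q]
        by (intro mult_left_mono) auto
      finally show "(\<Sum>n\<in>{N..<N + K}. q ^ n) \<le> q ^ N / (1 - q)" by simp
      show "(\<Sum>n\<in>{N..<N + K}. g n) \<le> suminf g"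
        using gsum g0 by (intro sum_le_suminf) auto
    qed (use q g0 in \<open>auto intro!: sum_nonneg\<close>)
    finally show ?thesis .
  qed
  have "(\<lambda>K. (cmod ((\<Sum>n<N + K. c n) - (\<Sum>n<N. c n)))\<^sup>2) \<longlonglongrightarrow> (cmod (suminf c - (\<Sum>n<N. c n)))\<^sup>2"
    using LIMSEQ_ignore_initial_segment[OF summable_LIMSEQ[OF sc], of N]
    by (intro tendsto_intros) (simp add: add.commute)
  then show "(cmod (suminf c - (\<Sum>n<N. c n)))\<^sup>2 \<le> q ^ N / (1 - q) * (\<Sum>n. (cmod (c n))\<^sup>2 / q ^ n)"
    using fin by (auto simp: g_def[abs_def] intro: LIMSEQ_le_const2)
qed

text \<open>The operator \<open>S\<close> is the sum of the powers of \<open>A\<close>, formed pointwise. The partial sums converge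
  at almost every point and in norm, by \<open>weighted_series_tail_bound\<close>, and this is what makes the sum
  a two-sided inverse of \<open>1 - A\<close>.\<close>

lemma L2_neumann_series:
  assumes A: "L2_bounded M A" and q: "0 < q" "q < 1"
    and contr: "\<And>v. v \<in> L2 M \<Longrightarrow> (\<integral>x. (cmod (A v x))\<^sup>2 \<partial>M) \<le> q\<^sup>2 * (\<integral>x. (cmod (v x))\<^sup>2 \<partial>M)"
  obtains S where "L2_bounded M S"
    "\<And>v. v \<in> L2 M \<Longrightarrow> AE x in M. S (\<lambda>y. v y - A v y) x = v x"
    "\<And>v. v \<in> L2 M \<Longrightarrow> AE x in M. S v x - A (S v) x = v x"
proof -
  define n2 where "n2 v = (\<integral>x. (cmod (v x))\<^sup>2 \<partial>M)" for v
  have n2_nonneg: "0 \<le> n2 v" for v by (simp add: n2_def)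
  define f where "f v n = (A ^^ n) v" for v n
  have f0: "f v 0 = v" and fS: "f v (Suc n) = A (f v n)" for v n
    by (simp_all add: f_def)
  have fL2: "f v n \<in> L2 M" if "v \<in> L2 M" for v n
    by (induction n) (use that L2_boundedD(1)[OF A] in \<open>auto simp: f0 fS\<close>)
  have fn2: "n2 (f v n) \<le> (q ^ n)\<^sup>2 * n2 v" if "v \<in> L2 M" for v n
  proof (induction n)
    case (Suc n)
    have "n2 (f v (Suc n)) \<le> q\<^sup>2 * n2 (f v n)"
      using contr[OF fL2[OF that]] by (simp add: n2_def fS)
    also have "\<dots> \<le> q\<^sup>2 * ((q ^ n)\<^sup>2 * n2 v)"
      using Suc by (intro mult_left_mono) auto
    finally show ?case by (simp add: power_mult_distrib mult_ac)
  qed (simp add: f0)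
  have f_lin: "AE x in M. \<forall>n. f (\<lambda>y. a * v y + b * w y) n x = a * f v n x + b * f w n x"
    if vw: "v \<in> L2 M" "w \<in> L2 M" for v w a b
  proof (subst AE_all_countable, intro allI)
    fix n
    show "AE x in M. f (\<lambda>y. a * v y + b * w y) n x = a * f v n x + b * f w n x"
    proof (induction n)
      case (Suc n)
      have "AE x in M. A (f (\<lambda>y. a * v y + b * w y) n) x = A (\<lambda>y. a * f v n y + b * f w n y) x"
        using Suc vw by (intro L2_bounded_cong_AE[OF A] fL2 L2_lincomb)
      with L2_boundedD(2)[OF A fL2[OF vw(1), of n] fL2[OF vw(2), of n], of a b]
      show ?case by eventually_elim (simp add: fS)
    qed (simp add: f0)
  qed
  \<comment> \<open>One integrable function that controls all tails of the series at once.\<close>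
  define H where "H v x = (\<Sum>n. ennreal ((cmod (f v n x))\<^sup>2 / q ^ n))" for v x
  have H_meas [measurable]: "H v \<in> borel_measurable M" if "v \<in> L2 M" for v
    using fL2[OF that, THEN L2_borel_measurable] unfolding H_def by measurable
  have H_int: "(\<integral>\<^sup>+x. H v x \<partial>M) \<le> ennreal (n2 v / (1 - q))" if v: "v \<in> L2 M" for v
  proof -
    note [measurable] = fL2[OF v, THEN L2_borel_measurable]
    have "(\<integral>\<^sup>+x. H v x \<partial>M) = (\<Sum>n. \<integral>\<^sup>+x. ennreal ((cmod (f v n x))\<^sup>2 / q ^ n) \<partial>M)"
      unfolding H_def by (intro nn_integral_suminf) measurable
    also have "\<dots> = (\<Sum>n. ennreal (n2 (f v n) / q ^ n))"
      using q L2_integrable_square[OF fL2[OF v]]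
      by (subst nn_integral_eq_integral) (auto simp: n2_def)
    also have "\<dots> \<le> (\<Sum>n. ennreal (n2 v * q ^ n))"
    proof (intro suminf_le ennreal_leI)
      show "n2 (f v n) / q ^ n \<le> n2 v * q ^ n" for n
        using fn2[OF v, of n] q by (simp add: power2_eq_square field_simps)
    qed auto
    also have "\<dots> = ennreal (\<Sum>n. n2 v * q ^ n)"
      using q n2_nonneg by (intro suminf_ennreal2) (auto intro!: summable_mult summable_geometric)
    also have "(\<Sum>n. n2 v * q ^ n) = n2 v / (1 - q)"
      using q by (simp add: suminf_mult suminf_geometric summable_geometric)
    finally show ?thesis .
  qed
  have H_fin: "AE x in M. summable (\<lambda>n. (cmod (f v n x))\<^sup>2 / q ^ n)
      \<and> H v x = ennreal (\<Sum>n. (cmod (f v n x))\<^sup>2 / q ^ n)" if v: "v \<in> L2 M" for v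
  proof -
    have "AE x in M. H v x \<noteq> \<infinity>"
      using H_int[OF v] by (intro nn_integral_PInf_AE H_meas v) (auto simp: top_unique)
    then show ?thesis
    proof eventually_elim
      case (elim x)
      then have "summable (\<lambda>n. (cmod (f v n x))\<^sup>2 / q ^ n)"
        using q unfolding H_def by (intro summable_suminf_not_top) auto
      moreover from this have "H v x = ennreal (\<Sum>n. (cmod (f v n x))\<^sup>2 / q ^ n)"
        using q unfolding H_def by (intro suminf_ennreal2) auto
      ultimately show ?case by simp
    qed
  qed
  define S where "S v x = (\<Sum>n. f v n x)" for v x
  define P where "P v N x = (\<Sum>n<N. f v n x)" for v N x
  have S_meas: "S v \<in> borel_measurable M" if "v \<in> L2 M" for v
    using fL2[OF that, THEN L2_borel_measurable] unfolding S_def[abs_def] by measurable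
  have P_L2: "P v N \<in> L2 M" if "v \<in> L2 M" for v N
    unfolding P_def[abs_def] using fL2[OF that] by (intro L2_sum) auto
  have summable_AE: "AE x in M. summable (\<lambda>n. f v n x)" if "v \<in> L2 M" for v
    using H_fin[OF that] by eventually_elim (rule weighted_series_tail_bound(1)[OF q conjunct1])
  have tail_nn: "(\<integral>\<^sup>+x. ennreal ((cmod (S v x - P v N x))\<^sup>2) \<partial>M) \<le> ennreal (q ^ N / (1 - q)\<^sup>2 * n2 v)"
    if v: "v \<in> L2 M" for v N
  proof -
    have "(\<integral>\<^sup>+x. ennreal ((cmod (S v x - P v N x))\<^sup>2) \<partial>M) \<le> (\<integral>\<^sup>+x. ennreal (q ^ N / (1 - q)) * H v x \<partial>M)"
    proof (intro nn_integral_mono_AE)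
      show "AE x in M. ennreal ((cmod (S v x - P v N x))\<^sup>2) \<le> ennreal (q ^ N / (1 - q)) * H v x"
        using H_fin[OF v]
      proof eventually_elim
        case (elim x)
        then have "(cmod (S v x - P v N x))\<^sup>2 \<le> q ^ N / (1 - q) * (\<Sum>n. (cmod (f v n x))\<^sup>2 / q ^ n)"
          unfolding S_def P_def by (intro weighted_series_tail_bound(2)[OF q]) auto
        then show ?case using q elim by (simp add: ennreal_mult'[symmetric] ennreal_leI)
      qed
    qed
    also have "\<dots> = ennreal (q ^ N / (1 - q)) * (\<integral>\<^sup>+x. H v x \<partial>M)"
      using H_meas[OF v] by (rule nn_integral_cmult)
    also have "\<dots> \<le> ennreal (q ^ N / (1 - q)) * ennreal (n2 v / (1 - q))"
      by (intro mult_left_mono H_int v) auto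
    also have "\<dots> = ennreal (q ^ N / (1 - q)\<^sup>2 * n2 v)"
      using q by (subst ennreal_mult'[symmetric]) (auto simp: power2_eq_square)
    finally show ?thesis .
  qed
  have S_L2: "S v \<in> L2 M" and S_n2: "n2 (S v) \<le> (1 / (1 - q))\<^sup>2 * n2 v" if v: "v \<in> L2 M" for v
  proof -
    have "P v 0 = (\<lambda>_. 0)" by (auto simp: P_def)
    then show "S v \<in> L2 M" "n2 (S v) \<le> (1 / (1 - q))\<^sup>2 * n2 v"
      using L2_nn_integral_bound[OF S_meas[OF v], of "1 / (1 - q)\<^sup>2 * n2 v"] tail_nn[OF v, of 0] q n2_nonneg[of v]
      by (simp_all add: n2_def power_divide)
  qed
  have tail: "n2 (\<lambda>x. S v x - P v N x) \<le> q ^ N / (1 - q)\<^sup>2 * n2 v" if v: "v \<in> L2 M" for v N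
    using L2_nn_integral_bound(2)[OF _ _ tail_nn[OF v, of N]] L2_borel_measurable[OF L2_diff[OF S_L2[OF v] P_L2[OF v]]] q n2_nonneg[of v]
    by (simp add: n2_def)
  have S_lin: "AE x in M. S (\<lambda>y. a * v y + b * w y) x = a * S v x + b * S w x"
    if "v \<in> L2 M" "w \<in> L2 M" for v w a b
    using f_lin[OF that, of a b] summable_AE[OF that(1)] summable_AE[OF that(2)]
    by eventually_elim (simp add: S_def suminf_add[symmetric] suminf_mult summable_mult)
  have bdd: "L2_bounded M S"
    using S_L2 S_lin S_n2 q by (intro L2_boundedI[where c = "1 / (1 - q)"]) (auto simp: n2_def)
  have left: "AE x in M. S (\<lambda>y. v y - A v y) x = v x" if v: "v \<in> L2 M" for v
  proof -
    have "f (A v) n = f v (Suc n)" for n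
      by (simp add: f_def funpow_swap1)
    note fA = this
    show ?thesis
      using f_lin[OF v L2_boundedD(1)[OF A v], of 1 "-1"] summable_AE[OF v]
    proof eventually_elim
      case (elim x)
      have "(\<lambda>n. f v n x - f v (Suc n) x) sums (f v 0 x - 0)"
        using elim(2) by (intro telescope_sums' summable_LIMSEQ_zero)
      then show ?case
        using elim(1) by (simp add: S_def f0 fA sums_iff)
    qed
  qed
  have right: "AE x in M. S v x - A (S v) x = v x" if v: "v \<in> L2 M" for v
  proof -
    have PS: "P v (Suc N) x = P v N x + f v N x" for N x
      by (simp add: P_def)
    have AP: "AE x in M. A (P v N) x = P v (Suc N) x - v x" for N
    proof (induction N)
      case 0
      have "P v 0 = (\<lambda>_. 0)" by (auto simp: P_def)
      with L2_boundedD(2)[OF A v v, of 0 0] show ?case by (simp add: P_def f0)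
    next
      case (Suc N)
      have "P v (Suc N) = (\<lambda>y. 1 * P v N y + 1 * f v N y)" by (auto simp: P_def)
      with L2_boundedD(2)[OF A P_L2[OF v, of N] fL2[OF v, of N], of 1 1]
      have "AE x in M. A (P v (Suc N)) x = 1 * A (P v N) x + 1 * A (f v N) x" by (simp only:)
      with Suc show ?case
      proof eventually_elim
        case (elim x)
        then show ?case using PS[of "Suc N" x] by (simp add: fS)
      qed
    qed
    define r where "r x = S v x - v x - A (S v) x" for x
    have AS: "A (S v) \<in> L2 M" by (intro L2_boundedD(1)[OF A] S_L2 v)
    have rL2: "r \<in> L2 M"
      unfolding r_def[abs_def] by (intro L2_diff S_L2 v AS)
    have bound: "n2 r \<le> q ^ N * (4 / (1 - q)\<^sup>2 * n2 v)" for N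
    proof -
      define e where "e N x = S v x - P v N x" for N x
      have eL2: "e N \<in> L2 M" for N unfolding e_def[abs_def] by (intro L2_diff S_L2 P_L2 v)
      have "AE x in M. r x = e (Suc N) x - A (e N) x"
        using AP[of N] L2_boundedD(2)[OF A S_L2[OF v] P_L2[OF v], of 1 "-1" N]
        by eventually_elim (simp add: r_def e_def[abs_def])
      then have "n2 r = n2 (\<lambda>x. e (Suc N) x - A (e N) x)"
        unfolding n2_def using L2_borel_measurable[OF rL2]
          L2_borel_measurable[OF L2_diff[OF eL2 L2_boundedD(1)[OF A eL2]], of "Suc N" N]
        by (intro integral_cong_AE) auto
      also have "\<dots> \<le> (\<integral>x. 2 * (cmod (e (Suc N) x))\<^sup>2 + 2 * (cmod (A (e N) x))\<^sup>2 \<partial>M)"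
        unfolding n2_def
      proof (rule integral_mono)
        show "integrable M (\<lambda>x. (cmod (e (Suc N) x - A (e N) x))\<^sup>2)"
          by (rule L2_integrable_square[OF L2_diff[OF eL2 L2_boundedD(1)[OF A eL2]]])
        show "integrable M (\<lambda>x. 2 * (cmod (e (Suc N) x))\<^sup>2 + 2 * (cmod (A (e N) x))\<^sup>2)"
          by (simp add: L2_integrable_square eL2 L2_boundedD(1)[OF A])
        show "(cmod (e (Suc N) x - A (e N) x))\<^sup>2
            \<le> 2 * (cmod (e (Suc N) x))\<^sup>2 + 2 * (cmod (A (e N) x))\<^sup>2" for x
          using norm_add_square_le[of "e (Suc N) x" "- A (e N) x"] by simp
      qed
      also have "\<dots> = 2 * n2 (e (Suc N)) + 2 * n2 (A (e N))"
        unfolding n2_def by (simp add: L2_integrable_square eL2 L2_boundedD(1)[OF A])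
      also have "n2 (A (e N)) \<le> n2 (e N)"
      proof -
        have "q\<^sup>2 \<le> 1" using q by (simp add: power_le_one)
        then show ?thesis
          using contr[OF eL2[of N]] mult_right_mono[of "q\<^sup>2" 1 "n2 (e N)"] n2_nonneg[of "e N"]
          by (simp add: n2_def)
      qed
      also have "n2 (e (Suc N)) \<le> q ^ N / (1 - q)\<^sup>2 * n2 v"
      proof -
        have "q ^ Suc N / (1 - q)\<^sup>2 \<le> q ^ N / (1 - q)\<^sup>2"
          using q by (intro divide_right_mono) (auto simp: mult_left_le_one_le)
        from mult_right_mono[OF this n2_nonneg[of v]] show ?thesis
          using tail[OF v, of "Suc N"] by (simp only: e_def[abs_def])
      qed
      also have "n2 (e N) \<le> q ^ N / (1 - q)\<^sup>2 * n2 v"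
        using tail[OF v, of N] by (simp add: e_def[abs_def])
      finally show ?thesis by (simp add: algebra_simps)
    qed
    have "n2 r \<le> 0"
    proof (rule LIMSEQ_le_const)
      show "(\<lambda>N. q ^ N * (4 / (1 - q)\<^sup>2 * n2 v)) \<longlonglongrightarrow> 0"
        using q by (intro tendsto_mult_left_zero LIMSEQ_power_zero) auto
    qed (use bound in auto)
    then have "AE x in M. r x = 0"
      using L2_square_eq_0_AE[OF rL2] by (simp add: n2_def)
    then show ?thesis by eventually_elim (simp add: r_def algebra_simps)
  qed
  show ?thesis using that bdd left right by blast
qed

text \<open>Let \<open>c\<close> bound the norm of \<open>T\<close>. Positivity and symmetry give \<open>\<parallel>T u\<parallel>\<^sup>2 \<le> c \<langle>T u, u\<rangle>\<close>, hence
  \<open>\<parallel>w u - T u\<parallel> \<le> \<bar>w\<bar> \<parallel>u\<parallel>\<close> whenever the real part of \<open>w\<close> is \<open>c / 2\<close>. Any \<open>z\<close> outside \<open>[0, \<infinity>)\<close> is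
  farther than \<open>\<bar>w\<bar>\<close> from a suitable such \<open>w\<close>, so \<open>T - z = (w - z) (1 - (w - T) / (w - z))\<close> is
  inverted by a Neumann series.\<close>

lemma L2_positive_of_form:
  assumes T: "L2_bounded M T"
    and sym: "\<And>u v. u \<in> L2 M \<Longrightarrow> v \<in> L2 M \<Longrightarrow>
      (\<integral>x. T u x * cnj (v x) \<partial>M) = (\<integral>x. u x * cnj (T v x) \<partial>M)"
    and pos: "\<And>u. u \<in> L2 M \<Longrightarrow> 0 \<le> Re (\<integral>x. T u x * cnj (u x) \<partial>M)"
  shows "L2_positive M T"
proof -
  define n2 where "n2 v = (\<integral>x. (cmod (v x))\<^sup>2 \<partial>M)" for v
  define E where "E u v = (\<integral>x. u x * cnj (v x) \<partial>M)" for u v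
  obtain c where c: "0 < c" "\<And>v. v \<in> L2 M \<Longrightarrow> n2 (T v) \<le> c\<^sup>2 * n2 v"
    using L2_bounded_square[OF T] unfolding n2_def by blast
  note TL2 = L2_boundedD(1)[OF T]
  have E_self: "E v v = of_real (n2 v)" for v
    unfolding E_def n2_def by (simp add: complex_norm_square[symmetric] del: of_real_power)
  have E_lin: "E (\<lambda>x. a * u x + b * v x) w = a * E u w + b * E v w"
    if "u \<in> L2 M" "v \<in> L2 M" "w \<in> L2 M" for u v w a b
    using L2_integrable_mult_cnj[OF that(1,3)] L2_integrable_mult_cnj[OF that(2,3)]
    by (simp add: E_def distrib_right mult.assoc)
  have E_cnj: "E v u = cnj (E u v)" for u v
  proof -
    have "E v u = (\<integral>x. cnj (u x * cnj (v x)) \<partial>M)" by (simp add: E_def mult.commute)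
    also have "\<dots> = cnj (E u v)" unfolding E_def by (rule Bochner_Integration.integral_cnj)
    finally show ?thesis .
  qed
  have E_cong: "E u w = E v w" if "AE x in M. u x = v x" "u \<in> L2 M" "v \<in> L2 M" "w \<in> L2 M" for u v w
    unfolding E_def using that(1) that(2-4)[THEN L2_borel_measurable]
    by (intro integral_cong_AE) auto
  have E_real: "Im (E (T u) u) = 0" if "u \<in> L2 M" for u
    using sym[OF that that] E_cnj[of "T u" u] by (simp add: E_def complex_eq_iff)
  have E_bound: "Re (E (T u) u) \<le> c * n2 u" if u: "u \<in> L2 M" for u
  proof -
    have ineq: "Re (a * cnj b) \<le> (cmod a)\<^sup>2 / (2 * c) + c / 2 * (cmod b)\<^sup>2" for a b
    proof -
      have "2 * cmod a * (c * cmod b) \<le> (cmod a)\<^sup>2 + (c * cmod b)\<^sup>2"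
        by (rule sum_squares_bound)
      then have "cmod a * cmod b \<le> ((cmod a)\<^sup>2 + (c * cmod b)\<^sup>2) / (2 * c)"
        using c(1) by (simp add: field_simps)
      also have "\<dots> = (cmod a)\<^sup>2 / (2 * c) + c / 2 * (cmod b)\<^sup>2"
        using c(1) by (simp add: field_simps power2_eq_square)
      finally show ?thesis
        using complex_Re_le_cmod[of "a * cnj b"] by (simp add: norm_mult)
    qed
    have "Re (E (T u) u) = (\<integral>x. Re (T u x * cnj (u x)) \<partial>M)"
      unfolding E_def by (rule integral_Re[symmetric]) (rule L2_integrable_mult_cnj[OF TL2[OF u] u])
    also have "\<dots> \<le> (\<integral>x. (cmod (T u x))\<^sup>2 / (2 * c) + c / 2 * (cmod (u x))\<^sup>2 \<partial>M)"
    proof (rule integral_mono)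
      show "integrable M (\<lambda>x. Re (T u x * cnj (u x)))"
        by (rule integrable_Re) (rule L2_integrable_mult_cnj[OF TL2[OF u] u])
      show "integrable M (\<lambda>x. (cmod (T u x))\<^sup>2 / (2 * c) + c / 2 * (cmod (u x))\<^sup>2)"
        using L2_integrable_square[OF u] L2_integrable_square[OF TL2[OF u]] by simp
    qed (rule ineq)
    also have "\<dots> = n2 (T u) / (2 * c) + c / 2 * n2 u"
      using L2_integrable_square[OF u] L2_integrable_square[OF TL2[OF u]] by (simp add: n2_def)
    also have "\<dots> \<le> c\<^sup>2 * n2 u / (2 * c) + c / 2 * n2 u"
      using c(1) c(2)[OF u] by (intro add_right_mono divide_right_mono) auto
    also have "\<dots> = c * n2 u"
      using c(1) by (simp add: field_simps power2_eq_square)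
    finally show ?thesis .
  qed
  have form_bound: "n2 (T u) \<le> c * Re (E (T u) u)" if u: "u \<in> L2 M" for u
  proof -
    \<comment> \<open>The form at \<open>u - T u / c\<close> is nonnegative.\<close>
    define a where "a = complex_of_real (- 1 / c)"
    define f where "f = (\<lambda>x. 1 * u x + a * T u x)"
    note Tu = TL2[OF u] and TTu = TL2[OF TL2[OF u]]
    have f: "f \<in> L2 M" unfolding f_def by (rule L2_lincomb[OF u Tu])
    have lin: "AE x in M. T f x = 1 * T u x + a * T (T u) x"
      unfolding f_def by (rule L2_boundedD(2)[OF T u Tu])
    have "E (T f) f = 1 * E (T u) f + a * E (T (T u)) f"
      by (rule trans[OF E_cong[OF lin TL2[OF f] L2_lincomb[OF Tu TTu] f] E_lin[OF Tu TTu f]])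
    moreover have "E w f = E w u + a * E w (T u)" if w: "w \<in> L2 M" for w
    proof -
      have "E f w = 1 * E u w + a * E (T u) w" unfolding f_def by (rule E_lin[OF u Tu w])
      then show ?thesis unfolding E_cnj[of w] by (simp add: a_def)
    qed
    moreover have "E (T (T u)) u = E (T u) (T u)"
      using sym[OF Tu u] by (simp add: E_def)
    ultimately have "E (T f) f = E (T u) u + 2 * a * of_real (n2 (T u)) + a * a * E (T (T u)) (T u)"
      using Tu TTu by (simp add: E_self algebra_simps)
    then have "0 \<le> Re (E (T u) u) - 2 / c * n2 (T u) + 1 / c * (1 / c) * Re (E (T (T u)) (T u))"
      using pos[OF f] by (simp add: E_def a_def)
    also have "1 / c * (1 / c) * Re (E (T (T u)) (T u)) \<le> 1 / c * (1 / c) * (c * n2 (T u))"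
      using c(1) E_bound[OF Tu] by (intro mult_left_mono) auto
    also have "1 / c * (1 / c) * (c * n2 (T u)) = 1 / c * n2 (T u)"
      using c(1) by simp
    finally have "0 \<le> Re (E (T u) u) - 1 / c * n2 (T u)" by (simp add: field_simps)
    then show ?thesis using c(1) by (simp add: field_simps)
  qed
  have "z \<notin> L2_spectrum M T" if z: "z \<notin> \<real>\<^sub>\<ge>\<^sub>0" for z
  proof -
    obtain w where w: "Re w = c / 2" "cmod w < cmod (w - z)"
    proof -
      have sq: "(cmod (w - z))\<^sup>2 = (cmod w)\<^sup>2 + (cmod z)\<^sup>2 - 2 * (Re w * Re z + Im w * Im z)" for w
        unfolding cmod_power2 by (simp add: power2_eq_square algebra_simps)
      \<comment> \<open>The vectors \<open>w\<close> and \<open>z\<close> must enclose at least a right angle in the plane. If \<open>Im z \<noteq> 0\<close> this \<open>b\<close>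
        makes them orthogonal; otherwise \<open>z\<close> is a negative real number and any \<open>w\<close> with positive real part will do.\<close>
      define b where "b = (if Im z = 0 then 0 else (- c / 2 * Re z) / Im z)"
      define w where "w = Complex (c / 2) b"
      have "Re w * Re z + Im w * Im z \<le> 0"
      proof (cases "Im z = 0")
        case True
        then have "Re z < 0" using z by (auto simp: complex_nonneg_Reals_iff)
        then show ?thesis using True c(1) by (simp add: w_def b_def mult_le_0_iff)
      qed (simp add: w_def b_def)
      moreover have "0 < (cmod z)\<^sup>2" using z by auto
      ultimately have "(cmod w)\<^sup>2 < (cmod (w - z))\<^sup>2"
        unfolding sq by (smt (verit))
      then have "cmod w < cmod (w - z)" by (rule power_less_imp_less_base) simp
      then show ?thesis using that[of w] by (simp add: w_def)
    qed
    define d where "d = w - z"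
    have d: "d \<noteq> 0" "cmod w < cmod d" using w by (auto simp: d_def)
    have w0: "0 < cmod w" using w(1) c(1) by auto
    define A where "A v = (\<lambda>x. w / d * v x + (- 1 / d) * T v x)" for v
    have A_L2: "A v \<in> L2 M" if "v \<in> L2 M" for v
      unfolding A_def by (rule L2_lincomb[OF that TL2[OF that]])
    have A_contr: "n2 (A v) \<le> (cmod w / cmod d)\<^sup>2 * n2 v" if v: "v \<in> L2 M" for v
    proof -
      note Tv = TL2[OF v]
      have E1: "E (A v) u = w / d * E v u + (- 1 / d) * E (T v) u" if "u \<in> L2 M" for u
        unfolding A_def by (rule E_lin[OF v Tv that])
      have e: "E v (T v) = E (T v) v" using sym[OF v v] by (simp add: E_def)
      have Av: "E u (A v) = cnj (w / d) * E u v + cnj (- 1 / d) * E u (T v)" if "u \<in> L2 M" for u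
        using E1[OF that] unfolding E_cnj[of u] by simp
      have "of_real (n2 (A v)) = E (A v) (A v)" by (simp add: E_self)
      also have "\<dots> = (w / d) * (cnj (w / d) * E v v + cnj (- 1 / d) * E v (T v)) +
          (- 1 / d) * (cnj (w / d) * E (T v) v + cnj (- 1 / d) * E (T v) (T v))"
        by (simp only: E1[OF A_L2[OF v]] Av[OF v] Av[OF Tv])
      also have "\<dots> = (w * cnj w * E v v - (w + cnj w) * E (T v) v + E (T v) (T v)) / (d * cnj d)"
        using d by (simp add: e field_simps)
      also have "w + cnj w = of_real c"
        using w(1) by (simp add: complex_eq_iff)
      also have "E (T v) v = of_real (Re (E (T v) v))"
        using E_real[OF v] by (simp add: complex_eq_iff)
      also have "(w * cnj w * E v v - of_real c * of_real (Re (E (T v) v)) + E (T v) (T v)) / (d * cnj d)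
         = of_real (((cmod w)\<^sup>2 * n2 v - c * Re (E (T v) v) + n2 (T v)) / (cmod d)\<^sup>2)"
        by (simp add: E_self complex_norm_square del: of_real_power)
      finally have "n2 (A v) = ((cmod w)\<^sup>2 * n2 v - c * Re (E (T v) v) + n2 (T v)) / (cmod d)\<^sup>2"
        by (simp only: of_real_eq_iff)
      also have "\<dots> \<le> ((cmod w)\<^sup>2 * n2 v) / (cmod d)\<^sup>2"
        using form_bound[OF v] by (intro divide_right_mono) auto
      finally show ?thesis by (simp add: power_divide)
    qed
    have A_bdd: "L2_bounded M A"
    proof (rule L2_boundedI)
      show "AE x in M. A (\<lambda>y. a * v y + b * u y) x = a * A v x + b * A u x"
        if "v \<in> L2 M" "u \<in> L2 M" for v u a b
        using L2_boundedD(2)[OF T that, of a b] by eventually_elim (simp add: A_def algebra_simps add_divide_distrib)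
      show "(\<integral>x. (cmod (A v x))\<^sup>2 \<partial>M) \<le> (cmod w / cmod d)\<^sup>2 * (\<integral>x. (cmod (v x))\<^sup>2 \<partial>M)"
        if "v \<in> L2 M" for v
        using A_contr[OF that] by (simp add: n2_def)
    qed (use A_L2 in auto)
    obtain S where S: "L2_bounded M S"
        "\<And>v. v \<in> L2 M \<Longrightarrow> AE x in M. S (\<lambda>y. v y - A v y) x = v x"
        "\<And>v. v \<in> L2 M \<Longrightarrow> AE x in M. S v x - A (S v) x = v x"
    proof (rule L2_neumann_series[OF A_bdd])
      show "0 < cmod w / cmod d" "cmod w / cmod d < 1"
        using w0 d by (auto simp: divide_less_eq)
      show "(\<integral>x. (cmod (A v x))\<^sup>2 \<partial>M) \<le> (cmod w / cmod d)\<^sup>2 * (\<integral>x. (cmod (v x))\<^sup>2 \<partial>M)"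
        if "v \<in> L2 M" for v
        using A_contr[OF that] by (simp add: n2_def)
    qed blast
    note SL2 = L2_boundedD(1)[OF S(1)]
    have shift: "T v x - z * v x = d * (v x - A v x)" for v x
    proof -
      have "d * (v x - A v x) = d * v x - w * v x + T v x"
        using d(1) by (simp add: A_def algebra_simps)
      then show ?thesis by (simp add: d_def algebra_simps)
    qed
    define R where "R v = (\<lambda>x. S v x / d)" for v
    have R_alt: "R v = (\<lambda>x. (1 / d) * S v x + 0 * S v x)" for v
      by (simp add: R_def)
    have RL2: "R v \<in> L2 M" if "v \<in> L2 M" for v
      unfolding R_alt by (intro L2_lincomb SL2 that)
    obtain k where k: "0 < k" "\<And>v. v \<in> L2 M \<Longrightarrow> n2 (S v) \<le> k\<^sup>2 * n2 v"
      using L2_bounded_square[OF S(1)] unfolding n2_def by blast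
    have "L2_bounded M R"
    proof (rule L2_boundedI[where c = "k / cmod d"])
      show "AE x in M. R (\<lambda>y. a * v y + b * u y) x = a * R v x + b * R u x"
        if "v \<in> L2 M" "u \<in> L2 M" for v u a b
        using L2_boundedD(2)[OF S(1) that, of a b] by eventually_elim (simp add: R_def add_divide_distrib)
      have "n2 (R v) = n2 (S v) / (cmod d)\<^sup>2" for v
        by (simp add: n2_def R_def norm_divide power_divide)
      then show "(\<integral>x. (cmod (R v x))\<^sup>2 \<partial>M) \<le> (k / cmod d)\<^sup>2 * (\<integral>x. (cmod (v x))\<^sup>2 \<partial>M)"
        if "v \<in> L2 M" for v
        using k(2)[OF that] by (simp add: n2_def power_divide divide_right_mono)
    qed (use RL2 k in auto)
    moreover have "(\<lambda>x. T v x - z * v x) \<in> L2 M"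
      "AE x in M. R (\<lambda>y. T v y - z * v y) x = v x"
      "AE x in M. T (R v) x - z * R v x = v x" if v: "v \<in> L2 M" for v
    proof -
      show "(\<lambda>x. T v x - z * v x) \<in> L2 M"
        using L2_lincomb[OF TL2[OF v] v, of 1 "- z"] by simp
      have dv: "(\<lambda>x. v x - A v x) \<in> L2 M" by (rule L2_diff[OF v A_L2[OF v]])
      have "(\<lambda>y. T v y - z * v y) = (\<lambda>y. d * (v y - A v y) + 0 * (v y - A v y))"
        by (simp add: shift)
      with L2_boundedD(2)[OF S(1) dv dv, of d 0]
      have "AE x in M. S (\<lambda>y. T v y - z * v y) x = d * S (\<lambda>y. v y - A v y) x + 0 * S (\<lambda>y. v y - A v y) x"
        by (simp only:)
      with S(2)[OF v] show "AE x in M. R (\<lambda>y. T v y - z * v y) x = v x"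
        by eventually_elim (simp add: R_def d(1))
      have "AE x in M. A (R v) x = (1 / d) * A (S v) x + 0 * A (S v) x"
        unfolding R_alt by (rule L2_boundedD(2)[OF A_bdd SL2[OF v] SL2[OF v]])
      with S(3)[OF v] show "AE x in M. T (R v) x - z * R v x = v x"
      proof eventually_elim
        case (elim x)
        have "T (R v) x - z * R v x = d * (R v x - A (R v) x)" by (rule shift)
        also have "\<dots> = S v x - A (S v) x"
          using d(1) elim(2) by (simp add: R_def right_diff_distrib)
        finally show ?case using elim(1) by simp
      qed
    qed
    ultimately show ?thesis
      unfolding L2_spectrum_def by blast
  qed
  then show ?thesis unfolding L2_positive_def by blast
qed

lemma L2_positive_zero: "L2_positive M (\<lambda>_ _. 0)"
  by (rule L2_positive_of_form) (auto simp: L2_bounded_def L2_zero L2_norm_of_def intro!: exI[of _ 0])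

text \<open>The spectrum depends only on the class of square integrable functions, the null sets, and the
  norm up to equivalence.\<close>

lemma L2_spectrum_cong_measure:
  assumes L2: "L2 N = L2 M" and ae: "ae_filter N = ae_filter M" and k: "0 < k"
    and norms: "\<And>v. v \<in> L2 M \<Longrightarrow> L2_norm_of N v \<le> k * L2_norm_of M v"
      "\<And>v. v \<in> L2 M \<Longrightarrow> L2_norm_of M v \<le> k * L2_norm_of N v"
  shows "L2_spectrum N T = L2_spectrum M T"
proof -
  have "L2_bounded N S = L2_bounded M S" for S
  proof -
    have "(\<exists>C. \<forall>v\<in>L2 M. L2_norm_of N (S v) \<le> C * L2_norm_of N v) \<longleftrightarrow>
          (\<exists>C. \<forall>v\<in>L2 M. L2_norm_of M (S v) \<le> C * L2_norm_of M v)" if S: "\<forall>v\<in>L2 M. S v \<in> L2 M"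
    proof -
      have "\<exists>C. \<forall>v\<in>L2 M. n' (S v) \<le> C * n' v"
        if n: "\<And>v. v \<in> L2 M \<Longrightarrow> n' v \<le> k * n v" "\<And>v. v \<in> L2 M \<Longrightarrow> n v \<le> k * n' v"
          "\<And>v. 0 \<le> n v" "\<exists>C. \<forall>v\<in>L2 M. n (S v) \<le> C * n v" for n n' :: "('a \<Rightarrow> complex) \<Rightarrow> real"
      proof -
        obtain C where C: "\<And>v. v \<in> L2 M \<Longrightarrow> n (S v) \<le> C * n v" using n(4) by blast
        have "n' (S v) \<le> (k * max C 0 * k) * n' v" if v: "v \<in> L2 M" for v
        proof -
          have "n' (S v) \<le> k * n (S v)" using n(1) S v by blast
          also have "n (S v) \<le> max C 0 * n v"
            using C[OF v] mult_right_mono[OF _ n(3)[of v], of C "max C 0"] by simp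
          also have "max C 0 * n v \<le> max C 0 * (k * n' v)"
            using n(2)[OF v] by (intro mult_left_mono) auto
          finally show ?thesis using k by (simp add: mult_ac)
        qed
        then show ?thesis by blast
      qed
      from this[of "L2_norm_of N" "L2_norm_of M"] this[of "L2_norm_of M" "L2_norm_of N"] norms
      show ?thesis by (auto simp: L2_norm_of_nonneg)
    qed
    then show ?thesis unfolding L2_bounded_def L2 ae by blast
  qed
  then show ?thesis unfolding L2_spectrum_def L2 ae by simp
qed

section \<open>Reversible averaging operators\<close>

lemma (in pair_sigma_finite) integrable_product_mult:
  fixes f :: "'a \<Rightarrow> complex" and g :: "'b \<Rightarrow> complex"
  assumes f: "integrable M1 f" and g: "integrable M2 g"
  shows "integrable (M1 \<Otimes>\<^sub>M M2) (\<lambda>(x, y). f x * g y)"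
    and "(\<integral>(x, y). f x * g y \<partial>(M1 \<Otimes>\<^sub>M M2)) = integral\<^sup>L M1 f * integral\<^sup>L M2 g"
proof -
  show int: "integrable (M1 \<Otimes>\<^sub>M M2) (\<lambda>(x, y). f x * g y)"
  proof (rule Fubini_integrable)
    show "(\<lambda>(x, y). f x * g y) \<in> borel_measurable (M1 \<Otimes>\<^sub>M M2)"
      using f g by measurable
    show "integrable M1 (\<lambda>x. \<integral>y. norm (case (x, y) of (x, y) \<Rightarrow> f x * g y) \<partial>M2)"
      using f by (simp add: norm_mult)
    show "AE x in M1. integrable M2 (\<lambda>y. case (x, y) of (x, y) \<Rightarrow> f x * g y)"
      using g by simp
  qed
  show "(\<integral>(x, y). f x * g y \<partial>(M1 \<Otimes>\<^sub>M M2)) = integral\<^sup>L M1 f * integral\<^sup>L M2 g"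
    using integral_fst'[OF int] by simp
qed

lemma (in finite_measure) L2_integrable:
  assumes "u \<in> L2 M"
  shows "integrable M u"
proof (rule Bochner_Integration.integrable_bound)
  show "integrable M (\<lambda>x. 1 + (cmod (u x))\<^sup>2)"
    using L2_integrable_square[OF assms] by simp
  show "AE x in M. norm (u x) \<le> norm (1 + (cmod (u x))\<^sup>2)"
  proof (rule AE_I2)
    fix x
    have "2 * cmod (u x) \<le> (cmod (u x))\<^sup>2 + 1"
      using sum_squares_bound[of "cmod (u x)" 1] by simp
    then have "cmod (u x) \<le> 1 + (cmod (u x))\<^sup>2"
      using norm_ge_zero[of "u x"] by linarith
    then show "norm (u x) \<le> norm (1 + (cmod (u x))\<^sup>2)" by simp
  qed
qed (rule L2_borel_measurable[OF assms])

lemma psd_kernel_hermitian_form: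
  assumes "psd_kernel L" "finite I"
  shows "0 \<le> Re (\<Sum>i\<in>I. \<Sum>j\<in>I. of_real (L i j) * (a j * cnj (a i)))"
proof -
  have "Re (\<Sum>i\<in>I. \<Sum>j\<in>I. of_real (L i j) * (a j * cnj (a i))) =
     (\<Sum>i\<in>I. \<Sum>j\<in>I. Re (a i) * Re (a j) * L i j) + (\<Sum>i\<in>I. \<Sum>j\<in>I. Im (a i) * Im (a j) * L i j)"
    by (simp add: sum.distrib[symmetric] algebra_simps)
  then show ?thesis
    using psd_kernelD[OF assms, of "\<lambda>i. Re (a i)"] psd_kernelD[OF assms, of "\<lambda>i. Im (a i)"] by simp
qed

text \<open>The kernel depends only on the countably many cells \<open>idx = i\<close>. Restricted to the first \<open>N\<close> cells
  the double integral is the hermitian form of \<open>L\<close> at the vector of integrals of \<open>u\<close> over the cells;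
  then \<open>N\<close> tends to infinity.\<close>

lemma (in finite_measure) psd_kernel_integral_nonneg:
  fixes idx :: "'a \<Rightarrow> nat" and L :: "nat \<Rightarrow> nat \<Rightarrow> real"
  assumes idx [measurable]: "idx \<in> M \<rightarrow>\<^sub>M count_space UNIV"
    and psd: "psd_kernel L" and bound: "\<And>i j. \<bar>L i j\<bar> \<le> B" and u: "integrable M u"
  shows "0 \<le> Re (\<integral>(x, y). of_real (L (idx x) (idx y)) * (u y * cnj (u x)) \<partial>(M \<Otimes>\<^sub>M M))"
proof -
  interpret pair_sigma_finite M M ..
  have [measurable]: "u \<in> borel_measurable M" using u by auto
  have L_meas [measurable]: "(\<lambda>(x, y). L (idx x) (idx y)) \<in> borel_measurable (M \<Otimes>\<^sub>M M)"
    by measurable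
  define f where "f N = (\<lambda>(x, y). if idx x < N \<and> idx y < N then of_real (L (idx x) (idx y)) * (u y * cnj (u x)) else 0)" for N
  define p where "p i x = (if idx x = i then u x else 0)" for i x
  have p_int: "integrable M (p i)" for i
    by (rule Bochner_Integration.integrable_bound[OF u]) (auto simp: p_def[abs_def])
  have pc_int: "integrable M (\<lambda>x. cnj (p i x))" for i
    using p_int by simp
  have "0 \<le> Re (integral\<^sup>L (M \<Otimes>\<^sub>M M) (f N))" for N
  proof -
    have f_eq: "f N = (\<lambda>z. \<Sum>i<N. \<Sum>j<N. of_real (L i j) * (case z of (x, y) \<Rightarrow> cnj (p i x) * p j y))"
    proof (rule ext)
      fix z :: "'a \<times> 'a"
      obtain x y where z: "z = (x, y)" by (cases z)
      have "(\<Sum>j<N. of_real (L i j) * (cnj (p i x) * p j y)) =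
        (if idx x = i then (if idx y < N then of_real (L i (idx y)) * (cnj (u x) * u y) else 0) else 0)" for i
      proof -
        have "(\<Sum>j<N. of_real (L i j) * (cnj (p i x) * p j y)) =
          (\<Sum>j<N. if idx y = j then (if idx x = i then of_real (L i j) * (cnj (u x) * u y) else 0) else 0)"
          by (intro sum.cong refl) (simp add: p_def)
        then show ?thesis by simp
      qed
      then show "f N z = (\<Sum>i<N. \<Sum>j<N. of_real (L i j) * (case z of (x, y) \<Rightarrow> cnj (p i x) * p j y))"
        by (simp add: f_def z mult_ac)
    qed
    have "integral\<^sup>L (M \<Otimes>\<^sub>M M) (f N) = (\<Sum>i<N. \<Sum>j<N. of_real (L i j) * (cnj (integral\<^sup>L M (p i)) * integral\<^sup>L M (p j)))"
      unfolding f_eq using integrable_product_mult[OF pc_int p_int]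
      by (simp add: Bochner_Integration.integral_cnj)
    then show ?thesis
      using psd_kernel_hermitian_form[OF psd, of "{..<N}" "\<lambda>i. integral\<^sup>L M (p i)"]
      by (simp add: mult_ac)
  qed
  moreover have "(\<lambda>N. integral\<^sup>L (M \<Otimes>\<^sub>M M) (f N)) \<longlonglongrightarrow>
     (\<integral>(x, y). of_real (L (idx x) (idx y)) * (u y * cnj (u x)) \<partial>(M \<Otimes>\<^sub>M M))"
  proof (rule integral_dominated_convergence)
    show "integrable (M \<Otimes>\<^sub>M M) (\<lambda>z. B * (case z of (x, y) \<Rightarrow> cmod (u x * u y)))"
      using integrable_product_mult(1)[OF u u, THEN integrable_norm]
      by (intro integrable_mult_right) (simp add: case_prod_beta')
    show "AE z in M \<Otimes>\<^sub>M M. (\<lambda>N. f N z) \<longlonglongrightarrow> (case z of (x, y) \<Rightarrow> of_real (L (idx x) (idx y)) * (u y * cnj (u x)))"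
    proof (rule AE_I2, clarify)
      fix x y
      have "eventually (\<lambda>N. f N (x, y) = of_real (L (idx x) (idx y)) * (u y * cnj (u x))) sequentially"
        using eventually_gt_at_top[of "max (idx x) (idx y)"] by eventually_elim (simp add: f_def)
      then show "(\<lambda>N. f N (x, y)) \<longlonglongrightarrow> of_real (L (idx x) (idx y)) * (u y * cnj (u x))"
        by (rule tendsto_eventually)
    qed
    show "AE z in M \<Otimes>\<^sub>M M. norm (f N z) \<le> B * (case z of (x, y) \<Rightarrow> cmod (u x * u y))" for N
    proof (rule AE_I2, clarify)
      fix x y
      have "\<bar>L (idx x) (idx y)\<bar> * cmod (u x * u y) \<le> B * cmod (u x * u y)"
        by (intro mult_right_mono bound) simp
      moreover have "0 \<le> B * cmod (u x * u y)"
        using bound[of 0 0] by (intro mult_nonneg_nonneg) auto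
      ultimately show "norm (f N (x, y)) \<le> B * cmod (u x * u y)"
        by (simp add: f_def norm_mult mult_ac)
    qed
  qed (auto simp: f_def)
  ultimately show ?thesis
    by (intro LIMSEQ_le_const[OF tendsto_Re]) auto
qed

text \<open>The setting is that of a weighted graph with conductances \<open>K x y\<close>: the random walk that moves from
  \<open>x\<close> with density \<open>K x\<close>, normalized, is reversible for the measure weighted by the degree. Bounds on
  the degree make the weighted and the unweighted \<open>L\<^sup>2\<close> norms equivalent.\<close>

locale bounded_degree_kernel = finite_measure M for M :: "'a measure" +
  fixes K :: "'a \<Rightarrow> 'a \<Rightarrow> real" and c C :: real
  assumes K_measurable [measurable]: "(\<lambda>(x, y). K x y) \<in> borel_measurable (M \<Otimes>\<^sub>M M)"
    and K_nonneg: "0 \<le> K x y"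
    and K_sym: "K x y = K y x"
    and K_integrable: "x \<in> space M \<Longrightarrow> integrable M (K x)"
    and c_pos: "0 < c"
    and degree_ge: "x \<in> space M \<Longrightarrow> c \<le> (\<integral>y. K x y \<partial>M)"
    and degree_le: "x \<in> space M \<Longrightarrow> (\<integral>y. K x y \<partial>M) \<le> C"
begin

sublocale pair_sigma_finite M M ..

definition deg :: "'a \<Rightarrow> real" where "deg x = (\<integral>y. K x y \<partial>M)"

definition pot :: "('a \<Rightarrow> complex) \<Rightarrow> 'a \<Rightarrow> complex" where
  "pot v x = (\<integral>y. v y * of_real (K x y) \<partial>M)"

definition averaging :: "('a \<Rightarrow> complex) \<Rightarrow> 'a \<Rightarrow> complex" where
  "averaging v x = pot v x / pot (\<lambda>_. 1) x"

definition weighted :: "'a measure" where "weighted = density M (\<lambda>x. ennreal (deg x))"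

lemma deg_measurable [measurable]: "deg \<in> borel_measurable M"
  unfolding deg_def[abs_def] by measurable

lemma deg_bounds: "x \<in> space M \<Longrightarrow> c \<le> deg x" "x \<in> space M \<Longrightarrow> deg x \<le> C"
  using degree_ge degree_le by (auto simp: deg_def)

lemma deg_pos: "x \<in> space M \<Longrightarrow> 0 < deg x"
  using deg_bounds(1) c_pos by force

lemma deg_nonneg_AE: "AE x in M. 0 \<le> deg x"
  by (rule AE_I2) (use deg_pos in \<open>auto intro: less_imp_le\<close>)

lemma averaging_eq: "averaging v x = pot v x / of_real (deg x)"
proof -
  have "pot (\<lambda>_. 1) x = of_real (deg x)"
    by (simp add: pot_def deg_def)
  then show ?thesis by (simp add: averaging_def)
qed

lemma pot_measurable [measurable]:
  assumes [measurable]: "v \<in> borel_measurable M"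
  shows "pot v \<in> borel_measurable M"
  unfolding pot_def[abs_def] by measurable

lemma averaging_measurable [measurable]:
  assumes [measurable]: "v \<in> borel_measurable M"
  shows "averaging v \<in> borel_measurable M"
  unfolding averaging_def[abs_def] by measurable

lemma deg_mult_integrable:
  assumes f: "integrable M (f :: 'a \<Rightarrow> real)"
  shows "integrable M (\<lambda>x. deg x * f x)"
proof (rule Bochner_Integration.integrable_bound)
  show "integrable M (\<lambda>x. C * f x)" using f by simp
  show "AE x in M. norm (deg x * f x) \<le> norm (C * f x)"
  proof (rule AE_I2)
    fix x assume x: "x \<in> space M"
    have "\<bar>deg x\<bar> \<le> \<bar>C\<bar>" using deg_bounds[OF x] deg_pos[OF x] by simp
    then show "norm (deg x * f x) \<le> norm (C * f x)"
      by (simp add: abs_mult mult_right_mono)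
  qed
qed (use f in measurable)

lemma K_mult_fst_integrable:
  assumes f: "integrable M (f :: 'a \<Rightarrow> real)"
  shows "integrable (M \<Otimes>\<^sub>M M) (\<lambda>(x, y). K x y * f x)"
proof (rule Fubini_integrable)
  show "(\<lambda>(x, y). K x y * f x) \<in> borel_measurable (M \<Otimes>\<^sub>M M)"
    using f by measurable
  have "(\<integral>y. norm (K x y * f x) \<partial>M) = norm (deg x * f x)" if "x \<in> space M" for x
    using deg_pos[OF that] K_nonneg by (simp add: abs_mult deg_def)
  then show "integrable M (\<lambda>x. \<integral>y. norm (case (x, y) of (x, y) \<Rightarrow> K x y * f x) \<partial>M)"
    using deg_mult_integrable[OF f, THEN integrable_norm]
    by (subst Bochner_Integration.integrable_cong[OF refl, of _ _ "\<lambda>x. norm (deg x * f x)"]) auto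
  show "AE x in M. integrable M (\<lambda>y. case (x, y) of (x, y) \<Rightarrow> K x y * f x)"
    using K_integrable by (intro AE_I2) simp
qed

lemma K_mult_snd_integrable:
  assumes f: "integrable M (f :: 'a \<Rightarrow> real)"
  shows "integrable (M \<Otimes>\<^sub>M M) (\<lambda>(x, y). K x y * f y)"
  using integrable_product_swap[OF K_mult_fst_integrable[OF f]] by (simp add: K_sym)

text \<open>The degree weighted measure is stationary for the random walk.\<close>

lemma K_mult_snd_integral:
  assumes f: "integrable M (f :: 'a \<Rightarrow> real)"
  shows "(\<integral>x. (\<integral>y. K x y * f y \<partial>M) \<partial>M) = (\<integral>x. deg x * f x \<partial>M)"
proof -
  have "(\<integral>x. (\<integral>y. K x y * f y \<partial>M) \<partial>M) = (\<integral>(x, y). K x y * f y \<partial>(M \<Otimes>\<^sub>M M))"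
    using integral_fst'[OF K_mult_snd_integrable[OF f]] by simp
  also have "\<dots> = (\<integral>(x, y). K x y * f x \<partial>(M \<Otimes>\<^sub>M M))"
  proof -
    have "(\<lambda>(x, y). K x y * f x) \<in> borel_measurable (M \<Otimes>\<^sub>M M)"
      using f by measurable
    from integral_product_swap[OF this] show ?thesis by (simp add: K_sym)
  qed
  also have "\<dots> = (\<integral>x. (\<integral>y. K x y * f x \<partial>M) \<partial>M)"
    using integral_fst'[OF K_mult_fst_integrable[OF f]] by simp
  also have "\<dots> = (\<integral>x. deg x * f x \<partial>M)"
    by (simp add: deg_def)
  finally show ?thesis .
qed

lemma K_form_integrable:
  assumes u: "u \<in> L2 M" and v: "v \<in> L2 M"
  shows "integrable (M \<Otimes>\<^sub>M M) (\<lambda>(x, y). of_real (K x y) * (u y * cnj (v x)))"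
proof (rule Bochner_Integration.integrable_bound)
  note [measurable] = u[THEN L2_borel_measurable] v[THEN L2_borel_measurable]
  show "integrable (M \<Otimes>\<^sub>M M) (\<lambda>z. (case z of (x, y) \<Rightarrow> K x y * (cmod (u y))\<^sup>2) + (case z of (x, y) \<Rightarrow> K x y * (cmod (v x))\<^sup>2))"
    using K_mult_snd_integrable[OF L2_integrable_square[OF u]] K_mult_fst_integrable[OF L2_integrable_square[OF v]]
    by simp
  show "AE z in M \<Otimes>\<^sub>M M. norm (case z of (x, y) \<Rightarrow> of_real (K x y) * (u y * cnj (v x)))
      \<le> norm ((case z of (x, y) \<Rightarrow> K x y * (cmod (u y))\<^sup>2) + (case z of (x, y) \<Rightarrow> K x y * (cmod (v x))\<^sup>2))"
  proof (rule AE_I2, clarify)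
    fix x y
    have "cmod (u y) * cmod (v x) \<le> (cmod (u y))\<^sup>2 + (cmod (v x))\<^sup>2"
      using sum_squares_bound[of "cmod (u y)" "cmod (v x)"]
        mult_nonneg_nonneg[OF norm_ge_zero[of "u y"] norm_ge_zero[of "v x"]] by linarith
    from mult_left_mono[OF this K_nonneg[of x y]]
    show "norm (of_real (K x y) * (u y * cnj (v x)))
      \<le> norm (K x y * (cmod (u y))\<^sup>2 + K x y * (cmod (v x))\<^sup>2)"
      using K_nonneg[of x y] by (simp add: norm_mult distrib_left)
  qed
qed (use assms[THEN L2_borel_measurable] in measurable)

lemma K_section_integrable:
  assumes v: "v \<in> L2 M"
  shows "AE x in M. integrable M (\<lambda>y. K x y * (cmod (v y))\<^sup>2) \<and> integrable M (\<lambda>y. v y * of_real (K x y))"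
proof -
  note [measurable] = L2_borel_measurable[OF v]
  have "AE x in M. integrable M (\<lambda>y. K x y * (cmod (v y))\<^sup>2)"
    using AE_integrable_fst'[OF K_mult_snd_integrable[OF L2_integrable_square[OF v]]] by simp
  then show ?thesis using AE_space
  proof eventually_elim
    case (elim x)
    have "integrable M (\<lambda>y. v y * of_real (K x y))"
    proof (rule Bochner_Integration.integrable_bound)
      show "integrable M (\<lambda>y. K x y + K x y * (cmod (v y))\<^sup>2)"
        using elim K_integrable by simp
      show "AE y in M. norm (v y * of_real (K x y)) \<le> norm (K x y + K x y * (cmod (v y))\<^sup>2)"
      proof (rule AE_I2)
        fix y
        have "2 * cmod (v y) \<le> (cmod (v y))\<^sup>2 + 1"
          using sum_squares_bound[of "cmod (v y)" 1] by simp
        then have "cmod (v y) \<le> 1 + (cmod (v y))\<^sup>2"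
          using norm_ge_zero[of "v y"] by linarith
        from mult_left_mono[OF this K_nonneg[of x y]]
        show "norm (v y * of_real (K x y)) \<le> norm (K x y + K x y * (cmod (v y))\<^sup>2)"
          using K_nonneg[of x y] by (simp add: norm_mult distrib_left mult.commute)
      qed
      show "(\<lambda>y. v y * of_real (K x y)) \<in> borel_measurable M"
        using elim by measurable
    qed
    with elim show ?case by simp
  qed
qed

text \<open>The variance of \<open>\<bar>v\<bar>\<close> under the transition probability from \<open>x\<close> is nonnegative.\<close>

lemma averaging_jensen:
  assumes v: "v \<in> L2 M"
  shows "AE x in M. deg x * (cmod (averaging v x))\<^sup>2 \<le> (\<integral>y. K x y * (cmod (v y))\<^sup>2 \<partial>M)"
  using K_section_integrable[OF v] AE_space
proof eventually_elim
  case (elim x)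
  define m where "m = (\<integral>y. K x y * cmod (v y) \<partial>M) / deg x"
  have d: "0 < deg x" using deg_pos elim by simp
  have i0: "integrable M (K x)" using K_integrable elim by simp
  have i1: "integrable M (\<lambda>y. K x y * cmod (v y))"
    using elim(1)[THEN conjunct2, THEN integrable_norm] K_nonneg by (simp add: norm_mult mult.commute)
  have i2: "integrable M (\<lambda>y. K x y * (cmod (v y))\<^sup>2)" using elim by simp
  have "0 \<le> (\<integral>y. K x y * (cmod (v y) - m)\<^sup>2 \<partial>M)"
    using K_nonneg by (intro integral_nonneg_AE AE_I2 mult_nonneg_nonneg) auto
  also have "\<dots> = (\<integral>y. K x y * (cmod (v y))\<^sup>2 - 2 * m * (K x y * cmod (v y)) + m\<^sup>2 * K x y \<partial>M)"
    by (intro Bochner_Integration.integral_cong refl) (simp add: power2_diff algebra_simps)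
  also have "\<dots> = (\<integral>y. K x y * (cmod (v y))\<^sup>2 \<partial>M) - 2 * m * (\<integral>y. K x y * cmod (v y) \<partial>M) + m\<^sup>2 * deg x"
    using i0 i1 i2 by (simp add: deg_def)
  also have "\<dots> = (\<integral>y. K x y * (cmod (v y))\<^sup>2 \<partial>M) - deg x * m\<^sup>2"
    using d by (simp add: m_def power2_eq_square)
  finally have "deg x * m\<^sup>2 \<le> (\<integral>y. K x y * (cmod (v y))\<^sup>2 \<partial>M)" by simp
  moreover have "cmod (averaging v x) \<le> m"
  proof -
    have "cmod (pot v x) \<le> (\<integral>y. norm (v y * of_real (K x y)) \<partial>M)"
      unfolding pot_def by (rule integral_norm_bound)
    also have "\<dots> = (\<integral>y. K x y * cmod (v y) \<partial>M)"
      using K_nonneg by (simp add: norm_mult mult.commute)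
    finally show ?thesis
      using d by (simp add: averaging_eq m_def norm_divide divide_right_mono)
  qed
  ultimately show ?case
    using d by (meson mult_left_mono norm_ge_zero order_trans power_mono less_imp_le)
qed

lemma L2_weighted: "L2 weighted = L2 M"
proof -
  have "integrable M (\<lambda>x. deg x * (cmod (v x))\<^sup>2) \<longleftrightarrow> integrable M (\<lambda>x. (cmod (v x))\<^sup>2)"
    if [measurable]: "v \<in> borel_measurable M" for v :: "'a \<Rightarrow> complex"
  proof
    assume i: "integrable M (\<lambda>x. deg x * (cmod (v x))\<^sup>2)"
    show "integrable M (\<lambda>x. (cmod (v x))\<^sup>2)"
    proof (rule Bochner_Integration.integrable_bound)
      show "integrable M (\<lambda>x. 1 / c * (deg x * (cmod (v x))\<^sup>2))" using i by simp
      show "AE x in M. norm ((cmod (v x))\<^sup>2) \<le> norm (1 / c * (deg x * (cmod (v x))\<^sup>2))"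
      proof (rule AE_I2)
        fix x assume x: "x \<in> space M"
        have "c * (cmod (v x))\<^sup>2 \<le> deg x * (cmod (v x))\<^sup>2"
          by (intro mult_right_mono deg_bounds x) simp
        then show "norm ((cmod (v x))\<^sup>2) \<le> norm (1 / c * (deg x * (cmod (v x))\<^sup>2))"
          using c_pos deg_pos[OF x] by (simp add: field_simps abs_mult)
      qed
    qed measurable
  qed (rule deg_mult_integrable)
  then show ?thesis
    unfolding L2_def weighted_def using deg_nonneg_AE by (auto simp: integrable_density)
qed

lemma integral_weighted:
  assumes "(f :: 'a \<Rightarrow> 'b::{banach, second_countable_topology}) \<in> borel_measurable M"
  shows "integral\<^sup>L weighted f = (\<integral>x. deg x *\<^sub>R f x \<partial>M)"
  unfolding weighted_def using assms deg_nonneg_AE by (intro integral_density) auto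

lemma ae_filter_weighted: "ae_filter weighted = ae_filter M"
proof -
  have "(AE x in weighted. P x) = (AE x in M. P x)" for P
  proof -
    have "(AE x in weighted. P x) = (AE x in M. 0 < deg x \<longrightarrow> P x)"
      unfolding weighted_def by (subst AE_density) (auto simp: ennreal_less_zero_iff)
    also have "\<dots> = (AE x in M. P x)"
      using deg_pos by (intro AE_cong) auto
    finally show ?thesis .
  qed
  then show ?thesis by (simp add: filter_eq_iff)
qed

lemma L2_positive_weighted: "L2_positive weighted T \<Longrightarrow> L2_positive M T"
proof -
  have sq: "(\<integral>x. (cmod (v x))\<^sup>2 \<partial>weighted) = (\<integral>x. deg x * (cmod (v x))\<^sup>2 \<partial>M)" if "v \<in> L2 M" for v
    using L2_borel_measurable[OF that] by (subst integral_weighted) auto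
  have up: "(\<integral>x. deg x * (cmod (v x))\<^sup>2 \<partial>M) \<le> max C 1 * (\<integral>x. (cmod (v x))\<^sup>2 \<partial>M)" if v: "v \<in> L2 M" for v
  proof -
    have "(\<integral>x. deg x * (cmod (v x))\<^sup>2 \<partial>M) \<le> (\<integral>x. max C 1 * (cmod (v x))\<^sup>2 \<partial>M)"
      using deg_mult_integrable[OF L2_integrable_square[OF v]] L2_integrable_square[OF v] deg_bounds(2)
      by (intro integral_mono mult_right_mono) (auto simp: le_max_iff_disj)
    then show ?thesis by simp
  qed
  have low: "(\<integral>x. (cmod (v x))\<^sup>2 \<partial>M) \<le> (1 / c) * (\<integral>x. deg x * (cmod (v x))\<^sup>2 \<partial>M)" if v: "v \<in> L2 M" for v
  proof -
    have "(\<integral>x. c * (cmod (v x))\<^sup>2 \<partial>M) \<le> (\<integral>x. deg x * (cmod (v x))\<^sup>2 \<partial>M)"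
      using deg_mult_integrable[OF L2_integrable_square[OF v]] L2_integrable_square[OF v] deg_bounds(1)
      by (intro integral_mono mult_right_mono) auto
    then show ?thesis using c_pos by (simp add: field_simps)
  qed
  define k where "k = max (sqrt (max C 1)) (sqrt (1 / c))"
  have "L2_spectrum weighted T = L2_spectrum M T"
  proof (rule L2_spectrum_cong_measure[where k = k])
    show "0 < k" unfolding k_def by (simp add: less_max_iff_disj)
    fix v assume v: "v \<in> L2 M"
    have "L2_norm_of weighted v \<le> sqrt (max C 1) * L2_norm_of M v"
      using up[OF v] by (simp add: L2_norm_of_def sq[OF v] real_sqrt_mult[symmetric])
    also have "\<dots> \<le> k * L2_norm_of M v"
      by (intro mult_right_mono L2_norm_of_nonneg) (simp add: k_def)
    finally show "L2_norm_of weighted v \<le> k * L2_norm_of M v" .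
    have "L2_norm_of M v \<le> sqrt (1 / c) * L2_norm_of weighted v"
      using low[OF v] unfolding L2_norm_of_def sq[OF v] real_sqrt_mult[symmetric] by (rule real_sqrt_le_mono)
    also have "\<dots> \<le> k * L2_norm_of weighted v"
      by (intro mult_right_mono L2_norm_of_nonneg) (simp add: k_def)
    finally show "L2_norm_of M v \<le> k * L2_norm_of weighted v" .
  qed (simp_all add: L2_weighted ae_filter_weighted)
  then show "L2_positive weighted T \<Longrightarrow> L2_positive M T"
    by (simp add: L2_positive_def)
qed

text \<open>By Jensen's inequality and stationarity the averaging operator is a contraction for the weighted
  measure.\<close>

lemma averaging_bounded: "L2_bounded weighted averaging"
proof (rule L2_boundedI[where c = 1], unfold L2_weighted ae_filter_weighted)
  have key: "integrable M (\<lambda>x. deg x * (cmod (averaging v x))\<^sup>2) \<and>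
      (\<integral>x. deg x * (cmod (averaging v x))\<^sup>2 \<partial>M) \<le> (\<integral>x. deg x * (cmod (v x))\<^sup>2 \<partial>M)" if v: "v \<in> L2 M" for v
  proof -
    note [measurable] = L2_borel_measurable[OF v]
    have i: "integrable M (\<lambda>x. \<integral>y. K x y * (cmod (v y))\<^sup>2 \<partial>M)"
      using integrable_fst'[OF K_mult_snd_integrable[OF L2_integrable_square[OF v]]] by simp
    have j: "integrable M (\<lambda>x. deg x * (cmod (averaging v x))\<^sup>2)"
    proof (rule Bochner_Integration.integrable_bound[OF i])
      show "AE x in M. norm (deg x * (cmod (averaging v x))\<^sup>2) \<le> norm (\<integral>y. K x y * (cmod (v y))\<^sup>2 \<partial>M)"
        using averaging_jensen[OF v] deg_nonneg_AE by eventually_elim simp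
    qed measurable
    have "(\<integral>x. deg x * (cmod (averaging v x))\<^sup>2 \<partial>M) \<le> (\<integral>x. (\<integral>y. K x y * (cmod (v y))\<^sup>2 \<partial>M) \<partial>M)"
      by (rule integral_mono_AE[OF j i averaging_jensen[OF v]])
    with j show ?thesis by (simp add: K_mult_snd_integral[OF L2_integrable_square[OF v]])
  qed
  show "averaging v \<in> L2 M" if v: "v \<in> L2 M" for v
  proof -
    have "averaging v \<in> L2 weighted"
      using key[OF v] L2_borel_measurable[OF v] deg_nonneg_AE
      by (auto simp: L2_def weighted_def integrable_density)
    then show ?thesis by (simp add: L2_weighted)
  qed
  then show "(\<integral>x. (cmod (averaging v x))\<^sup>2 \<partial>weighted) \<le> 1\<^sup>2 * (\<integral>x. (cmod (v x))\<^sup>2 \<partial>weighted)" if v: "v \<in> L2 M" for v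
    using key[OF v] L2_borel_measurable[OF v] L2_borel_measurable[OF \<open>v \<in> L2 M \<Longrightarrow> averaging v \<in> L2 M\<close>[OF v]]
    by (simp add: integral_weighted)
  show "AE x in M. averaging (\<lambda>y. a * v y + b * w y) x = a * averaging v x + b * averaging w x"
    if vw: "v \<in> L2 M" "w \<in> L2 M" for v w a b
    using K_section_integrable[OF vw(1)] K_section_integrable[OF vw(2)]
  proof eventually_elim
    case (elim x)
    then have "pot (\<lambda>y. a * v y + b * w y) x = a * pot v x + b * pot w x"
      by (simp add: pot_def distrib_right mult.assoc)
    then show ?case by (simp add: averaging_eq add_divide_distrib)
  qed
qed simp

text \<open>The weight cancels the normalization of the average, so the form of the averaging operator for the
  weighted measure is the form of \<open>K\<close> for the original measure. In particular it is symmetric.\<close>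

lemma averaging_form:
  assumes u: "u \<in> L2 M" and v: "v \<in> L2 M"
  shows "(\<integral>x. averaging u x * cnj (v x) \<partial>weighted) =
    (\<integral>(x, y). of_real (K x y) * (u y * cnj (v x)) \<partial>(M \<Otimes>\<^sub>M M))"
proof -
  note [measurable] = L2_borel_measurable[OF u] L2_borel_measurable[OF v]
  have "(\<integral>x. averaging u x * cnj (v x) \<partial>weighted) = (\<integral>x. deg x *\<^sub>R (averaging u x * cnj (v x)) \<partial>M)"
    by (rule integral_weighted) measurable
  also have "\<dots> = (\<integral>x. (\<integral>y. of_real (K x y) * (u y * cnj (v x)) \<partial>M) \<partial>M)"
  proof (intro Bochner_Integration.integral_cong refl)
    fix x assume "x \<in> space M"
    from deg_pos[OF this] have "deg x *\<^sub>R (averaging u x * cnj (v x)) = pot u x * cnj (v x)"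
      by (simp add: averaging_eq scaleR_conv_of_real)
    also have "\<dots> = (\<integral>y. of_real (K x y) * (u y * cnj (v x)) \<partial>M)"
      unfolding pot_def by (subst integral_mult_left_zero[symmetric]) (simp add: mult_ac)
    finally show "deg x *\<^sub>R (averaging u x * cnj (v x)) = (\<integral>y. of_real (K x y) * (u y * cnj (v x)) \<partial>M)" .
  qed
  also have "\<dots> = (\<integral>(x, y). of_real (K x y) * (u y * cnj (v x)) \<partial>(M \<Otimes>\<^sub>M M))"
    using integral_fst'[OF K_form_integrable[OF u v]] by simp
  finally show ?thesis .
qed

theorem L2_positive_averaging:
  assumes pos: "\<And>u. u \<in> L2 M \<Longrightarrow> 0 \<le> Re (\<integral>(x, y). of_real (K x y) * (u y * cnj (u x)) \<partial>(M \<Otimes>\<^sub>M M))"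
  shows "L2_positive M averaging"
proof (rule L2_positive_weighted, rule L2_positive_of_form[OF averaging_bounded], unfold L2_weighted)
  fix u v assume u: "u \<in> L2 M" and v: "v \<in> L2 M"
  note [measurable] = L2_borel_measurable[OF u] L2_borel_measurable[OF v]
  have "(\<integral>x. u x * cnj (averaging v x) \<partial>weighted) = (\<integral>x. cnj (averaging v x * cnj (u x)) \<partial>weighted)"
    by (simp add: mult.commute)
  also have "\<dots> = cnj (\<integral>(x, y). of_real (K x y) * (v y * cnj (u x)) \<partial>(M \<Otimes>\<^sub>M M))"
    by (subst Bochner_Integration.integral_cnj) (simp add: averaging_form[OF v u])
  also have "\<dots> = (\<integral>z. cnj (case z of (x, y) \<Rightarrow> of_real (K x y) * (v y * cnj (u x))) \<partial>(M \<Otimes>\<^sub>M M))"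
    by (rule Bochner_Integration.integral_cnj[symmetric])
  also have "\<dots> = (\<integral>(x, y). of_real (K y x) * (u x * cnj (v y)) \<partial>(M \<Otimes>\<^sub>M M))"
    by (intro Bochner_Integration.integral_cong refl) (auto simp: K_sym mult_ac)
  also have "\<dots> = (\<integral>(x, y). of_real (K x y) * (u y * cnj (v x)) \<partial>(M \<Otimes>\<^sub>M M))"
    using integral_product_swap[of "\<lambda>(x, y). of_real (K x y) * (u y * cnj (v x))"]
      K_form_integrable[OF u v] by simp
  finally show "(\<integral>x. averaging u x * cnj (v x) \<partial>weighted) = (\<integral>x. u x * cnj (averaging v x) \<partial>weighted)"
    by (simp add: averaging_form[OF u v])
next
  fix u assume "u \<in> L2 M"
  then show "0 \<le> Re (\<integral>x. averaging u x * cnj (u x) \<partial>weighted)"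
    using pos by (simp add: averaging_form)
qed

end

section \<open>The Gromov product on the bordification\<close>

text \<open>The extension is the one chosen in \<^const>\<open>bdry_product\<close>, so that the visual distance can be
  computed as a limit of Gromov products in the space.\<close>

definition gromov_ext :: "'x::metric_space \<Rightarrow> 'x bord \<Rightarrow> 'x bord \<Rightarrow> ereal" where
  "gromov_ext p z w = (SOME F. gromov_extension p F) (z, w)"

definition boundary_map :: "('x \<Rightarrow> 'x) \<Rightarrow> (nat \<Rightarrow> 'x) set \<Rightarrow> (nat \<Rightarrow> 'x) set" where
  "boundary_map h \<xi> = (\<lambda>s. h \<circ> s) ` \<xi>"

lemma openin_bord_topology [simp]: "openin bord_topology = bord_open"
  by (simp add: bord_topology_def istopology_bord_open)

lemma topspace_bord_topology [simp]:
  "topspace (bord_topology :: 'x::metric_space bord topology) = bordification"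
proof
  have "bord_open (bordification :: 'x bord set)"
    by (auto simp: bord_open_def bordification_def)
  then show "bordification \<subseteq> topspace (bord_topology :: 'x bord topology)"
    by (simp add: openin_subset)
  show "topspace (bord_topology :: 'x bord topology) \<subseteq> bordification"
    unfolding topspace_def by (auto simp: bord_open_def)
qed

lemma bordification_simps [simp]:
  "Inl x \<in> bordification" "Inr \<xi> \<in> bordification \<longleftrightarrow> \<xi> \<in> gromov_boundary"
  by (auto simp: bordification_def)

lemma gromov_product_commute: "gromov_product dist p x y = gromov_product dist p y (x :: 'x::metric_space)"
  by (simp add: gromov_product_def dist_commute)

lemma gromov_product_nonneg: "0 \<le> gromov_product dist p x (y :: 'x::metric_space)"
  using dist_triangle[of x y p] by (simp add: gromov_product_def dist_commute)

lemma gromov_product_le_dist: "gromov_product dist p x y \<le> dist p (x :: 'x::metric_space)"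
  using dist_triangle[of y p x] by (simp add: gromov_product_def dist_commute)

lemma gromov_boundaryE:
  assumes "\<xi> \<in> gromov_boundary"
  obtains s where "tends_to_infinity s" "\<xi> = asymptotic `` {s}" "s \<in> \<xi>"
proof -
  obtain s where s: "tends_to_infinity s" "\<xi> = asymptotic `` {s}"
    using assms by (auto simp: gromov_boundary_def quotient_def)
  moreover have "s \<in> \<xi>"
    using s by (auto simp: asymptotic_def tends_to_infinity_def)
  ultimately show ?thesis using that by blast
qed

lemma LIM_product_eventually:
  assumes "LIM (i, j) sequentially \<times>\<^sub>F sequentially. f i j :> at_top"
  obtains N :: nat where "\<And>i j. N \<le> i \<Longrightarrow> N \<le> j \<Longrightarrow> (r::real) \<le> f i j"
proof -
  have "eventually (\<lambda>z. r \<le> (case z of (i, j) \<Rightarrow> f i j)) (sequentially \<times>\<^sub>F sequentially)"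
    using assms by (simp add: filterlim_at_top)
  then show ?thesis using that by (auto simp: eventually_prod_sequentially)
qed

lemma gromov_sup_ge:
  assumes "s \<in> \<xi>" "eventually (\<lambda>i. c \<le> gromov_product dist p (s i) x) sequentially"
  shows "ereal c \<le> gromov_sup p (Inr \<xi>) (Inl x)"
proof -
  let ?L = "Liminf (sequentially \<times>\<^sub>F sequentially) (\<lambda>(i, j). ereal (gromov_product dist p (s i) ((\<lambda>_. x) j)))"
  have "ereal c \<le> ?L"
  proof (rule Liminf_bounded)
    have "eventually (\<lambda>(i, j). c \<le> gromov_product dist p (s i) x) (sequentially \<times>\<^sub>F (sequentially :: nat filter))"
      using assms(2) by (simp add: eventually_prod1)
    then show "eventually (\<lambda>z. ereal c \<le> (case z of (i, j) \<Rightarrow> ereal (gromov_product dist p (s i) ((\<lambda>_. x) j))))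
        (sequentially \<times>\<^sub>F (sequentially :: nat filter))"
      by eventually_elim auto
  qed
  also have "?L \<le> gromov_sup p (Inr \<xi>) (Inl x)"
    unfolding gromov_sup_def using assms(1) by (intro Sup_upper) force
  finally show ?thesis .
qed

text \<open>Neighbourhoods of a boundary point are described by the supremum version of the Gromov product;
  one basepoint is enough to enter all of them.\<close>

lemma limitin_boundaryI:
  assumes "\<xi> \<in> gromov_boundary"
    and "\<And>r. eventually (\<lambda>n. ereal r < gromov_sup p (Inr \<xi>) (Inl (x n))) F"
  shows "limitin bord_topology (\<lambda>n. Inl (x n)) (Inr \<xi>) F"
  unfolding limitin_def
proof (intro conjI allI impI)
  show "Inr \<xi> \<in> topspace bord_topology" using assms(1) by simp
  fix U assume U: "openin bord_topology U \<and> Inr \<xi> \<in> U"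
  then have "\<forall>p. \<exists>r::real. \<forall>w\<in>bordification. gromov_sup p (Inr \<xi>) w > ereal r \<longrightarrow> w \<in> U"
    by (simp add: bord_open_def)
  then obtain r :: real where r: "\<forall>w\<in>bordification. gromov_sup p (Inr \<xi>) w > ereal r \<longrightarrow> w \<in> U"
    by blast
  show "eventually (\<lambda>n. Inl (x n) \<in> U) F"
    using assms(2)[of r] by eventually_elim (use r in auto)
qed

lemma limitin_representative:
  assumes xi: "\<xi> \<in> gromov_boundary" and t: "t \<in> \<xi>"
  shows "limitin bord_topology (\<lambda>n. Inl (t n)) (Inr \<xi>) sequentially"
proof (rule limitin_boundaryI[OF xi])
  fix p r
  obtain s where s: "\<xi> = asymptotic `` {s}" "s \<in> \<xi>"
    using gromov_boundaryE[OF xi] by blast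
  then have "LIM (i, j) sequentially \<times>\<^sub>F sequentially. gromov_product dist p (s i) (t j) :> at_top"
    using t by (auto simp: asymptotic_def)
  then obtain N where N: "\<And>i j. N \<le> i \<Longrightarrow> N \<le> j \<Longrightarrow> r + 1 \<le> gromov_product dist p (s i) (t j)"
    using LIM_product_eventually by blast
  show "eventually (\<lambda>n. ereal r < gromov_sup p (Inr \<xi>) (Inl (t n))) sequentially"
    using eventually_ge_at_top[of N]
  proof eventually_elim
    case (elim j)
    have "eventually (\<lambda>i. r + 1 \<le> gromov_product dist p (s i) (t j)) sequentially"
      using eventually_ge_at_top[of N] by eventually_elim (use N elim in auto)
    from gromov_sup_ge[OF s(2) this] show ?case
      by (rule less_le_trans[rotated]) simp
  qed
qed

text \<open>The space is sequentially dense in its bordification. Statements about the extended Gromov product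
  are proved below by passing to the limit along such sequences.\<close>

lemma bordification_approachable:
  assumes "z \<in> bordification"
  shows "\<exists>s. limitin bord_topology (\<lambda>n. Inl (s n)) z sequentially"
proof (cases z)
  case (Inl x)
  then show ?thesis by (intro exI[of _ "\<lambda>_. x"]) simp
next
  case (Inr \<xi>)
  then obtain s where "s \<in> \<xi>" using assms gromov_boundaryE by auto
  then show ?thesis using limitin_representative[of \<xi> s] Inr assms by auto
qed

lemma limitin_Inl_const: "limitin bord_topology (\<lambda>n. Inl x) (Inl x) F"
  by simp

locale good_space =
  fixes b :: "'x::metric_space" and \<delta> \<epsilon> :: real
  assumes hyp: "hyperbolic_on UNIV (dist :: 'x \<Rightarrow> 'x \<Rightarrow> real) b \<delta>"
    and good: "eps_good TYPE('x) \<epsilon>"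
begin

lemma eps_pos: "0 < \<epsilon>"
  using good by (simp add: eps_good_def)

lemma Metric_space_visual: "Metric_space gromov_boundary (visual_dist (p :: 'x) \<epsilon>)"
  using good by (simp add: eps_good_def)

lemma delta_nonneg: "0 \<le> \<delta>"
  using hyp by (simp add: hyperbolic_on_def)

lemma gromov_product_hyperbolic:
  "min (gromov_product dist b x z) (gromov_product dist b z y) - \<delta> \<le> gromov_product dist b x (y :: 'x)"
  using hyp by (simp add: hyperbolic_on_def)

lemma gromov_ext_is_extension: "gromov_extension (p :: 'x) (\<lambda>(z, w). gromov_ext p z w)"
proof -
  have "\<exists>F. gromov_extension p F" using good by (simp add: eps_good_def)
  then have "gromov_extension p (SOME F. gromov_extension p F)" by (rule someI_ex)
  then show ?thesis by (simp add: gromov_ext_def)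
qed

lemma gromov_ext_Inl: "gromov_ext p (Inl x) (Inl y) = ereal (gromov_product dist (p :: 'x) x y)"
  using gromov_ext_is_extension[of p] by (simp add: gromov_extension_def)

lemma gromov_ext_tendsto:
  assumes "limitin bord_topology f z F" "limitin bord_topology g w F"
  shows "((\<lambda>n. gromov_ext (p :: 'x) (f n) (g n)) \<longlongrightarrow> gromov_ext p z w) F"
proof -
  have "limitin (prod_topology bord_topology bord_topology) (\<lambda>n. (f n, g n)) (z, w) F"
    using assms by (simp add: limitin_pairwise o_def)
  then have "limitin euclidean ((\<lambda>(z, w). gromov_ext p z w) \<circ> (\<lambda>n. (f n, g n))) ((\<lambda>(z, w). gromov_ext p z w) (z, w)) F"
    using gromov_ext_is_extension[of p] unfolding gromov_extension_def
    by (intro continuous_map_limit) auto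
  then show ?thesis by (simp add: o_def)
qed

lemma gromov_product_tendsto:
  assumes "limitin bord_topology (\<lambda>n. Inl (s n)) z F" "limitin bord_topology (\<lambda>n. Inl (t n)) w F"
  shows "((\<lambda>n. ereal (gromov_product dist (p :: 'x) (s n) (t n))) \<longlongrightarrow> gromov_ext p z w) F"
  using gromov_ext_tendsto[OF assms, of p] by (simp add: gromov_ext_Inl)

lemma gromov_ext_nonneg:
  assumes "z \<in> bordification" "w \<in> bordification"
  shows "0 \<le> gromov_ext (p :: 'x) z w"
proof -
  obtain s t where st: "limitin bord_topology (\<lambda>n. Inl (s n)) z sequentially"
      "limitin bord_topology (\<lambda>n. Inl (t n)) w sequentially"
    using bordification_approachable[OF assms(1)] bordification_approachable[OF assms(2)] by blast
  show ?thesis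
    by (rule LIMSEQ_le_const[OF gromov_product_tendsto[OF st]]) (simp add: gromov_product_nonneg)
qed

lemma gromov_ext_commute:
  assumes "z \<in> bordification" "w \<in> bordification"
  shows "gromov_ext (p :: 'x) z w = gromov_ext p w z"
proof -
  obtain s t where st: "limitin bord_topology (\<lambda>n. Inl (s n)) z sequentially"
      "limitin bord_topology (\<lambda>n. Inl (t n)) w sequentially"
    using bordification_approachable[OF assms(1)] bordification_approachable[OF assms(2)] by blast
  show ?thesis
    using gromov_product_tendsto[OF st, of p] gromov_product_tendsto[OF st(2,1), of p]
    by (simp add: gromov_product_commute[of p "t _"] LIMSEQ_unique)
qed

lemma gromov_ext_Inl_le:
  assumes "z \<in> bordification"
  shows "gromov_ext (p :: 'x) (Inl x) z \<le> ereal (dist p x)"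
proof -
  obtain s where s: "limitin bord_topology (\<lambda>n. Inl (s n)) z sequentially"
    using bordification_approachable[OF assms] by blast
  show ?thesis
    by (rule LIMSEQ_le_const2[OF gromov_product_tendsto[OF limitin_Inl_const s]])
       (simp add: gromov_product_le_dist)
qed

lemma gromov_ext_Inl_real:
  assumes "z \<in> bordification"
  obtains r where "gromov_ext (p :: 'x) (Inl x) z = ereal r" "0 \<le> r" "r \<le> dist p x"
  using gromov_ext_nonneg[of "Inl x" z p] gromov_ext_Inl_le[OF assms, of p x] assms
  by (cases "gromov_ext p (Inl x) z") auto

text \<open>Threshold form of the hyperbolicity inequality, which avoids arithmetic with infinite values.\<close>

lemma gromov_ext_hyperbolic:
  assumes "z \<in> bordification" "w \<in> bordification" "v \<in> bordification"
    and "ereal r \<le> gromov_ext b z v" "ereal r \<le> gromov_ext b v w"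
  shows "ereal (r - \<delta>) \<le> gromov_ext b z w"
proof (rule ccontr)
  assume "\<not> ereal (r - \<delta>) \<le> gromov_ext b z w"
  moreover obtain a where a: "gromov_ext b z w = ereal a"
    using gromov_ext_nonneg[OF assms(1,2), of b] calculation by (cases "gromov_ext b z w") auto
  ultimately have ar: "a < r - \<delta>" by simp
  obtain s t u where stu: "limitin bord_topology (\<lambda>n. Inl (s n)) z sequentially"
      "limitin bord_topology (\<lambda>n. Inl (t n)) w sequentially"
      "limitin bord_topology (\<lambda>n. Inl (u n)) v sequentially"
    using bordification_approachable[OF assms(1)] bordification_approachable[OF assms(2)] bordification_approachable[OF assms(3)] by blast
  define e where "e = (r - \<delta> - a) / 2"
  have e: "0 < e" using ar by (simp add: e_def)
  have re: "r = a + \<delta> + 2 * e" by (simp add: e_def field_simps)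
  have lt: "ereal (r - e) < ereal r" using e by simp
  have upper: "gromov_ext b z w < ereal (a + e)" using a e by simp
  have "eventually (\<lambda>n. ereal (r - e) < ereal (gromov_product dist b (s n) (u n))) sequentially"
    "eventually (\<lambda>n. ereal (r - e) < ereal (gromov_product dist b (u n) (t n))) sequentially"
    "eventually (\<lambda>n. ereal (gromov_product dist b (s n) (t n)) < ereal (a + e)) sequentially"
    using order_tendstoD(1)[OF gromov_product_tendsto[OF stu(1,3)] less_le_trans[OF lt assms(4)]]
      order_tendstoD(1)[OF gromov_product_tendsto[OF stu(3,2)] less_le_trans[OF lt assms(5)]]
      order_tendstoD(2)[OF gromov_product_tendsto[OF stu(1,2)] upper]
    by simp_all
  then have "eventually (\<lambda>n. False) sequentially"
  proof eventually_elim
    case (elim n)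
    then show ?case
      using gromov_product_hyperbolic[of "s n" "u n" "t n"] by (auto simp: re min_def split: if_splits)
  qed
  then show False by simp
qed

text \<open>On \<open>X\<close> this is the identity
  \<open>(z, w)\<^sub>b = (z, w)\<^sub>x + (x, z)\<^sub>b + (x, w)\<^sub>b - d(b, x)\<close>; both additional products stay finite in the limit.
  It says that visual metrics with different basepoints are conformal to each other.\<close>

lemma gromov_ext_change_basepoint:
  assumes "z \<in> bordification" "w \<in> bordification"
    and "gromov_ext b (Inl x) z = ereal \<alpha>" "gromov_ext b (Inl x) w = ereal \<beta>"
  shows "gromov_ext b z w = gromov_ext x z w + ereal (\<alpha> + \<beta> - dist b x)"
proof -
  obtain s t where st: "limitin bord_topology (\<lambda>n. Inl (s n)) z sequentially"
      "limitin bord_topology (\<lambda>n. Inl (t n)) w sequentially"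
    using bordification_approachable[OF assms(1)] bordification_approachable[OF assms(2)] by blast
  have "(\<lambda>n. gromov_product dist b x (s n)) \<longlonglongrightarrow> \<alpha>" "(\<lambda>n. gromov_product dist b x (t n)) \<longlonglongrightarrow> \<beta>"
    using gromov_product_tendsto[OF limitin_Inl_const st(1), of b x]
      gromov_product_tendsto[OF limitin_Inl_const st(2), of b x] assms by simp_all
  then have "(\<lambda>n. ereal (gromov_product dist b x (s n) + gromov_product dist b x (t n) - dist b x))
      \<longlonglongrightarrow> ereal (\<alpha> + \<beta> - dist b x)"
    by (intro tendsto_intros)
  then have "(\<lambda>n. ereal (gromov_product dist x (s n) (t n)) +
      ereal (gromov_product dist b x (s n) + gromov_product dist b x (t n) - dist b x))
      \<longlonglongrightarrow> gromov_ext x z w + ereal (\<alpha> + \<beta> - dist b x)"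
    by (intro tendsto_add_ereal_general1 gromov_product_tendsto st) auto
  moreover have "gromov_product dist x (s n) (t n) +
      (gromov_product dist b x (s n) + gromov_product dist b x (t n) - dist b x) = gromov_product dist b (s n) (t n)" for n
    by (simp add: gromov_product_def dist_commute field_simps)
  ultimately have "(\<lambda>n. ereal (gromov_product dist b (s n) (t n))) \<longlonglongrightarrow> gromov_ext x z w + ereal (\<alpha> + \<beta> - dist b x)"
    by simp
  then show ?thesis
    using gromov_product_tendsto[OF st, of b] LIMSEQ_unique by blast
qed

lemma visual_dist_eq:
  assumes "\<xi> \<in> gromov_boundary" "\<eta> \<in> gromov_boundary"
  shows "visual_dist (p :: 'x) \<epsilon> \<xi> \<eta> = (if gromov_ext p (Inr \<xi>) (Inr \<eta>) = \<infinity> then 0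
     else exp (- \<epsilon> * real_of_ereal (gromov_ext p (Inr \<xi>) (Inr \<eta>))))"
  using assms by (simp add: visual_dist_def bdry_product_def gromov_ext_def)

lemma visual_dist_le_iff:
  assumes "\<xi> \<in> gromov_boundary" "\<eta> \<in> gromov_boundary"
  shows "visual_dist (p :: 'x) \<epsilon> \<xi> \<eta> \<le> exp (- \<epsilon> * r) \<longleftrightarrow> ereal r \<le> gromov_ext p (Inr \<xi>) (Inr \<eta>)"
  using gromov_ext_nonneg[of "Inr \<xi>" "Inr \<eta>" p] assms eps_pos
  by (cases "gromov_ext p (Inr \<xi>) (Inr \<eta>)") (auto simp: visual_dist_eq)

lemma visual_dist_le_1: "visual_dist (p :: 'x) \<epsilon> \<xi> \<eta> \<le> 1"
proof (cases "\<xi> \<in> gromov_boundary \<and> \<eta> \<in> gromov_boundary")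
  case True
  then show ?thesis
    using visual_dist_le_iff[of \<xi> \<eta> p 0] gromov_ext_nonneg[of "Inr \<xi>" "Inr \<eta>" p]
    by (simp add: zero_ereal_def)
qed (auto simp: visual_dist_def)

lemma gromov_ext_finite:
  assumes "\<xi> \<in> gromov_boundary" "\<eta> \<in> gromov_boundary" "\<xi> \<noteq> \<eta>"
  obtains r where "gromov_ext (p :: 'x) (Inr \<xi>) (Inr \<eta>) = ereal r" "visual_dist p \<epsilon> \<xi> \<eta> = exp (- \<epsilon> * r)"
proof -
  have "visual_dist p \<epsilon> \<xi> \<eta> \<noteq> 0"
    using Metric_space.zero[OF Metric_space_visual] assms by blast
  then show ?thesis
    using that gromov_ext_nonneg[of "Inr \<xi>" "Inr \<eta>" p] assms
    by (cases "gromov_ext p (Inr \<xi>) (Inr \<eta>)") (auto simp: visual_dist_eq)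
qed

lemma limitin_of_gromov_ext:
  assumes xi: "\<xi> \<in> gromov_boundary"
    and ge: "\<And>r. eventually (\<lambda>n. ereal r \<le> gromov_ext b (Inl (x n)) (Inr \<xi>)) F"
  shows "limitin bord_topology (\<lambda>n. Inl (x n)) (Inr \<xi>) F"
proof (rule limitin_boundaryI[OF xi])
  fix r :: real
  obtain s where s: "s \<in> \<xi>" using gromov_boundaryE[OF xi] by blast
  show "eventually (\<lambda>n. ereal r < gromov_sup b (Inr \<xi>) (Inl (x n))) F"
    using ge[of "r + 2"]
  proof eventually_elim
    case (elim n)
    then have "ereal (r + 1) < gromov_ext b (Inl (x n)) (Inr \<xi>)"
      by (rule less_le_trans[rotated]) simp
    then have "eventually (\<lambda>i. ereal (r + 1) < ereal (gromov_product dist b (x n) (s i))) sequentially"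
      using gromov_product_tendsto[OF limitin_Inl_const limitin_representative[OF xi s]] order_tendstoD by blast
    then have "eventually (\<lambda>i. r + 1 \<le> gromov_product dist b (s i) (x n)) sequentially"
      by eventually_elim (simp add: gromov_product_commute[of b _ "x n"])
    from gromov_sup_ge[OF s this] show ?case
      by (rule less_le_trans[rotated]) simp
  qed
qed

text \<open>The limit of \<open>d(s\<^sub>i, x) - d(s\<^sub>i, b)\<close> along any sequence \<open>s\<close> that represents \<open>\<xi>\<close>. It exists exactly,
  not only up to a bounded error, because the Gromov product extends continuously.\<close>

definition busemann :: "(nat \<Rightarrow> 'x) set \<Rightarrow> 'x \<Rightarrow> real" where
  "busemann \<xi> x = dist b x - 2 * real_of_ereal (gromov_ext b (Inl x) (Inr \<xi>))"

lemma gromov_ext_busemann: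
  assumes "\<xi> \<in> gromov_boundary"
  shows "gromov_ext b (Inl x) (Inr \<xi>) = ereal ((dist b x - busemann \<xi> x) / 2)"
proof -
  obtain r where "gromov_ext b (Inl x) (Inr \<xi>) = ereal r"
    using gromov_ext_Inl_real[of "Inr \<xi>" b x] assms by auto
  then show ?thesis by (simp add: busemann_def)
qed

lemma busemann_tendsto:
  assumes "\<xi> \<in> gromov_boundary" "s \<in> \<xi>"
  shows "(\<lambda>i. dist (s i) x - dist (s i) b) \<longlonglongrightarrow> busemann \<xi> x"
proof -
  have "(\<lambda>i. gromov_product dist b x (s i)) \<longlonglongrightarrow> (dist b x - busemann \<xi> x) / 2"
    using gromov_product_tendsto[OF limitin_Inl_const limitin_representative[OF assms], of b x]
    by (simp add: gromov_ext_busemann[OF assms(1)])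
  then have "(\<lambda>i. dist b x - 2 * gromov_product dist b x (s i)) \<longlonglongrightarrow> dist b x - 2 * ((dist b x - busemann \<xi> x) / 2)"
    by (intro tendsto_intros)
  moreover have "dist b x - 2 * gromov_product dist b x (s i) = dist (s i) x - dist (s i) b" for i
    unfolding gromov_product_def dist_commute[of b x] dist_commute[of x "s i"] by (simp add: field_simps)
  moreover have "dist b x - 2 * ((dist b x - busemann \<xi> x) / 2) = busemann \<xi> x"
    by (simp add: field_simps)
  ultimately show ?thesis by (simp only:)
qed

end

lemma gromov_product_isometry:
  fixes h :: "'x \<Rightarrow> 'x::metric_space"
  assumes "\<And>x y. dist (h x) (h y) = dist x y"
  shows "gromov_product dist (h p) (h x) (h y) = gromov_product dist p x y"
  by (simp add: gromov_product_def assms)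

text \<open>Both notions quantify over all basepoints, and a surjective isometry permutes the basepoints.\<close>

lemma asymptotic_isometry:
  fixes h :: "'x \<Rightarrow> 'x::metric_space"
  assumes iso: "\<And>x y. dist (h x) (h y) = dist x y" and surj: "surj h"
  shows "tends_to_infinity (h \<circ> s) \<longleftrightarrow> tends_to_infinity s"
    and "(h \<circ> s, h \<circ> t) \<in> asymptotic \<longleftrightarrow> (s, t) \<in> asymptotic"
proof -
  have *: "(\<forall>p. P p) \<longleftrightarrow> (\<forall>p. P (h p))" for P :: "'x \<Rightarrow> bool"
    using surj by (metis surjD)
  show "tends_to_infinity (h \<circ> s) \<longleftrightarrow> tends_to_infinity s" for s
    unfolding tends_to_infinity_def by (subst *) (simp add: gromov_product_isometry[OF iso])
  moreover have "(\<forall>p. LIM (i, j) sequentially \<times>\<^sub>F sequentially. gromov_product dist p ((h \<circ> s) i) ((h \<circ> t) j) :> at_top)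
    \<longleftrightarrow> (\<forall>p. LIM (i, j) sequentially \<times>\<^sub>F sequentially. gromov_product dist p (s i) (t j) :> at_top)"
    by (subst *) (simp add: gromov_product_isometry[OF iso])
  ultimately show "(h \<circ> s, h \<circ> t) \<in> asymptotic \<longleftrightarrow> (s, t) \<in> asymptotic"
    unfolding asymptotic_def by simp
qed

lemma boundary_map_boundary:
  fixes h :: "'x \<Rightarrow> 'x::metric_space"
  assumes iso: "\<And>x y. dist (h x) (h y) = dist x y" and surj: "surj h" and xi: "\<xi> \<in> gromov_boundary"
  shows "boundary_map h \<xi> \<in> gromov_boundary"
proof -
  obtain s where s: "tends_to_infinity s" "\<xi> = asymptotic `` {s}"
    using gromov_boundaryE[OF xi] by blast
  have "boundary_map h \<xi> = asymptotic `` {h \<circ> s}"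
  proof
    show "boundary_map h \<xi> \<subseteq> asymptotic `` {h \<circ> s}"
      using asymptotic_isometry(2)[OF iso surj] by (auto simp: s(2) boundary_map_def)
    show "asymptotic `` {h \<circ> s} \<subseteq> boundary_map h \<xi>"
    proof
      fix t assume t: "t \<in> asymptotic `` {h \<circ> s}"
      have "t = h \<circ> (inv_into UNIV h \<circ> t)" using surj by (auto simp: surj_f_inv_f)
      moreover from this t have "inv_into UNIV h \<circ> t \<in> \<xi>"
        using asymptotic_isometry(2)[OF iso surj, of s "inv_into UNIV h \<circ> t"] by (simp add: s(2))
      ultimately show "t \<in> boundary_map h \<xi>" unfolding boundary_map_def by blast
    qed
  qed
  then show ?thesis
    using s asymptotic_isometry(1)[OF iso surj] by (auto simp: gromov_boundary_def quotient_def)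
qed

lemma boundary_map_comp: "boundary_map (g \<circ> h) \<xi> = boundary_map g (boundary_map h \<xi>)"
  by (auto simp: boundary_map_def image_image comp_assoc)

lemma boundary_map_id: "boundary_map id \<xi> = \<xi>"
  by (simp add: boundary_map_def)

context good_space
begin

lemma gromov_ext_boundary_map:
  assumes iso: "\<And>x y. dist (h x) (h y) = dist x y" and surj: "surj (h :: 'x \<Rightarrow> 'x)"
    and xi: "\<xi> \<in> gromov_boundary" "\<eta> \<in> gromov_boundary"
  shows "gromov_ext (h p) (Inr (boundary_map h \<xi>)) (Inr (boundary_map h \<eta>)) = gromov_ext p (Inr \<xi>) (Inr \<eta>)"
proof -
  obtain s t where st: "s \<in> \<xi>" "t \<in> \<eta>" using gromov_boundaryE xi by metis
  have "h \<circ> s \<in> boundary_map h \<xi>" "h \<circ> t \<in> boundary_map h \<eta>"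
    using st by (auto simp: boundary_map_def)
  from gromov_product_tendsto[OF limitin_representative[OF boundary_map_boundary[OF iso surj xi(1)] this(1)]
      limitin_representative[OF boundary_map_boundary[OF iso surj xi(2)] this(2)], of "h p"]
  have "(\<lambda>n. ereal (gromov_product dist p (s n) (t n))) \<longlonglongrightarrow>
      gromov_ext (h p) (Inr (boundary_map h \<xi>)) (Inr (boundary_map h \<eta>))"
    by (simp add: gromov_product_isometry[OF iso])
  with gromov_product_tendsto[OF limitin_representative[OF xi(1) st(1)] limitin_representative[OF xi(2) st(2)], of p]
  show ?thesis by (metis LIMSEQ_unique)
qed

lemma visual_dist_boundary_map:
  assumes iso: "\<And>x y. dist (h x) (h y) = dist x y" and surj: "surj (h :: 'x \<Rightarrow> 'x)"
    and xi: "\<xi> \<in> gromov_boundary" "\<eta> \<in> gromov_boundary"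
  shows "visual_dist (h p) \<epsilon> (boundary_map h \<xi>) (boundary_map h \<eta>) = visual_dist p \<epsilon> \<xi> \<eta>"
  by (simp add: visual_dist_eq boundary_map_boundary[OF iso surj] xi gromov_ext_boundary_map[OF iso surj xi])

end

locale good_space_action = good_space b \<delta> \<epsilon>
  for b :: "'x::metric_space" and \<delta> \<epsilon> :: real +
  fixes G :: "('g, 'm) monoid_scheme" (structure) and \<phi> :: "'g \<Rightarrow> 'x \<Rightarrow> 'x"
  assumes isometric: "isometric_action G \<phi>"
begin

sublocale group_action G UNIV \<phi>
  using isometric by (simp add: isometric_action_def)

sublocale group G
  using group_hom by (rule group_hom.axioms(1))

lemma action_isometry: "g \<in> carrier G \<Longrightarrow> dist (\<phi> g x) (\<phi> g y) = dist x y"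
  using isometric by (simp add: isometric_action_def)

lemma action_surj: "g \<in> carrier G \<Longrightarrow> surj (\<phi> g)"
  using surj_prop by blast

lemma action_mult: "g \<in> carrier G \<Longrightarrow> h \<in> carrier G \<Longrightarrow> \<phi> (g \<otimes> h) = \<phi> g \<circ> \<phi> h"
  by (rule ext) (simp add: composition_rule)

lemma action_one: "\<phi> \<one> = id"
  by (rule ext) (simp add: id_eq_one[symmetric])

lemma boundary_action:
  assumes "g \<in> carrier G" "\<xi> \<in> gromov_boundary"
  shows "boundary_map (\<phi> g) \<xi> \<in> gromov_boundary"
  using assms by (intro boundary_map_boundary action_isometry action_surj)

lemma boundary_action_mult:
  "g \<in> carrier G \<Longrightarrow> h \<in> carrier G \<Longrightarrow> boundary_map (\<phi> (g \<otimes> h)) \<xi> = boundary_map (\<phi> g) (boundary_map (\<phi> h) \<xi>)"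
  by (simp add: action_mult boundary_map_comp)

lemma boundary_action_inv:
  "g \<in> carrier G \<Longrightarrow> boundary_map (\<phi> (inv g)) (boundary_map (\<phi> g) \<xi>) = \<xi>"
  using boundary_action_mult[of "inv g" g \<xi>] by (simp add: action_one boundary_map_id)

lemma visual_dist_action:
  assumes "g \<in> carrier G" "\<xi> \<in> gromov_boundary" "\<eta> \<in> gromov_boundary"
  shows "visual_dist (\<phi> g p) \<epsilon> (boundary_map (\<phi> g) \<xi>) (boundary_map (\<phi> g) \<eta>) = visual_dist p \<epsilon> \<xi> \<eta>"
  using assms by (intro visual_dist_boundary_map action_isometry action_surj)

text \<open>Take a far point \<open>w\<close> of a sequence that represents \<open>\<xi>\<close> and the point at parameter \<open>r\<close> on a rough
  geodesic from \<open>b\<close> to \<open>w\<close>, and move it to the orbit of \<open>b\<close> by a bounded amount.\<close>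

lemma orbit_points_near_rays:
  assumes rg: "roughly_geodesic TYPE('x)" and cc: "cocompact G \<phi>"
  obtains C where "0 \<le> C" "\<And>\<xi> r. \<xi> \<in> gromov_boundary \<Longrightarrow> 0 \<le> r \<Longrightarrow>
     \<exists>g\<in>carrier G. dist b (\<phi> g b) \<le> r + C \<and> ereal (r - C) \<le> gromov_ext b (Inl (\<phi> g b)) (Inr \<xi>)"
proof -
  obtain C0 where C0: "0 < C0" and geo: "\<And>x y::'x. \<exists>a c (r::real \<Rightarrow> 'x). a \<le> c \<and> r a = x \<and> r c = y \<and>
        (\<forall>s\<in>{a..c}. \<forall>t\<in>{a..c}. \<bar>t - s\<bar> - C0 \<le> dist (r t) (r s) \<and> dist (r t) (r s) \<le> \<bar>t - s\<bar> + C0)"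
    using rg unfolding roughly_geodesic_def by blast
  obtain K where K: "compact K" "(\<Union>g\<in>carrier G. \<phi> g ` K) = UNIV"
    using cc unfolding cocompact_def by blast
  obtain R where R: "0 \<le> R" "\<And>k. k \<in> K \<Longrightarrow> dist b k \<le> R"
  proof -
    obtain e where "\<forall>k\<in>K. dist b k \<le> e"
      using compact_imp_bounded[OF K(1)] unfolding bounded_any_center[where a = b] by blast
    then show ?thesis using that[of "max e 0"] by (auto simp: le_max_iff_disj)
  qed
  have near: "\<exists>g\<in>carrier G. dist (\<phi> g b) x \<le> R" for x
  proof -
    obtain g k where "g \<in> carrier G" "k \<in> K" "x = \<phi> g k" using K(2) by blast
    then show ?thesis using R(2)[of k] action_isometry[of g b k] by (intro bexI[of _ g]) auto
  qed
  \<comment> \<open>Three times the rough geodesic error for the Gromov product, the distance to the orbit, and one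
    use of hyperbolicity.\<close>
  define C where "C = 3 * C0 + R + \<delta>"
  show ?thesis
  proof (rule that[of C])
    show "0 \<le> C" using C0 R delta_nonneg by (simp add: C_def)
    fix \<xi> :: "(nat \<Rightarrow> 'x) set" and n :: real assume xi: "\<xi> \<in> gromov_boundary" and n: "0 \<le> n"
    obtain s where s: "tends_to_infinity s" "s \<in> \<xi>" using gromov_boundaryE[OF xi] by blast
    have "LIM (i, j) sequentially \<times>\<^sub>F sequentially. gromov_product dist b (s i) (s j) :> at_top"
      using s(1) by (simp add: tends_to_infinity_def)
    then obtain N where N: "\<And>i j. N \<le> i \<Longrightarrow> N \<le> j \<Longrightarrow> n \<le> gromov_product dist b (s i) (s j)"
      by (rule LIM_product_eventually) blast
    define w where "w = s N"
    have w: "n \<le> dist b w" using N[of N N] by (simp add: w_def gromov_product_def dist_commute)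
    obtain a c and r :: "real \<Rightarrow> 'x" where r: "a \<le> c" "r a = b" "r c = w"
      "\<forall>s\<in>{a..c}. \<forall>t\<in>{a..c}. \<bar>t - s\<bar> - C0 \<le> dist (r t) (r s) \<and> dist (r t) (r s) \<le> \<bar>t - s\<bar> + C0"
      using geo[of b w] by blast
    have rgeo: "\<bar>t - s\<bar> - C0 \<le> dist (r t) (r s) \<and> dist (r t) (r s) \<le> \<bar>t - s\<bar> + C0"
      if "s \<in> {a..c}" "t \<in> {a..c}" for s t
      using r(4) that by simp
    \<comment> \<open>The parameter interval may be shorter than \<open>n\<close>, by at most \<open>C0\<close>.\<close>
    define u where "u = min n (c - a)"
    define x where "x = r (a + u)"
    have u: "a + u \<in> {a..c}" "0 \<le> u" "u \<le> n" using n r(1) by (auto simp: u_def)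
    have ac: "a \<in> {a..c}" "c \<in> {a..c}" using r(1) by auto
    have bw: "dist b w \<le> (c - a) + C0" "(c - a) - C0 \<le> dist b w"
      using rgeo[OF ac(1) ac(2)] r(1-3) by (auto simp: dist_commute)
    have bx: "dist b x \<le> u + C0" "u - C0 \<le> dist b x"
      using rgeo[OF ac(1) u(1)] r(2) u(2) by (auto simp: x_def dist_commute)
    have xw: "dist x w \<le> (c - a - u) + C0"
      using rgeo[OF u(1) ac(2)] r(3) u(1) by (auto simp: x_def dist_commute)
    have un: "n - C0 \<le> u" using bw w C0 by (auto simp: u_def)
    obtain g where g: "g \<in> carrier G" "dist (\<phi> g b) x \<le> R" using near by blast
    have gx: "dist b (\<phi> g b) \<le> n + C"
      using dist_triangle[of b "\<phi> g b" x] g(2) bx(1) u(3) C0 delta_nonneg by (simp add: C_def dist_commute)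
    have prod: "n - (3 * C0 + R) \<le> gromov_product dist b (\<phi> g b) w"
    proof -
      have "dist b x - R \<le> dist b (\<phi> g b)" "dist (\<phi> g b) w \<le> dist x w + R"
        using dist_triangle[of b x "\<phi> g b"] dist_triangle[of "\<phi> g b" w x] g(2) by (auto simp: dist_commute)
      then show ?thesis
        using bx bw xw un C0 by (simp add: gromov_product_def dist_commute field_simps)
    qed
    have "eventually (\<lambda>i. n - C \<le> gromov_product dist b (\<phi> g b) (s i)) sequentially"
      using eventually_ge_at_top[of N]
    proof eventually_elim
      case (elim i)
      have "n \<le> gromov_product dist b w (s i)" using N[of N i] elim by (simp add: w_def)
      then show ?case
        using gromov_product_hyperbolic[of "\<phi> g b" w "s i"] prod C0 R(1) by (auto simp: C_def min_def split: if_splits)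
    qed
    then have "ereal (n - C) \<le> gromov_ext b (Inl (\<phi> g b)) (Inr \<xi>)"
      by (intro tendsto_lowerbound[OF gromov_product_tendsto[OF limitin_Inl_const limitin_representative[OF xi s(2)]]]) auto
    with g(1) gx show "\<exists>g\<in>carrier G. dist b (\<phi> g b) \<le> n + C \<and> ereal (n - C) \<le> gromov_ext b (Inl (\<phi> g b)) (Inr \<xi>)"
      by blast
  qed
qed

end

section \<open>Finite boundaries and elementary groups\<close>

text \<open>If \<open>\<tau>\<close> vanishes on \<open>A\<close> then \<open>A\<close> is finite. Otherwise any element \<open>g0\<close> of \<open>A\<close> with \<open>\<tau> g0 > 0\<close>
  generates a subgroup of finite index in \<open>A\<close>: division with remainder brings the value of \<open>\<tau>\<close> into
  the interval \<open>[0, \<tau> g0]\<close>, and only finitely many elements of \<open>A\<close> have their value there. The set \<open>F\<close> says that \<open>A\<close> itself has finite index.\<close>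

lemma (in group) elementary_of_discrete_hom:
  fixes \<tau> :: "'a \<Rightarrow> real"
  assumes A: "subgroup A G"
    and hom: "\<And>g h. g \<in> A \<Longrightarrow> h \<in> A \<Longrightarrow> \<tau> (g \<otimes> h) = \<tau> g + \<tau> h"
    and fin: "\<And>c. finite {g \<in> A. \<bar>\<tau> g\<bar> \<le> c}"
    and F: "finite F" "F \<subseteq> carrier G" "\<And>g. g \<in> carrier G \<Longrightarrow> \<exists>a\<in>A. \<exists>f\<in>F. g = a \<otimes> f"
  shows "elementary_group G"
proof -
  note Acl = subgroup.mem_carrier[OF A] subgroup.one_closed[OF A] subgroup.m_closed[OF A] subgroup.m_inv_closed[OF A]
  have tau_one: "\<tau> \<one> = 0" using hom[of \<one> \<one>] Acl by simp
  have tau_inv: "\<tau> (inv g) = - \<tau> g" if "g \<in> A" for g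
    using hom[of g "inv g"] that Acl tau_one by (simp add: r_inv)
  have pow_A: "g [^] (n::nat) \<in> A" if "g \<in> A" for g n
    by (induction n) (use that Acl in auto)
  have tau_pow: "\<tau> (g [^] (n::nat)) = real n * \<tau> g" if "g \<in> A" for g n
    by (induction n) (use that hom pow_A tau_one in \<open>auto simp: algebra_simps\<close>)
  have ipow_A: "g [^] (k::int) \<in> A" and tau_ipow: "\<tau> (g [^] (k::int)) = of_int k * \<tau> g" if g: "g \<in> A" for g k
  proof -
    have "g [^] (k::int) \<in> A \<and> \<tau> (g [^] (k::int)) = of_int k * \<tau> g"
    proof (cases k rule: int_cases2)
      case (nonneg n)
      then show ?thesis using g pow_A tau_pow by (simp add: int_pow_int)
    next
      case (nonpos n)
      then show ?thesis using g pow_A tau_pow Acl tau_inv by (simp add: int_pow_neg int_pow_int)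
    qed
    then show "g [^] (k::int) \<in> A" "\<tau> (g [^] (k::int)) = of_int k * \<tau> g" by auto
  qed
  obtain g0 F0 where g0: "g0 \<in> A" and F0: "finite F0" "F0 \<subseteq> A"
    and dec: "\<And>g. g \<in> A \<Longrightarrow> \<exists>k::int. \<exists>f\<in>F0. g = g0 [^] k \<otimes> f"
  proof (cases "\<forall>g\<in>A. \<tau> g = 0")
    case True
    then have "A = {g \<in> A. \<bar>\<tau> g\<bar> \<le> 0}" by auto
    then have "finite A" using fin[of 0] by metis
    moreover have "\<exists>k::int. \<exists>f\<in>A. g = \<one> [^] k \<otimes> f" if "g \<in> A" for g
      using that Acl(1) by (intro exI[of _ 0] bexI[of _ g]) auto
    ultimately show ?thesis using that[of \<one> A] Acl(2) by blast
  next
    case False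
    then obtain g1 where g1: "g1 \<in> A" "\<tau> g1 \<noteq> 0" by blast
    define g0 where "g0 = (if 0 < \<tau> g1 then g1 else inv g1)"
    have g0: "g0 \<in> A" "0 < \<tau> g0" using g1 Acl tau_inv by (auto simp: g0_def)
    define F0 where "F0 = {g \<in> A. \<bar>\<tau> g\<bar> \<le> \<tau> g0}"
    have "\<exists>k::int. \<exists>f\<in>F0. g = g0 [^] k \<otimes> f" if g: "g \<in> A" for g
    proof -
      define k where "k = \<lfloor>\<tau> g / \<tau> g0\<rfloor>"
      define f where "f = g0 [^] (- k) \<otimes> g"
      have f: "f \<in> A" using ipow_A g0 g Acl by (simp add: f_def)
      have "\<tau> f = \<tau> g - of_int k * \<tau> g0"
        using hom[OF ipow_A[OF g0(1), of "- k"] g] tau_ipow[OF g0(1), of "- k"] by (simp add: f_def)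
      moreover have "of_int k * \<tau> g0 \<le> \<tau> g" "\<tau> g < (of_int k + 1) * \<tau> g0"
      proof -
        have "of_int k \<le> \<tau> g / \<tau> g0" "\<tau> g / \<tau> g0 < of_int k + 1"
          using floor_correct[of "\<tau> g / \<tau> g0"] by (auto simp: k_def)
        then show "of_int k * \<tau> g0 \<le> \<tau> g" "\<tau> g < (of_int k + 1) * \<tau> g0"
          by (simp_all add: pos_le_divide_eq[OF g0(2)] pos_divide_less_eq[OF g0(2)])
      qed
      ultimately have "f \<in> F0" using f by (simp add: F0_def distrib_right)
      moreover have "g = g0 [^] k \<otimes> f"
        using Acl(1)[OF g0(1)] Acl(1)[OF g] by (simp add: f_def m_assoc[symmetric] int_pow_neg int_pow_closed)
      ultimately show ?thesis by blast
    qed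
    then show ?thesis using that[of g0 F0] g0 fin by (auto simp: F0_def)
  qed
  define H where "H = generate G (carrier G \<inter> {g0})"
  have g0c: "g0 \<in> carrier G" using g0 Acl by blast
  have H: "subgroup H G" unfolding H_def by (rule generate_is_subgroup) auto
  have cyc: "cyclic_group (G\<lparr>carrier := H\<rparr>)"
    using cyclic_group_generated[of g0] by (simp add: subgroup_generated_def H_def)
  have powH: "g0 [^] (k::int) \<in> H" for k
  proof -
    have "generate G {g0} = {g0 [^] k | k. k \<in> (UNIV :: int set)}" by (rule generate_pow[OF g0c])
    then show ?thesis using g0c by (auto simp: H_def)
  qed
  have "rcosets H \<subseteq> (\<lambda>(f0, f). H #> (f0 \<otimes> f)) ` (F0 \<times> F)"
  proof
    fix C assume "C \<in> rcosets H"
    then obtain g where g: "g \<in> carrier G" "C = H #> g" by (auto simp: RCOSETS_def)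
    obtain a f where a: "a \<in> A" "f \<in> F" "g = a \<otimes> f" using F(3)[OF g(1)] by blast
    obtain k :: int and f0 where k: "f0 \<in> F0" "a = g0 [^] k \<otimes> f0" using dec[OF a(1)] by blast
    have cl: "f0 \<in> carrier G" "f \<in> carrier G" "g0 [^] k \<in> carrier G"
      using k(1) F0(2) a(2) F(2) Acl(1) g0c by (auto intro: int_pow_closed)
    have "g = g0 [^] k \<otimes> (f0 \<otimes> f)" using a k cl by (simp add: m_assoc)
    then have "C = (H #> (g0 [^] k)) #> (f0 \<otimes> f)"
      using g(2) cl subgroup.subset[OF H] by (simp add: coset_mult_assoc)
    also have "H #> (g0 [^] k) = H" using cl H powH by (intro coset_join2) auto
    finally show "C \<in> (\<lambda>(f0, f). H #> (f0 \<otimes> f)) ` (F0 \<times> F)"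
      using k(1) a(2) by auto
  qed
  then have "finite (rcosets H)"
    by (rule finite_subset) (use F0 F in auto)
  then show ?thesis using H cyc unfolding elementary_group_def by blast
qed

context good_space_action
begin

text \<open>The Busemann function is a cocycle, and it is a homomorphism on the stabilizer of \<open>\<xi>\<close>.\<close>

lemma busemann_mult:
  assumes g: "g \<in> carrier G" and h: "h \<in> carrier G" and xi: "\<xi> \<in> gromov_boundary"
    and fix_g: "boundary_map (\<phi> (inv g)) \<xi> = \<xi>"
  shows "busemann \<xi> (\<phi> (g \<otimes> h) b) = busemann \<xi> (\<phi> g b) + busemann \<xi> (\<phi> h b)"
proof -
  obtain s where s: "s \<in> \<xi>" using gromov_boundaryE[OF xi] by blast
  have s': "\<phi> (inv g) \<circ> s \<in> \<xi>" using s fix_g by (auto simp: boundary_map_def)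
  have ig: "inv g \<in> carrier G" using g by simp
  have move: "dist (\<phi> (inv g) (s i)) y = dist (s i) (\<phi> g y)" for i y
  proof -
    have "\<phi> (inv g) (\<phi> g y) = y" using action_mult[OF ig g] g by (simp add: action_one fun_eq_iff)
    then show ?thesis using action_isometry[OF ig, of "s i" "\<phi> g y"] by simp
  qed
  have "(\<lambda>i. (dist ((\<phi> (inv g) \<circ> s) i) (\<phi> h b) - dist ((\<phi> (inv g) \<circ> s) i) b) + (dist (s i) (\<phi> g b) - dist (s i) b))
     \<longlonglongrightarrow> busemann \<xi> (\<phi> h b) + busemann \<xi> (\<phi> g b)"
    by (intro tendsto_add busemann_tendsto xi s s')
  then have "(\<lambda>i. dist (s i) (\<phi> g (\<phi> h b)) - dist (s i) b) \<longlonglongrightarrow> busemann \<xi> (\<phi> h b) + busemann \<xi> (\<phi> g b)"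
    by (simp add: move)
  moreover have "\<phi> (g \<otimes> h) b = \<phi> g (\<phi> h b)" using action_mult[OF g h] by simp
  ultimately have "(\<lambda>i. dist (s i) (\<phi> (g \<otimes> h) b) - dist (s i) b) \<longlonglongrightarrow> busemann \<xi> (\<phi> h b) + busemann \<xi> (\<phi> g b)"
    by (simp only:)
  from LIMSEQ_unique[OF busemann_tendsto[OF xi s] this] show ?thesis by simp
qed

text \<open>The elements that fix \<open>\<xi>\<close> and \<open>\<eta>\<close> form a subgroup of finite index. Along its orbits the Busemann
  functions of \<open>\<xi>\<close> and \<open>\<eta>\<close> are opposite to each other, since the Gromov product of \<open>\<xi>\<close> and \<open>\<eta>\<close> does not
  change with the basepoint there. By hyperbolicity an orbit point with small Busemann functions is
  close to \<open>b\<close>, and proper discontinuity leaves finitely many of them.\<close>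

lemma elementary_of_finite_boundary:
  fixes \<xi> \<eta> :: "(nat \<Rightarrow> 'x) set"
  assumes pd: "properly_discontinuous G \<phi>" and proper: "proper_metric TYPE('x)"
    and fin: "finite (gromov_boundary :: (nat \<Rightarrow> 'x) set set)"
    and xi: "\<xi> \<in> gromov_boundary" and eta: "\<eta> \<in> gromov_boundary" and ne: "\<xi> \<noteq> \<eta>"
  shows "elementary_group G"
proof -
  define A where "A = {g \<in> carrier G. boundary_map (\<phi> g) \<xi> = \<xi> \<and> boundary_map (\<phi> g) \<eta> = \<eta>}"
  have inv_fix: "boundary_map (\<phi> (inv g)) \<zeta> = \<zeta>" if "g \<in> carrier G" "boundary_map (\<phi> g) \<zeta> = \<zeta>" for g \<zeta>
    using boundary_action_inv[OF that(1), of \<zeta>] that(2) by simp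
  have A: "subgroup A G"
  proof (rule subgroupI)
    show "A \<subseteq> carrier G" by (auto simp: A_def)
    have "\<one> \<in> A" by (simp add: A_def action_one boundary_map_id)
    then show "A \<noteq> {}" by blast
    show "inv g \<in> A" if "g \<in> A" for g using that inv_fix by (simp add: A_def)
    show "g \<otimes> h \<in> A" if "g \<in> A" "h \<in> A" for g h
      using that by (simp add: A_def boundary_action_mult)
  qed
  define c where "c g = (boundary_map (\<phi> (inv g)) \<xi>, boundary_map (\<phi> (inv g)) \<eta>)" for g
  \<comment> \<open>One representative for each pair of images of \<open>\<xi>\<close> and \<open>\<eta>\<close>; there are finitely many pairs.\<close>
  define F where "F = (\<lambda>v. SOME g. g \<in> carrier G \<and> c g = v) ` (c ` carrier G)"
  have "c ` carrier G \<subseteq> gromov_boundary \<times> gromov_boundary"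
    using xi eta boundary_action by (auto simp: c_def)
  then have "finite (c ` carrier G)" by (rule finite_subset) (use fin in simp)
  then have F: "finite F" unfolding F_def by (rule finite_imageI)
  have some: "(SOME f. f \<in> carrier G \<and> c f = c g) \<in> carrier G \<and> c (SOME f. f \<in> carrier G \<and> c f = c g) = c g"
    if "g \<in> carrier G" for g
    by (rule someI[of "\<lambda>f. f \<in> carrier G \<and> c f = c g" g]) (use that in simp)
  show ?thesis
  proof (rule elementary_of_discrete_hom[OF A, where \<tau> = "\<lambda>g. busemann \<xi> (\<phi> g b)" and F = F])
    show "finite F" by (rule F)
    show "F \<subseteq> carrier G"
    proof
      fix f assume "f \<in> F"
      then obtain g where "g \<in> carrier G" "f = (SOME f. f \<in> carrier G \<and> c f = c g)"
        unfolding F_def by blast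
      then show "f \<in> carrier G" using some[of g] by (simp only:)
    qed
    show "\<exists>a\<in>A. \<exists>f\<in>F. g = a \<otimes> f" if g: "g \<in> carrier G" for g
    proof -
      define f where "f = (SOME f. f \<in> carrier G \<and> c f = c g)"
      have f: "f \<in> carrier G" "c f = c g" "f \<in> F" using some[OF g] g by (auto simp: f_def F_def)
      have "boundary_map (\<phi> (g \<otimes> inv f)) \<zeta> = \<zeta>" if "\<zeta> \<in> {\<xi>, \<eta>}" for \<zeta>
      proof -
        have "boundary_map (\<phi> (inv f)) \<zeta> = boundary_map (\<phi> (inv g)) \<zeta>" using f(2) that by (auto simp: c_def)
        then have "boundary_map (\<phi> (g \<otimes> inv f)) \<zeta> = boundary_map (\<phi> (inv (inv g))) (boundary_map (\<phi> (inv g)) \<zeta>)"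
          using g f(1) by (simp add: boundary_action_mult)
        then show ?thesis using boundary_action_inv[of "inv g" \<zeta>] g by simp
      qed
      then have "g \<otimes> inv f \<in> A" using g f(1) by (simp add: A_def)
      moreover have "g = g \<otimes> inv f \<otimes> f" using g f(1) by (simp add: m_assoc)
      ultimately show ?thesis using f(3) by blast
    qed
    show "busemann \<xi> (\<phi> (g \<otimes> h) b) = busemann \<xi> (\<phi> g b) + busemann \<xi> (\<phi> h b)" if "g \<in> A" "h \<in> A" for g h
      using that xi inv_fix by (intro busemann_mult) (auto simp: A_def)
    show "finite {g \<in> A. \<bar>busemann \<xi> (\<phi> g b)\<bar> \<le> M}" for M
    proof -
      obtain r where r: "gromov_ext b (Inr \<xi>) (Inr \<eta>) = ereal r"
        using gromov_ext_finite[OF xi eta ne] by blast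
      have bound: "dist b (\<phi> g b) \<le> 2 * r + 2 * \<delta> + \<bar>busemann \<xi> (\<phi> g b)\<bar>" if g: "g \<in> A" for g
      proof -
        define p where "p = \<phi> g b"
        have gc: "g \<in> carrier G" "boundary_map (\<phi> g) \<xi> = \<xi>" "boundary_map (\<phi> g) \<eta> = \<eta>"
          using g by (auto simp: A_def)
        have "gromov_ext p (Inr \<xi>) (Inr \<eta>) = ereal r"
          using gromov_ext_boundary_map[OF action_isometry[OF gc(1)] action_surj[OF gc(1)] xi eta, of b] gc r
          by (simp add: p_def)
        then have "r = r + ((dist b p - busemann \<xi> p) / 2 + (dist b p - busemann \<eta> p) / 2 - dist b p)"
          using gromov_ext_change_basepoint[of "Inr \<xi>" "Inr \<eta>", OF _ _ gromov_ext_busemann[OF xi, of p] gromov_ext_busemann[OF eta, of p]] xi eta r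
          by simp
        then have opp: "busemann \<eta> p = - busemann \<xi> p" by (simp add: field_simps)
        define m where "m = min ((dist b p - busemann \<xi> p) / 2) ((dist b p - busemann \<eta> p) / 2)"
        have "ereal (m - \<delta>) \<le> gromov_ext b (Inr \<xi>) (Inr \<eta>)"
        proof (rule gromov_ext_hyperbolic[where v = "Inl p"])
          show "ereal m \<le> gromov_ext b (Inr \<xi>) (Inl p)"
            using gromov_ext_commute[of "Inr \<xi>" "Inl p" b] xi by (simp add: gromov_ext_busemann[OF xi] m_def)
          show "ereal m \<le> gromov_ext b (Inl p) (Inr \<eta>)"
            by (simp add: gromov_ext_busemann[OF eta] m_def)
        qed (use xi eta in auto)
        then have "m \<le> r + \<delta>" by (simp add: r)
        then have "dist b p \<le> 2 * r + 2 * \<delta> + \<bar>busemann \<xi> p\<bar>"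
          unfolding m_def opp min_le_iff_disj by (elim disjE) (simp_all add: field_simps)
        then show ?thesis by (simp add: p_def)
      qed
      define R where "R = max 0 (2 * r + 2 * \<delta> + M)"
      have "compact (cball b R)" using proper by (simp add: proper_metric_def)
      then have "finite {g \<in> carrier G. \<phi> g ` cball b R \<inter> cball b R \<noteq> {}}"
        using pd by (simp add: properly_discontinuous_def)
      moreover have "{g \<in> A. \<bar>busemann \<xi> (\<phi> g b)\<bar> \<le> M} \<subseteq> {g \<in> carrier G. \<phi> g ` cball b R \<inter> cball b R \<noteq> {}}"
      proof (rule subsetI, rule CollectI)
        fix g assume "g \<in> {g \<in> A. \<bar>busemann \<xi> (\<phi> g b)\<bar> \<le> M}"
        then have g: "g \<in> A" "\<bar>busemann \<xi> (\<phi> g b)\<bar> \<le> M" by auto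
        have "dist b (\<phi> g b) \<le> R" using bound[OF g(1)] g(2) by (simp add: R_def)
        then have "\<phi> g b \<in> \<phi> g ` cball b R \<inter> cball b R" by (auto simp: R_def)
        then show "g \<in> carrier G \<and> \<phi> g ` cball b R \<inter> cball b R \<noteq> {}" using g(1) by (auto simp: A_def)
      qed
      ultimately show ?thesis by (rule finite_subset[rotated])
    qed
  qed
qed

end

section \<open>Hausdorff measure\<close>

lemma ediam_le_scale:
  assumes "0 \<le> L" and lip: "\<And>x y. x \<in> V \<Longrightarrow> y \<in> V \<Longrightarrow> d x y \<le> L * d (f x) (f y)"
    and sub: "f ` V \<subseteq> U"
  shows "ediam d V \<le> ennreal L * ediam d U"
  unfolding ediam_def
proof (intro SUP_least)
  fix x y assume xy: "x \<in> V" "y \<in> V"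
  have "ennreal (d x y) \<le> ennreal L * ennreal (d (f x) (f y))"
    using lip[OF xy] \<open>0 \<le> L\<close> by (simp add: ennreal_mult'[symmetric] ennreal_leI)
  also have "ennreal (d (f x) (f y)) \<le> (SUP y\<in>U. ennreal (d (f x) y))"
    using sub xy by (intro SUP_upper) auto
  also have "\<dots> \<le> (SUP x\<in>U. SUP y\<in>U. ennreal (d x y))"
    using sub xy by (intro SUP_upper[of "f x" U]) auto
  finally show "ennreal (d x y) \<le> ennreal L * (SUP x\<in>U. SUP y\<in>U. ennreal (d x y))"
    by (simp add: mult_left_mono)
qed

text \<open>A map that expands distances at least by the factor \<open>1 / L\<close> pulls a cover of \<open>M\<close> back to a cover of
  \<open>B\<close> by sets whose diameters are smaller by the factor \<open>L\<close>.\<close>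

lemma hausdorff_outer_le_expanding:
  assumes L: "0 < L" and s: "0 < s" and B: "B \<subseteq> M" and f: "f ` B \<subseteq> M"
    and lip: "\<And>x y. x \<in> B \<Longrightarrow> y \<in> B \<Longrightarrow> d x y \<le> L * d (f x) (f y)"
  shows "hausdorff_outer M d s B \<le> ennreal (L powr s) * hausdorff_outer M d s M"
proof -
  let ?cov = "\<lambda>A \<delta>. {U::nat \<Rightarrow> 'a set. A \<subseteq> (\<Union>n. U n) \<and> (\<forall>n. U n \<subseteq> M \<and> ediam d (U n) \<le> ennreal \<delta>)}"
  have Ls: "ennreal (L powr s) \<noteq> 0" "ennreal (L powr s) < \<infinity>" using L by auto
  show ?thesis
    unfolding hausdorff_outer_def[of M d s B]
  proof (intro SUP_least)
    fix \<delta> :: real assume "\<delta> \<in> {0<..}"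
    then have \<delta>: "0 < \<delta>" by simp
    define I where "I = (INF U\<in>?cov B \<delta>. \<Sum>n. diam_power d s (U n))"
    have le: "I / ennreal (L powr s) \<le> (\<Sum>n. diam_power d s (U n))" if U: "U \<in> ?cov M (\<delta> / L)" for U
    proof (rule divide_le_posI_ennreal)
      show "0 < ennreal (L powr s)" using L by simp
      define V where "V n = {x \<in> B. f x \<in> U n}" for n
      have diam: "ediam d (V n) \<le> ennreal L * ediam d (U n)" for n
        using L lip by (intro ediam_le_scale) (auto simp: V_def)
      have Ufin: "ediam d (U n) \<le> ennreal (\<delta> / L)" for n using U by auto
      have "V \<in> ?cov B \<delta>"
      proof (rule CollectI, intro conjI allI)
        show "B \<subseteq> (\<Union>n. V n)"
        proof
          fix x assume x: "x \<in> B"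
          then obtain n where "f x \<in> U n" using f U by blast
          with x show "x \<in> (\<Union>n. V n)" by (auto simp: V_def)
        qed
        show "V n \<subseteq> M" for n using B by (auto simp: V_def)
        have "ediam d (V n) \<le> ennreal L * ennreal (\<delta> / L)" for n
          by (rule order_trans[OF diam mult_left_mono[OF Ufin]]) simp
        then show "ediam d (V n) \<le> ennreal \<delta>" for n
          using L \<delta> by (simp add: ennreal_mult'[symmetric])
      qed
      then have "I \<le> (\<Sum>n. diam_power d s (V n))"
        unfolding I_def by (rule INF_lower)
      also have "\<dots> \<le> (\<Sum>n. ennreal (L powr s) * diam_power d s (U n))"
      proof (intro suminf_le)
        fix n
        show "diam_power d s (V n) \<le> ennreal (L powr s) * diam_power d s (U n)"
        proof (cases "V n = {}")
          case False
          then have "U n \<noteq> {}" by (auto simp: V_def)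
          have fin: "ediam d (U n) < \<infinity>" using Ufin[of n] by (rule le_less_trans) simp
          have "enn2real (ediam d (V n)) \<le> enn2real (ennreal L * ediam d (U n))"
          proof (rule enn2real_mono[OF diam])
            show "ennreal L * ediam d (U n) < top_class.top"
              using fin by (simp add: ennreal_mult_less_top)
          qed
          also have "\<dots> = L * enn2real (ediam d (U n))"
            using L by (simp add: enn2real_mult)
          finally have "enn2real (ediam d (V n)) powr s \<le> (L * enn2real (ediam d (U n))) powr s"
            using s by (intro powr_mono2) auto
          also have "\<dots> = L powr s * enn2real (ediam d (U n)) powr s"
            using L by (simp add: powr_mult)
          finally show ?thesis
            using False \<open>U n \<noteq> {}\<close> s by (simp add: diam_power_def ennreal_mult'[symmetric] ennreal_leI)
        qed (simp add: diam_power_def)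
      qed auto
      also have "\<dots> = ennreal (L powr s) * (\<Sum>n. diam_power d s (U n))" by simp
      finally show "I \<le> ennreal (L powr s) * (\<Sum>n. diam_power d s (U n))" .
    qed
    have "I / ennreal (L powr s) \<le> (INF U\<in>?cov M (\<delta> / L). \<Sum>n. diam_power d s (U n))"
      by (intro INF_greatest le)
    also have "\<dots> \<le> hausdorff_outer M d s M"
      unfolding hausdorff_outer_def using \<delta> L by (intro SUP_upper) simp
    finally have "I / ennreal (L powr s) * ennreal (L powr s) \<le> hausdorff_outer M d s M * ennreal (L powr s)"
      by (rule mult_right_mono) simp
    moreover have "I / ennreal (L powr s) * ennreal (L powr s) = I"
      using Ls by (simp add: ennreal_divide_times)
    ultimately show "I \<le> ennreal (L powr s) * hausdorff_outer M d s M"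
      by (simp add: mult.commute)
  qed
qed

lemma hausdorff_outer_singleton_pos_dim:
  assumes "0 < s" "x \<in> M" "d x x = 0"
  shows "hausdorff_outer M d s {x} = 0"
proof -
  have "hausdorff_outer M d s {x} \<le> 0"
    unfolding hausdorff_outer_def
  proof (intro SUP_least)
    fix \<delta> :: real
    define U where "U n = (if n = 0 then {x} else {})" for n :: nat
    have "(\<Sum>n. diam_power d s (U n)) = (\<Sum>n\<in>{}. diam_power d s (U n))"
      using assms by (intro suminf_finite) (auto simp: U_def diam_power_def ediam_def)
    then have "(\<Sum>n. diam_power d s (U n)) = 0" by simp
    moreover have "U \<in> {U. {x} \<subseteq> (\<Union>n. U n) \<and> (\<forall>n. U n \<subseteq> M \<and> ediam d (U n) \<le> ennreal \<delta>)}"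
      using assms by (auto simp: U_def ediam_def bot_ennreal)
    ultimately show "(INF U\<in>{U. {x} \<subseteq> (\<Union>n. U n) \<and> (\<forall>n. U n \<subseteq> M \<and> ediam d (U n) \<le> ennreal \<delta>)}.
        \<Sum>n. diam_power d s (U n)) \<le> 0"
      by (metis (mono_tags, lifting) INF_lower)
  qed
  then show ?thesis by simp
qed

lemma hausdorff_outer_singleton_zero_dim:
  "1 \<le> hausdorff_outer M d 0 {x}"
proof -
  have "1 \<le> (INF U\<in>{U::nat \<Rightarrow> 'a set. {x} \<subseteq> (\<Union>n. U n) \<and> (\<forall>n. U n \<subseteq> M \<and> ediam d (U n) \<le> ennreal 1)}. \<Sum>n. diam_power d 0 (U n))"
  proof (intro INF_greatest)
    fix U :: "nat \<Rightarrow> 'a set"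
    assume "U \<in> {U. {x} \<subseteq> (\<Union>n. U n) \<and> (\<forall>n. U n \<subseteq> M \<and> ediam d (U n) \<le> ennreal 1)}"
    then obtain n where "x \<in> U n" by auto
    then have "1 = diam_power d 0 (U n)" by (auto simp: diam_power_def)
    also have "\<dots> = (\<Sum>k\<in>{n}. diam_power d 0 (U k))" by simp
    also have "\<dots> \<le> (\<Sum>k. diam_power d 0 (U k))"
      by (intro sum_le_suminf) auto
    finally show "1 \<le> (\<Sum>k. diam_power d 0 (U k))" .
  qed
  also have "\<dots> \<le> hausdorff_outer M d 0 {x}"
    unfolding hausdorff_outer_def by (intro SUP_upper) simp
  finally show ?thesis .
qed

text \<open>The infimum over an empty family of covers would be infinite.\<close>

lemma hausdorff_outer_finite_cover:
  assumes "hausdorff_outer M d s A < \<infinity>" "0 < (\<delta>::real)"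
  obtains U :: "nat \<Rightarrow> 'a set" where "A \<subseteq> (\<Union>n. U n)" "\<And>n. U n \<subseteq> M" "\<And>n. ediam d (U n) \<le> ennreal \<delta>"
proof -
  let ?C = "{U::nat \<Rightarrow> 'a set. A \<subseteq> (\<Union>n. U n) \<and> (\<forall>n. U n \<subseteq> M \<and> ediam d (U n) \<le> ennreal \<delta>)}"
  have "(INF U\<in>?C. \<Sum>n. diam_power d s (U n)) \<le> hausdorff_outer M d s A"
    unfolding hausdorff_outer_def using assms(2) by (intro SUP_upper) simp
  note le = this
  have "?C \<noteq> {}"
  proof
    assume "?C = {}"
    then show False using le assms(1) by (simp only: image_empty Inf_empty) simp
  qed
  then show ?thesis using that by auto
qed

lemma space_hausdorff_measure:
  assumes "Metric_space M d"
  shows "space (hausdorff_measure M d s) = M"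
proof -
  interpret Metric_space M d by fact
  have "{U. openin mtopology U} \<subseteq> Pow M"
    using openin_subset by fastforce
  then show ?thesis unfolding hausdorff_measure_def by (rule space_measure_of)
qed

locale finite_hausdorff = Metric_space M d for M :: "'a set" and d +
  fixes s :: real
  assumes s_nonneg: "0 \<le> s"
    and nontrivial: "emeasure (hausdorff_measure M d s) M \<noteq> 0"
    and finite: "emeasure (hausdorff_measure M d s) M \<noteq> \<infinity>"
begin

abbreviation "H \<equiv> hausdorff_measure M d s"

definition \<nu> :: "'a measure" where "\<nu> = uniform_measure H M"

lemma open_sets_Pow: "{U. openin mtopology U} \<subseteq> Pow M"
  using openin_subset by fastforce

lemma space_H [simp]: "space H = M" and sets_H: "sets H = sigma_sets M {U. openin mtopology U}"
  unfolding hausdorff_measure_def using open_sets_Pow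
  by (simp_all add: space_measure_of sets_measure_of)

text \<open>A measure built by \<^const>\<open>measure_of\<close> is zero unless its defining function is countably additive on
  the generated sigma algebra. So positive total mass already shows that the Hausdorff outer measure
  is additive on Borel sets.\<close>

lemma emeasure_H: "A \<in> sets H \<Longrightarrow> emeasure H A = hausdorff_outer M d s A"
proof -
  have "measure_space M (sigma_sets M {U. openin mtopology U}) (hausdorff_outer M d s)"
    using nontrivial unfolding hausdorff_measure_def emeasure_measure_of_conv
    by (auto split: if_splits)
  then show "A \<in> sets H \<Longrightarrow> emeasure H A = hausdorff_outer M d s A"
    unfolding sets_H unfolding hausdorff_measure_def emeasure_measure_of_conv by simp
qed

lemma M_in_sets_H [simp]: "M \<in> sets H"
  using sets.top[of H] by simp

lemma space_\<nu> [simp]: "space \<nu> = M" and sets_\<nu>: "sets \<nu> = sets H"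
  by (simp_all add: \<nu>_def)

lemma emeasure_\<nu>_M: "emeasure \<nu> M = 1"
  unfolding \<nu>_def by (rule emeasure_uniform_measure_1[OF nontrivial finite])

lemma finite_measure_\<nu>: "finite_measure \<nu>"
  by (rule finite_measureI) (simp add: emeasure_\<nu>_M)

lemma hausdorff_outer_M: "0 < hausdorff_outer M d s M" "hausdorff_outer M d s M < \<infinity>"
  using nontrivial finite emeasure_H[OF M_in_sets_H] by (auto simp: zero_less_iff_neq_zero top.not_eq_extremum)

lemma emeasure_\<nu>:
  assumes "A \<in> sets \<nu>"
  shows "emeasure \<nu> A = hausdorff_outer M d s A / hausdorff_outer M d s M"
proof -
  have A: "A \<in> sets H" using assms by (simp add: sets_\<nu>)
  then have "M \<inter> A = A" using sets.sets_into_space by fastforce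
  then show ?thesis using A by (simp add: \<nu>_def emeasure_H)
qed

lemma open_in_sets: "openin mtopology U \<Longrightarrow> U \<in> sets \<nu>"
  unfolding sets_\<nu> sets_H by (rule sigma_sets.Basic) simp

lemma closed_in_sets: "closedin mtopology C \<Longrightarrow> C \<in> sets \<nu>"
proof -
  assume C: "closedin mtopology C"
  then have "openin mtopology (M - C)" by (simp add: closedin_def)
  then have "space \<nu> - (M - C) \<in> sets \<nu>" by (intro sets.compl_sets open_in_sets)
  moreover have "M - (M - C) = C" using closedin_subset[OF C] by auto
  ultimately show "C \<in> sets \<nu>" by simp
qed

lemma mcball_in_sets: "mcball x r \<in> sets \<nu>"
  by (rule closed_in_sets[OF closedin_mcball])

lemma singleton_in_sets: "x \<in> M \<Longrightarrow> {x} \<in> sets \<nu>"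
proof -
  assume x: "x \<in> M"
  then have "{x} = mcball x 0"
    by (auto simp: set_eq_iff) (metis antisym nonneg zero)
  then show ?thesis using mcball_in_sets by metis
qed

text \<open>Finite Hausdorff measure provides countable covers by sets of arbitrarily small diameter; one
  point is chosen in each nonempty set.\<close>

lemma countable_dense:
  obtains Q where "countable Q" "Q \<subseteq> M" "Q \<noteq> {}" "\<And>x r. x \<in> M \<Longrightarrow> 0 < r \<Longrightarrow> \<exists>q\<in>Q. d x q < r"
proof -
  define P where "P k U \<longleftrightarrow> M \<subseteq> (\<Union>n. U n) \<and> (\<forall>n. U n \<subseteq> M) \<and> (\<forall>n. ediam d (U n) \<le> ennreal (1 / real (Suc k)))"
    for k :: nat and U :: "nat \<Rightarrow> 'a set"
  have "\<exists>U. P k U" for k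
  proof -
    have "0 < 1 / real (Suc k)" by simp
    from hausdorff_outer_finite_cover[OF hausdorff_outer_M(2) this] obtain U :: "nat \<Rightarrow> 'a set" where
      "M \<subseteq> (\<Union>n. U n)" "\<And>n. U n \<subseteq> M" "\<And>n. ediam d (U n) \<le> ennreal (1 / real (Suc k))"
      by blast
    then have "P k U" unfolding P_def by simp
    then show ?thesis by (rule exI[where x = U])
  qed
  then have "\<forall>k. \<exists>U. P k U" by simp
  then have "\<exists>V. \<forall>k. P k (V k)" by (rule choice)
  then obtain U :: "nat \<Rightarrow> nat \<Rightarrow> 'a set" where "\<forall>k. P k (U k)" by (rule exE)
  then have U: "M \<subseteq> (\<Union>n. U k n)" "U k n \<subseteq> M" "ediam d (U k n) \<le> ennreal (1 / real (Suc k))" for k n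
    by (auto simp: P_def)
  define Q where "Q = (\<lambda>(k, n). SOME x. x \<in> U k n) ` {(k, n). U k n \<noteq> {}}"
  have Q_in: "(SOME x. x \<in> U k n) \<in> U k n" if "U k n \<noteq> {}" for k n
    using that by (simp add: some_in_eq)
  have dense: "\<exists>q\<in>Q. d x q < r" if x: "x \<in> M" and r: "0 < r" for x r
  proof -
    obtain k where k: "1 / real (Suc k) < r"
      using reals_Archimedean[OF r] by (auto simp: inverse_eq_divide)
    obtain n where n: "x \<in> U k n" using U(1)[of k] x by blast
    define q where "q = (SOME x. x \<in> U k n)"
    have q: "q \<in> U k n" "q \<in> Q" using Q_in[of k n] n by (auto simp: q_def Q_def)
    have "ennreal (d x q) \<le> (SUP y\<in>U k n. ennreal (d x y))"
      using q(1) by (rule SUP_upper)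
    also have "\<dots> \<le> ediam d (U k n)"
      unfolding ediam_def using n by (rule SUP_upper)
    also have "\<dots> \<le> ennreal (1 / real (Suc k))" by (rule U(3))
    finally have "d x q \<le> 1 / real (Suc k)" by (simp add: ennreal_le_iff)
    with k q(2) show ?thesis by (intro bexI[of _ q]) auto
  qed
  have "M \<noteq> {}"
    using nontrivial by auto
  then have "Q \<noteq> {}" using dense[of _ 1] by fastforce
  moreover have "countable Q" unfolding Q_def by (intro countable_image) simp
  moreover have "Q \<subseteq> M" using Q_in U(2) by (force simp: Q_def)
  ultimately show ?thesis using that dense by blast
qed

lemma dist_section_measurable:
  assumes "q \<in> M" shows "(\<lambda>x. d q x) \<in> borel_measurable \<nu>"
proof (rule borel_measurableI_le)
  fix r
  have "{x \<in> space \<nu>. d q x \<le> r} = mcball q r" using assms by auto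
  then show "{x \<in> space \<nu>. d q x \<le> r} \<in> sets \<nu>" using mcball_in_sets by simp
qed

text \<open>By separability \<open>d x y\<close> is the infimum of \<open>d q x + d q y\<close> over a countable dense set of points
  \<open>q\<close>, which makes the distance measurable for the product sigma algebra.\<close>

lemma dist_measurable: "(\<lambda>(x, y). d x y) \<in> borel_measurable (\<nu> \<Otimes>\<^sub>M \<nu>)"
proof -
  obtain Q where Q: "countable Q" "Q \<subseteq> M" "Q \<noteq> {}" "\<And>x r. x \<in> M \<Longrightarrow> 0 < r \<Longrightarrow> \<exists>q\<in>Q. d x q < r"
    using countable_dense by blast
  have bdd: "bdd_below ((\<lambda>q. d q x + d q y) ` Q)" for x y
    by (rule bdd_belowI2[of _ 0]) simp
  have eq: "d x y = (INF q\<in>Q. d q x + d q y)" if xy: "x \<in> M" "y \<in> M" for x y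
  proof (rule antisym)
    show "d x y \<le> (INF q\<in>Q. d q x + d q y)"
    proof (rule cINF_greatest[OF Q(3)])
      fix q assume "q \<in> Q"
      then show "d x y \<le> d q x + d q y"
        using triangle[of x q y] Q(2) xy commute[of x q] by auto
    qed
    show "(INF q\<in>Q. d q x + d q y) \<le> d x y"
    proof (rule field_le_epsilon)
      fix e :: real assume "0 < e"
      then obtain q where q: "q \<in> Q" "d x q < e / 2" using Q(4)[OF xy(1), of "e / 2"] by auto
      have "(INF q\<in>Q. d q x + d q y) \<le> d q x + d q y"
        by (rule cINF_lower[OF bdd q(1)])
      also have "\<dots> \<le> d x y + e"
        using triangle[of q x y] q Q(2) xy commute[of x q] by auto
      finally show "(INF q\<in>Q. d q x + d q y) \<le> d x y + e" .
    qed
  qed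
  have "(\<lambda>z. INF q\<in>Q. d q (fst z) + d q (snd z)) \<in> borel_measurable (\<nu> \<Otimes>\<^sub>M \<nu>)"
  proof (rule borel_measurable_cINF[OF Q(1)])
    fix q assume "q \<in> Q"
    then have [measurable]: "d q \<in> borel_measurable \<nu>" using dist_section_measurable Q(2) by blast
    show "(\<lambda>z. d q (fst z) + d q (snd z)) \<in> borel_measurable (\<nu> \<Otimes>\<^sub>M \<nu>)" by measurable
  qed (rule bdd)
  then show ?thesis
    by (rule measurable_cong[THEN iffD1, rotated]) (auto simp: space_pair_measure eq)
qed

lemma emeasure_singleton:
  assumes "0 < s" "x \<in> M" shows "emeasure \<nu> {x} = 0"
  using hausdorff_outer_singleton_pos_dim[OF assms, of d] assms
  by (subst emeasure_\<nu>) (auto simp: singleton_in_sets)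

text \<open>In dimension zero every point has mass at least \<open>1\<close>.\<close>

lemma finite_carrier_of_zero_dim:
  assumes "s = 0" shows "Finite_Set.finite M"
proof (rule ccontr)
  assume inf: "infinite M"
  have le: "of_nat n \<le> emeasure H M" for n
  proof -
    obtain F where F: "F \<subseteq> M" "Finite_Set.finite F" "card F = n"
      using infinite_arbitrarily_large[OF inf] by blast
    have one: "1 \<le> emeasure H {x}" if "x \<in> F" for x
    proof -
      have "{x} \<in> sets H" using singleton_in_sets[of x] that F(1) by (auto simp: sets_\<nu>)
      then have "emeasure H {x} = hausdorff_outer M d s {x}" by (rule emeasure_H)
      then show ?thesis
        using hausdorff_outer_singleton_zero_dim[of M d x] by (simp only: \<open>s = 0\<close>)
    qed
    have "of_nat n = (\<Sum>x\<in>F. (1::ennreal))" using F by simp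
    also have "\<dots> \<le> (\<Sum>x\<in>F. emeasure H {x})" by (intro sum_mono one)
    also have "\<dots> = emeasure H F"
      using F singleton_in_sets by (intro emeasure_eq_sum_singleton[symmetric]) (auto simp: sets_\<nu>)
    also have "\<dots> \<le> emeasure H M"
      using F by (intro emeasure_mono) auto
    finally show ?thesis .
  qed
  have "emeasure H M < \<infinity>" using finite by (simp add: less_top)
  then obtain n where "emeasure H M < of_nat n"
    using ennreal_Ex_less_of_nat[of "emeasure H M"] by auto
  with le[of n] show False by simp
qed

text \<open>On the annulus where \<open>d x y\<close> is between \<open>exp (- (m + 1))\<close> and \<open>exp (- m)\<close> the integrand is at most
  \<open>exp (a (m + 1))\<close>, and the annulus has measure at most \<open>A exp (- m s)\<close>. The sum over \<open>m\<close> is a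
  convergent geometric series since \<open>a < s\<close>.\<close>

lemma riesz_kernel_nn_integral_le:
  assumes x: "x \<in> M" and a: "0 \<le> a" "a < s" and A: "0 \<le> A" and d1: "\<And>y. d x y \<le> 1"
    and ball: "\<And>m::nat. emeasure \<nu> (mcball x (exp (- real m))) \<le> ennreal (A * exp (- real m * s))"
  shows "(\<integral>\<^sup>+y. ennreal (1 / d x y powr a) \<partial>\<nu>) \<le> ennreal (A * exp a / (1 - exp (- (s - a))))"
proof -
  have [measurable]: "mcball x r \<in> sets \<nu>" for r by (rule mcball_in_sets)
  define q where "q = exp (- (s - a))"
  have q: "0 < q" "q < 1" using a by (auto simp: q_def)
  have pt: "ennreal (1 / d x y powr a) \<le> (\<Sum>m::nat. ennreal (exp (a * (real m + 1))) * indicator (mcball x (exp (- real m))) y)"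
    if y: "y \<in> M" for y
  proof (cases "d x y = 0")
    case False
    then have d0: "0 < d x y" using nonneg[of x y] by linarith
    \<comment> \<open>The index of the annulus that contains \<open>y\<close>.\<close>
    define m where "m = nat \<lfloor>- ln (d x y)\<rfloor>"
    have "0 \<le> - ln (d x y)" using d0 d1[of y] by simp
    then have m: "real m \<le> - ln (d x y)" "- ln (d x y) < real m + 1"
      unfolding m_def by linarith+
    have "d x y = exp (ln (d x y))" using d0 by simp
    also have "\<dots> \<le> exp (- real m)" using m by simp
    finally have "y \<in> mcball x (exp (- real m))" using x y by simp
    have "1 / d x y powr a = exp (a * (- ln (d x y)))"
      using d0 by (simp add: powr_def exp_minus inverse_eq_divide)
    also have "\<dots> \<le> exp (a * (real m + 1))"
    proof -
      have "a * (- ln (d x y)) \<le> a * (real m + 1)"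
        using m a by (intro mult_left_mono) auto
      then show ?thesis by simp
    qed
    finally have "ennreal (1 / d x y powr a) \<le> ennreal (exp (a * (real m + 1))) * indicator (mcball x (exp (- real m))) y"
      using \<open>y \<in> mcball x (exp (- real m))\<close> by (simp add: ennreal_leI)
    also have "\<dots> \<le> (\<Sum>k. ennreal (exp (a * (real k + 1))) * indicator (mcball x (exp (- real k))) y)"
      using sum_le_suminf[of "\<lambda>k. ennreal (exp (a * (real k + 1))) * indicator (mcball x (exp (- real k))) y" "{m}"]
      by (simp only: sum.insert sum.empty finite.intros empty_iff not_False_eq_True add_0_right) auto
    finally show ?thesis .
  qed simp
  have "(\<integral>\<^sup>+y. ennreal (1 / d x y powr a) \<partial>\<nu>) \<le>
      (\<integral>\<^sup>+y. (\<Sum>m::nat. ennreal (exp (a * (real m + 1))) * indicator (mcball x (exp (- real m))) y) \<partial>\<nu>)"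
    using pt by (intro nn_integral_mono) simp
  also have "\<dots> = (\<Sum>m::nat. \<integral>\<^sup>+y. ennreal (exp (a * (real m + 1))) * indicator (mcball x (exp (- real m))) y \<partial>\<nu>)"
    by (intro nn_integral_suminf) measurable
  also have "\<dots> = (\<Sum>m::nat. ennreal (exp (a * (real m + 1))) * emeasure \<nu> (mcball x (exp (- real m))))"
    by (simp add: nn_integral_cmult_indicator)
  also have "\<dots> \<le> (\<Sum>m::nat. ennreal (A * exp a * q ^ m))"
  proof (intro suminf_le)
    fix m :: nat
    have "ennreal (exp (a * (real m + 1))) * emeasure \<nu> (mcball x (exp (- real m)))
        \<le> ennreal (exp (a * (real m + 1))) * ennreal (A * exp (- real m * s))"
      by (intro mult_left_mono ball) simp
    also have "\<dots> = ennreal (A * (exp (a * (real m + 1)) * exp (- real m * s)))"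
      by (subst ennreal_mult'[symmetric]) (auto simp: mult_ac)
    also have "exp (a * (real m + 1)) * exp (- real m * s) = exp a * q ^ m"
      by (simp add: q_def exp_of_nat_mult[symmetric] exp_add[symmetric] algebra_simps)
    finally show "ennreal (exp (a * (real m + 1))) * emeasure \<nu> (mcball x (exp (- real m))) \<le> ennreal (A * exp a * q ^ m)"
      by (simp add: mult.assoc)
  qed auto
  also have "\<dots> = ennreal (\<Sum>m::nat. A * exp a * q ^ m)"
    using q A by (intro suminf_ennreal2) (auto intro!: summable_mult summable_geometric)
  also have "(\<Sum>m::nat. A * exp a * q ^ m) = A * exp a / (1 - q)"
    using q by (simp add: suminf_mult suminf_geometric summable_geometric)
  finally show ?thesis by (simp add: q_def)
qed

end

section \<open>The Riesz kernel on the boundary\<close>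

locale hausdorff_boundary = good_space_action b \<delta> \<epsilon> G \<phi> +
  hd: finite_hausdorff gromov_boundary "visual_dist b \<epsilon>" D
  for b :: "'x::metric_space" and \<delta> \<epsilon> :: real and G :: "('g, 'm) monoid_scheme" (structure)
    and \<phi> :: "'g \<Rightarrow> 'x \<Rightarrow> 'x" and D :: real +
  assumes rough: "roughly_geodesic TYPE('x)" and cocpt: "cocompact G \<phi>" and D_pos: "0 < D"
begin

text \<open>If \<open>p\<close> lies near the rays from \<open>b\<close> to \<open>\<eta>\<close> and to \<open>\<zeta>\<close>, say \<open>dist b p\<close> and \<open>k\<close> differ by a bounded
  amount, then seen from \<open>b\<close> the distance of \<open>\<eta>\<close> and \<open>\<zeta>\<close> is smaller than seen from \<open>p\<close> by a factor
  comparable to \<open>exp (- \<epsilon> dist b p)\<close>.\<close>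

lemma visual_dist_contract:
  assumes eta: "\<eta> \<in> gromov_boundary" and zeta: "\<zeta> \<in> gromov_boundary"
    and ext: "ereal k \<le> gromov_ext b (Inl p) (Inr \<eta>)" "ereal k \<le> gromov_ext b (Inl p) (Inr \<zeta>)"
  shows "visual_dist b \<epsilon> \<eta> \<zeta> \<le> exp (- \<epsilon> * (2 * k - dist b p)) * visual_dist p \<epsilon> \<eta> \<zeta>"
proof -
  obtain \<alpha> where a: "gromov_ext b (Inl p) (Inr \<eta>) = ereal \<alpha>"
    using gromov_ext_Inl_real[of "Inr \<eta>" b p] eta by auto
  obtain \<beta> where be: "gromov_ext b (Inl p) (Inr \<zeta>) = ereal \<beta>"
    using gromov_ext_Inl_real[of "Inr \<zeta>" b p] zeta by auto
  have ch: "gromov_ext b (Inr \<eta>) (Inr \<zeta>) = gromov_ext p (Inr \<eta>) (Inr \<zeta>) + ereal (\<alpha> + \<beta> - dist b p)"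
    using eta zeta a be by (intro gromov_ext_change_basepoint) auto
  have k: "k \<le> \<alpha>" "k \<le> \<beta>" using ext a be by auto
  show ?thesis
  proof (cases "gromov_ext p (Inr \<eta>) (Inr \<zeta>)")
    case (real r)
    then have "gromov_ext b (Inr \<eta>) (Inr \<zeta>) = ereal (r + (\<alpha> + \<beta> - dist b p))" using ch by simp
    then have "visual_dist b \<epsilon> \<eta> \<zeta> = exp (- \<epsilon> * (r + (\<alpha> + \<beta> - dist b p)))"
      using eta zeta by (simp add: visual_dist_eq)
    also have "\<dots> \<le> exp (- \<epsilon> * (r + (2 * k - dist b p)))"
      using k eps_pos by simp
    also have "\<dots> = exp (- \<epsilon> * (2 * k - dist b p)) * visual_dist p \<epsilon> \<eta> \<zeta>"
      using eta zeta real by (simp add: visual_dist_eq exp_add[symmetric] algebra_simps)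
    finally show ?thesis .
  next
    case PInf
    then have "visual_dist b \<epsilon> \<eta> \<zeta> = 0" using eta zeta ch by (simp add: visual_dist_eq)
    then show ?thesis using eta zeta PInf by (simp add: visual_dist_eq)
  next
    case MInf
    then show ?thesis using gromov_ext_nonneg[of "Inr \<eta>" "Inr \<zeta>" p] eta zeta by simp
  qed
qed

text \<open>Choose \<open>g\<close> such that \<open>p = \<phi> g b\<close> lies near the ray from \<open>b\<close> to \<open>\<xi>\<close> at distance \<open>m / \<epsilon>\<close>. Seen from
  \<open>p\<close>, distances in the ball around \<open>\<xi>\<close> of radius \<open>exp (- m)\<close> are larger by a factor comparable to
  \<open>exp m\<close>, and the boundary seen from \<open>p\<close> is an isometric copy, by the inverse of \<open>g\<close>, of the boundary
  seen from \<open>b\<close>. So the ball has at most \<open>exp (- m D)\<close> times the total mass, up to a constant.\<close>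

lemma ball_measure_upper_bound:
  obtains A where "0 \<le> A" "\<And>\<xi> m. \<xi> \<in> gromov_boundary \<Longrightarrow>
    emeasure hd.\<nu> (hd.mcball \<xi> (exp (- real m))) \<le> ennreal (A * exp (- real m * D))"
proof -
  obtain C where C: "0 \<le> C" "\<And>\<xi> r. \<xi> \<in> gromov_boundary \<Longrightarrow> 0 \<le> r \<Longrightarrow>
     \<exists>g\<in>carrier G. dist b (\<phi> g b) \<le> r + C \<and> ereal (r - C) \<le> gromov_ext b (Inl (\<phi> g b)) (Inr \<xi>)"
    using orbit_points_near_rays[OF rough cocpt] by blast
  define A where "A = exp (\<epsilon> * (3 * C + 2 * \<delta>) * D)"
  have bound: "emeasure hd.\<nu> (hd.mcball \<xi> (exp (- real m))) \<le> ennreal (A * exp (- real m * D))"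
    if xi: "\<xi> \<in> gromov_boundary" for \<xi> m
  proof -
    define n where "n = real m / \<epsilon>"
    have n: "0 \<le> n" "\<epsilon> * n = real m" using eps_pos by (auto simp: n_def)
    obtain g where g: "g \<in> carrier G" "dist b (\<phi> g b) \<le> n + C"
        "ereal (n - C) \<le> gromov_ext b (Inl (\<phi> g b)) (Inr \<xi>)"
      using C(2)[OF xi n(1)] by blast
    define p where "p = \<phi> g b"
    define B where "B = hd.mcball \<xi> (exp (- real m))"
    have B_sub: "B \<subseteq> gromov_boundary" by (auto simp: B_def)
    have near: "ereal (n - C - \<delta>) \<le> gromov_ext b (Inl p) (Inr \<eta>)" if "\<eta> \<in> B" for \<eta>
    proof (rule gromov_ext_hyperbolic)
      have "visual_dist b \<epsilon> \<xi> \<eta> \<le> exp (- \<epsilon> * n)" using that n(2) by (simp add: B_def)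
      then have "ereal n \<le> gromov_ext b (Inr \<xi>) (Inr \<eta>)"
        using visual_dist_le_iff[OF xi, of \<eta> b n] that B_sub by auto
      moreover have "ereal (n - C) \<le> ereal n" using C(1) by simp
      ultimately show "ereal (n - C) \<le> gromov_ext b (Inr \<xi>) (Inr \<eta>)" by (rule order_trans[rotated])
      show "ereal (n - C) \<le> gromov_ext b (Inl p) (Inr \<xi>)" using g(3) by (simp add: p_def)
    qed (use xi that B_sub in auto)
    \<comment> \<open>From \<open>visual_dist_contract\<close> with \<open>k = n - C - \<delta>\<close> and \<open>dist b p \<le> n + C\<close>.\<close>
    define L where "L = exp (- \<epsilon> * (n - 3 * C - 2 * \<delta>))"
    have ig: "inv g \<in> carrier G" using g(1) by simp
    have inv_p: "\<phi> (inv g) p = b"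
      using action_mult[OF ig g(1)] g(1) by (simp add: p_def action_one fun_eq_iff)
    have "hausdorff_outer gromov_boundary (visual_dist b \<epsilon>) D B \<le>
        ennreal (L powr D) * hausdorff_outer gromov_boundary (visual_dist b \<epsilon>) D gromov_boundary"
    proof (rule hausdorff_outer_le_expanding[where f = "boundary_map (\<phi> (inv g))"])
      show "0 < L" by (simp add: L_def)
      show "boundary_map (\<phi> (inv g)) ` B \<subseteq> gromov_boundary"
        using boundary_action[OF ig] B_sub by auto
      fix \<eta> \<zeta> assume in_B: "\<eta> \<in> B" "\<zeta> \<in> B"
      then have bd: "\<eta> \<in> gromov_boundary" "\<zeta> \<in> gromov_boundary" using B_sub by auto
      have "visual_dist b \<epsilon> \<eta> \<zeta> \<le> exp (- \<epsilon> * (2 * (n - C - \<delta>) - dist b p)) * visual_dist p \<epsilon> \<eta> \<zeta>"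
        using in_B by (intro visual_dist_contract bd near)
      also have "\<dots> \<le> L * visual_dist p \<epsilon> \<eta> \<zeta>"
      proof (rule mult_right_mono)
        show "exp (- \<epsilon> * (2 * (n - C - \<delta>) - dist b p)) \<le> L"
          using g(2) eps_pos by (simp add: L_def p_def)
        show "0 \<le> visual_dist p \<epsilon> \<eta> \<zeta>" by (rule Metric_space.nonneg[OF Metric_space_visual])
      qed
      also have "visual_dist p \<epsilon> \<eta> \<zeta> = visual_dist b \<epsilon> (boundary_map (\<phi> (inv g)) \<eta>) (boundary_map (\<phi> (inv g)) \<zeta>)"
        using visual_dist_action[OF ig bd, of p] by (simp add: inv_p)
      finally show "visual_dist b \<epsilon> \<eta> \<zeta> \<le> L * visual_dist b \<epsilon> (boundary_map (\<phi> (inv g)) \<eta>) (boundary_map (\<phi> (inv g)) \<zeta>)" .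
    qed (rule D_pos B_sub)+
    then have "emeasure hd.\<nu> B \<le> ennreal (L powr D)"
      using hd.hausdorff_outer_M hd.emeasure_\<nu>[OF hd.mcball_in_sets]
      by (auto simp: B_def mult.commute intro!: divide_le_posI_ennreal)
    also have "L powr D = A * exp (- real m * D)"
    proof -
      have "L powr D = exp (- (\<epsilon> * n) * D + \<epsilon> * (3 * C + 2 * \<delta>) * D)"
        by (simp add: L_def powr_def algebra_simps)
      then show ?thesis by (simp add: n(2) A_def exp_add[symmetric] add.commute)
    qed
    finally show ?thesis by (simp add: B_def)
  qed
  show ?thesis
    by (rule that[of A]) (use bound in \<open>auto simp: A_def\<close>)
qed

definition riesz_kernel :: "real \<Rightarrow> (nat \<Rightarrow> 'x) set \<Rightarrow> (nat \<Rightarrow> 'x) set \<Rightarrow> real" where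
  "riesz_kernel a \<xi> \<eta> = 1 / visual_dist b \<epsilon> \<xi> \<eta> powr a"

text \<open>The upper bound on the degree comes from the measure of balls. The lower bound holds because the
  kernel is at least \<open>1\<close> off the diagonal and points are null sets in positive dimension.\<close>

lemma riesz_kernel_bounded_degree:
  assumes a: "0 \<le> a" "a < D"
  obtains C where "bounded_degree_kernel hd.\<nu> (riesz_kernel a) 1 C"
proof -
  obtain A where A: "0 \<le> A" "\<And>\<xi> m. \<xi> \<in> gromov_boundary \<Longrightarrow>
    emeasure hd.\<nu> (hd.mcball \<xi> (exp (- real m))) \<le> ennreal (A * exp (- real m * D))"
    using ball_measure_upper_bound by blast
  define C where "C = A * exp a / (1 - exp (- (D - a)))"
  have C: "0 \<le> C" using A(1) a by (simp add: C_def)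
  interpret nu: finite_measure hd.\<nu> by (rule hd.finite_measure_\<nu>)
  note [measurable] = hd.dist_measurable
  have meas: "(\<lambda>(x, y). riesz_kernel a x y) \<in> borel_measurable (hd.\<nu> \<Otimes>\<^sub>M hd.\<nu>)"
    unfolding riesz_kernel_def by measurable
  have sec: "riesz_kernel a \<xi> \<in> borel_measurable hd.\<nu>" if "\<xi> \<in> gromov_boundary" for \<xi>
    using hd.dist_section_measurable[OF that] unfolding riesz_kernel_def[abs_def] by measurable
  have nn: "(\<integral>\<^sup>+y. ennreal (riesz_kernel a \<xi> y) \<partial>hd.\<nu>) \<le> ennreal C" if "\<xi> \<in> gromov_boundary" for \<xi>
    unfolding riesz_kernel_def C_def
    using that a A by (intro hd.riesz_kernel_nn_integral_le visual_dist_le_1) auto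
  have nonneg: "0 \<le> riesz_kernel a x y" for x y by (simp add: riesz_kernel_def)
  have int: "integrable hd.\<nu> (riesz_kernel a \<xi>)" if "\<xi> \<in> gromov_boundary" for \<xi>
    using sec[OF that] nn[OF that] nonneg
    by (intro integrableI_bounded) (auto simp: le_less_trans[OF _ ennreal_less_top])
  have "bounded_degree_kernel hd.\<nu> (riesz_kernel a) 1 C"
  proof unfold_locales
    show "riesz_kernel a x y = riesz_kernel a y x" for x y
      by (simp add: riesz_kernel_def hd.commute[of x])
    show "1 \<le> (\<integral>y. riesz_kernel a x y \<partial>hd.\<nu>)" if x: "x \<in> space hd.\<nu>" for x
    proof -
      have xM: "x \<in> gromov_boundary" using x by simp
      have "AE y in hd.\<nu>. y \<notin> {x}"
        using hd.emeasure_singleton[OF D_pos xM] hd.singleton_in_sets[OF xM] by (intro AE_not_in) (simp add: null_sets_def)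
      then have "AE y in hd.\<nu>. 1 \<le> riesz_kernel a x y"
        using AE_space
      proof eventually_elim
        case (elim y)
        then have "0 < visual_dist b \<epsilon> x y"
          using hd.zero[OF xM, of y] hd.nonneg[of x y] by (auto simp: less_le)
        then show ?case
          using visual_dist_le_1[of b x y] a by (simp add: riesz_kernel_def powr_le1)
      qed
      then have "(\<integral>y. 1 \<partial>hd.\<nu>) \<le> (\<integral>y. riesz_kernel a x y \<partial>hd.\<nu>)"
        using int[OF xM] by (intro integral_mono_AE) auto
      then show ?thesis by (simp add: measure_def hd.emeasure_\<nu>_M)
    qed
    show "(\<integral>y. riesz_kernel a x y \<partial>hd.\<nu>) \<le> C" if x: "x \<in> space hd.\<nu>" for x
    proof -
      have xM: "x \<in> gromov_boundary" using x by simp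
      have "ennreal (\<integral>y. riesz_kernel a x y \<partial>hd.\<nu>) \<le> ennreal C"
        using nn_integral_eq_integral[OF int[OF xM]] nn[OF xM] nonneg by simp
      then show ?thesis using C by (simp add: ennreal_le_iff)
    qed
  qed (use meas int nonneg in auto)
  then show ?thesis by (rule that)
qed

lemma riesz_kernel_eq_exp:
  assumes "\<xi> \<in> gromov_boundary" "\<eta> \<in> gromov_boundary" "gromov_ext b (Inr \<xi>) (Inr \<eta>) = ereal r"
  shows "riesz_kernel a \<xi> \<eta> = exp (\<epsilon> * a * r)"
proof -
  have "exp (- \<epsilon> * r) powr a = exp (- (\<epsilon> * a * r))" by (simp add: powr_def mult_ac)
  then show ?thesis
    using assms by (simp add: riesz_kernel_def visual_dist_eq exp_minus inverse_eq_divide)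
qed

text \<open>A measurable choice, with countably many values, of a point \<open>p n (idx n \<xi>)\<close> that represents \<open>\<xi>\<close> at
  scale \<open>n\<close>: take the first point \<open>q\<^sub>i\<close> of a dense sequence that is \<open>exp (- \<epsilon> n)\<close> close to \<open>\<xi>\<close>, and a
  point at distance about \<open>n\<close> on the ray to \<open>q\<^sub>i\<close>.\<close>

lemma interior_approximation:
  obtains C and p :: "nat \<Rightarrow> nat \<Rightarrow> 'x" and idx :: "nat \<Rightarrow> (nat \<Rightarrow> 'x) set \<Rightarrow> nat"
  where "0 \<le> C" "\<And>n i. dist b (p n i) \<le> real n + C"
    "\<And>n. idx n \<in> hd.\<nu> \<rightarrow>\<^sub>M count_space UNIV"
    "\<And>n \<xi>. \<xi> \<in> gromov_boundary \<Longrightarrow> ereal (real n - C) \<le> gromov_ext b (Inl (p n (idx n \<xi>))) (Inr \<xi>)"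
proof -
  obtain C where C: "0 \<le> C" "\<And>\<xi> r. \<xi> \<in> gromov_boundary \<Longrightarrow> 0 \<le> r \<Longrightarrow>
     \<exists>g\<in>carrier G. dist b (\<phi> g b) \<le> r + C \<and> ereal (r - C) \<le> gromov_ext b (Inl (\<phi> g b)) (Inr \<xi>)"
    using orbit_points_near_rays[OF rough cocpt] by blast
  obtain Q where Q: "countable Q" "Q \<subseteq> gromov_boundary" "Q \<noteq> {}"
      "\<And>x r. x \<in> gromov_boundary \<Longrightarrow> 0 < r \<Longrightarrow> \<exists>q\<in>Q. visual_dist b \<epsilon> x q < r"
    using hd.countable_dense by blast
  define q where "q = from_nat_into Q"
  have q: "q i \<in> gromov_boundary" for i using from_nat_into[OF Q(3)] Q(2) by (auto simp: q_def)
  have "\<forall>n i. \<exists>x. dist b x \<le> real n + C \<and> ereal (real n - C) \<le> gromov_ext b (Inl x) (Inr (q i))"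
  proof (intro allI)
    fix n i
    obtain g where "dist b (\<phi> g b) \<le> real n + C" "ereal (real n - C) \<le> gromov_ext b (Inl (\<phi> g b)) (Inr (q i))"
      using C(2)[OF q, of "real n" i] by auto
    then show "\<exists>x. dist b x \<le> real n + C \<and> ereal (real n - C) \<le> gromov_ext b (Inl x) (Inr (q i))" by blast
  qed
  then obtain p where p: "\<And>n i. dist b (p n i) \<le> real n + C"
      "\<And>n i. ereal (real n - C) \<le> gromov_ext b (Inl (p n i)) (Inr (q i))"
    by metis
  define idx where "idx n \<xi> = (LEAST i. visual_dist b \<epsilon> (q i) \<xi> < exp (- \<epsilon> * real n))" for n \<xi>
  have meas: "idx n \<in> hd.\<nu> \<rightarrow>\<^sub>M count_space UNIV" for n
    unfolding idx_def[abs_def]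
  proof (rule measurable_Least)
    fix i
    have [measurable]: "visual_dist b \<epsilon> (q i) \<in> borel_measurable hd.\<nu>"
      by (rule hd.dist_section_measurable[OF q])
    show "Measurable.pred hd.\<nu> (\<lambda>\<xi>. visual_dist b \<epsilon> (q i) \<xi> < exp (- \<epsilon> * real n))" by measurable
  qed
  have close: "ereal (real n - C - \<delta>) \<le> gromov_ext b (Inl (p n (idx n \<xi>))) (Inr \<xi>)" if xi: "\<xi> \<in> gromov_boundary" for n \<xi>
  proof (rule gromov_ext_hyperbolic[where v = "Inr (q (idx n \<xi>))"])
    obtain z where z: "z \<in> Q" "visual_dist b \<epsilon> \<xi> z < exp (- \<epsilon> * real n)" using Q(4)[OF xi, of "exp (- \<epsilon> * real n)"] by auto
    obtain i where "q i = z" using from_nat_into_surj[OF Q(1) z(1)] by (auto simp: q_def)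
    then have "visual_dist b \<epsilon> (q i) \<xi> < exp (- \<epsilon> * real n)" using z(2) by (simp add: hd.commute[of _ \<xi>])
    then have "visual_dist b \<epsilon> (q (idx n \<xi>)) \<xi> < exp (- \<epsilon> * real n)" unfolding idx_def by (rule LeastI)
    then have "ereal (real n) \<le> gromov_ext b (Inr (q (idx n \<xi>))) (Inr \<xi>)"
      using visual_dist_le_iff[OF q xi, of b "idx n \<xi>" "real n"] less_imp_le by blast
    moreover have "ereal (real n - C) \<le> ereal (real n)" using C(1) by simp
    ultimately show "ereal (real n - C) \<le> gromov_ext b (Inr (q (idx n \<xi>))) (Inr \<xi>)" by (rule order_trans[rotated])
    show "ereal (real n - C) \<le> gromov_ext b (Inl (p n (idx n \<xi>))) (Inr (q (idx n \<xi>)))" by (rule p(2))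
  qed (use xi q in auto)
  show ?thesis
  proof (rule that[of "C + \<delta>" p idx])
    show "0 \<le> C + \<delta>" using C(1) delta_nonneg by simp
    show "dist b (p n i) \<le> real n + (C + \<delta>)" for n i using p(1)[of n i] delta_nonneg by simp
    show "idx n \<in> hd.\<nu> \<rightarrow>\<^sub>M count_space UNIV" for n by (rule meas)
    show "ereal (real n - (C + \<delta>)) \<le> gromov_ext b (Inl (p n (idx n \<xi>))) (Inr \<xi>)"
      if "\<xi> \<in> gromov_boundary" for n \<xi>
      using close[OF that, of n] by (simp add: diff_diff_eq)
  qed
qed

text \<open>The form of the Riesz kernel is the limit of the forms of the bounded kernels
  \<open>exp (s (x\<^sub>n(\<xi>), x\<^sub>n(\<eta>)))\<close>, which are nonnegative by \<open>psd_kernel_integral_nonneg\<close>.\<close>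

lemma riesz_form_nonneg:
  assumes cnt: "cond_negative_type (dist :: 'x \<Rightarrow> 'x \<Rightarrow> real)" and a: "0 \<le> a" "a < D"
    and u: "u \<in> L2 hd.\<nu>"
  shows "0 \<le> Re (\<integral>(x, y). of_real (riesz_kernel a x y) * (u y * cnj (u x)) \<partial>(hd.\<nu> \<Otimes>\<^sub>M hd.\<nu>))"
proof -
  obtain C0 where "bounded_degree_kernel hd.\<nu> (riesz_kernel a) 1 C0"
    using riesz_kernel_bounded_degree[OF a] by blast
  then interpret K: bounded_degree_kernel hd.\<nu> "riesz_kernel a" 1 C0 .
  obtain C and p :: "nat \<Rightarrow> nat \<Rightarrow> 'x" and idx :: "nat \<Rightarrow> (nat \<Rightarrow> 'x) set \<Rightarrow> nat"
    where C: "0 \<le> C" and p: "\<And>n i. dist b (p n i) \<le> real n + C"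
    and idx: "\<And>n. idx n \<in> hd.\<nu> \<rightarrow>\<^sub>M count_space UNIV"
    and close: "\<And>n \<xi>. \<xi> \<in> gromov_boundary \<Longrightarrow> ereal (real n - C) \<le> gromov_ext b (Inl (p n (idx n \<xi>))) (Inr \<xi>)"
    using interior_approximation by blast
  note [measurable] = idx L2_borel_measurable[OF u] hd.dist_measurable
  define s where "s = \<epsilon> * a"
  have s: "0 \<le> s" using a eps_pos by (simp add: s_def)
  define L where "L n i j = exp (s * gromov_product dist b (p n i) (p n j))" for n i j
  have L_psd: "psd_kernel (L n)" for n
    unfolding L_def by (rule psd_kernel_compose[OF psd_kernel_exp[OF psd_kernel_gromov_product[OF cnt] s]])
  have gp_le: "gromov_product dist b (p n i) (p n j) \<le> real n + C" for n i j
    using gromov_product_le_dist[of b "p n i" "p n j"] p[of n i] by simp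
  have L_bound: "\<bar>L n i j\<bar> \<le> exp (s * (real n + C))" for n i j
    using mult_left_mono[OF gp_le s] by (simp add: L_def)
  define f where "f n = (\<lambda>(x, y). complex_of_real (L n (idx n x) (idx n y)) * (u y * cnj (u x)))" for n
  have f_nonneg: "0 \<le> Re (integral\<^sup>L (hd.\<nu> \<Otimes>\<^sub>M hd.\<nu>) (f n))" for n
    unfolding f_def by (rule K.psd_kernel_integral_nonneg[OF idx[of n] L_psd[of n] L_bound[of n] K.L2_integrable[OF u]])
  have L_meas [measurable]: "(\<lambda>(x, y). L n (idx n x) (idx n y)) \<in> borel_measurable (hd.\<nu> \<Otimes>\<^sub>M hd.\<nu>)" for n
  proof -
    have [measurable]: "idx n \<in> hd.\<nu> \<rightarrow>\<^sub>M count_space UNIV" by (rule idx)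
    define l where "l = L n"
    have "(\<lambda>(x, y). l (idx n x) (idx n y)) \<in> borel_measurable (hd.\<nu> \<Otimes>\<^sub>M hd.\<nu>)" by measurable
    then show ?thesis by (simp add: l_def)
  qed
  have lim: "(\<lambda>n. L n (idx n \<xi>) (idx n \<eta>)) \<longlonglongrightarrow> riesz_kernel a \<xi> \<eta>"
    and dom: "L n (idx n \<xi>) (idx n \<eta>) \<le> exp (s * (2 * C + 2 * \<delta>)) * riesz_kernel a \<xi> \<eta>"
    if xi: "\<xi> \<in> gromov_boundary" and eta: "\<eta> \<in> gromov_boundary" and ne: "\<xi> \<noteq> \<eta>" for \<xi> \<eta> n
  proof -
    obtain r where r: "gromov_ext b (Inr \<xi>) (Inr \<eta>) = ereal r"
      using gromov_ext_finite[OF xi eta ne] by blast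
    have K_eq: "riesz_kernel a \<xi> \<eta> = exp (s * r)"
      using riesz_kernel_eq_exp[OF xi eta r] by (simp add: s_def)
    have to_bd: "limitin bord_topology (\<lambda>n. Inl (p n (idx n \<zeta>))) (Inr \<zeta>) sequentially"
      if z: "\<zeta> \<in> gromov_boundary" for \<zeta>
    proof (rule limitin_of_gromov_ext[OF z])
      fix R :: real
      show "eventually (\<lambda>n. ereal R \<le> gromov_ext b (Inl (p n (idx n \<zeta>))) (Inr \<zeta>)) sequentially"
        using eventually_ge_at_top[of "nat \<lceil>R + C\<rceil>"]
      proof eventually_elim
        case (elim n)
        then have "R \<le> real n - C" by linarith
        then have "ereal R \<le> ereal (real n - C)" by simp
        then show ?case using close[OF z, of n] by (rule order_trans)
      qed
    qed
    have "(\<lambda>n. gromov_product dist b (p n (idx n \<xi>)) (p n (idx n \<eta>))) \<longlonglongrightarrow> r"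
      using gromov_product_tendsto[OF to_bd[OF xi] to_bd[OF eta], of b] by (simp add: r)
    then show "(\<lambda>n. L n (idx n \<xi>) (idx n \<eta>)) \<longlonglongrightarrow> riesz_kernel a \<xi> \<eta>"
      unfolding K_eq L_def by (intro tendsto_intros)
    \<comment> \<open>Hyperbolicity along \<open>\<xi>\<close>, the two approximating points and \<open>\<eta>\<close>. Since \<open>\<gamma> \<le> n + C\<close>, the
      products of \<open>\<xi>\<close> and \<open>\<eta>\<close> with their approximating points are at least \<open>\<gamma> - 2 C\<close>.\<close>
    define \<gamma> where "\<gamma> = gromov_product dist b (p n (idx n \<xi>)) (p n (idx n \<eta>))"
    have low: "\<gamma> - 2 * C \<le> real n - C" using gp_le[of n "idx n \<xi>" "idx n \<eta>"] by (simp add: \<gamma>_def)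
    have "ereal (\<gamma> - 2 * C - \<delta>) \<le> gromov_ext b (Inr \<xi>) (Inl (p n (idx n \<eta>)))"
    proof (rule gromov_ext_hyperbolic[where v = "Inl (p n (idx n \<xi>))"])
      show "ereal (\<gamma> - 2 * C) \<le> gromov_ext b (Inr \<xi>) (Inl (p n (idx n \<xi>)))"
        using order_trans[OF _ close[OF xi, of n], of "ereal (\<gamma> - 2 * C)"] low xi
        by (simp add: gromov_ext_commute[of "Inr \<xi>"])
      show "ereal (\<gamma> - 2 * C) \<le> gromov_ext b (Inl (p n (idx n \<xi>))) (Inl (p n (idx n \<eta>)))"
        using C by (simp add: gromov_ext_Inl \<gamma>_def)
    qed (use xi in auto)
    then have "ereal (\<gamma> - 2 * C - \<delta> - \<delta>) \<le> gromov_ext b (Inr \<xi>) (Inr \<eta>)"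
    proof (rule gromov_ext_hyperbolic[rotated 3])
      show "ereal (\<gamma> - 2 * C - \<delta>) \<le> gromov_ext b (Inl (p n (idx n \<eta>))) (Inr \<eta>)"
        using order_trans[OF _ close[OF eta, of n], of "ereal (\<gamma> - 2 * C - \<delta>)"] low delta_nonneg by simp
    qed (use xi eta in auto)
    then have "\<gamma> \<le> r + (2 * C + 2 * \<delta>)" by (simp add: r)
    then have "s * \<gamma> \<le> s * (2 * C + 2 * \<delta>) + s * r"
      using mult_left_mono[OF _ s, of \<gamma> "r + (2 * C + 2 * \<delta>)"] by (simp add: algebra_simps)
    then show "L n (idx n \<xi>) (idx n \<eta>) \<le> exp (s * (2 * C + 2 * \<delta>)) * riesz_kernel a \<xi> \<eta>"
      unfolding K_eq L_def \<gamma>_def[symmetric] exp_add[symmetric] by simp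
  qed
  have off_diagonal: "AE z in hd.\<nu> \<Otimes>\<^sub>M hd.\<nu>. fst z \<noteq> snd z"
  proof (rule K.AE_pair_measure)
    have "{z \<in> space (hd.\<nu> \<Otimes>\<^sub>M hd.\<nu>). fst z \<noteq> snd z} =
      {z \<in> space (hd.\<nu> \<Otimes>\<^sub>M hd.\<nu>). (case z of (x, y) \<Rightarrow> visual_dist b \<epsilon> x y) \<noteq> 0}"
      by (auto simp: space_pair_measure)
    also have "\<dots> \<in> sets (hd.\<nu> \<Otimes>\<^sub>M hd.\<nu>)" by measurable
    finally show "{z \<in> space (hd.\<nu> \<Otimes>\<^sub>M hd.\<nu>). fst z \<noteq> snd z} \<in> sets (hd.\<nu> \<Otimes>\<^sub>M hd.\<nu>)" .
    show "AE x in hd.\<nu>. AE y in hd.\<nu>. fst (x, y) \<noteq> snd (x, y)"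
    proof (rule AE_I2)
      fix x assume "x \<in> space hd.\<nu>"
      then have xM: "x \<in> gromov_boundary" by simp
      have "AE y in hd.\<nu>. y \<notin> {x}"
        using hd.emeasure_singleton[OF D_pos xM] hd.singleton_in_sets[OF xM] by (intro AE_not_in) (simp add: null_sets_def)
      then show "AE y in hd.\<nu>. fst (x, y) \<noteq> snd (x, y)" by eventually_elim auto
    qed
  qed
  have "(\<lambda>n. integral\<^sup>L (hd.\<nu> \<Otimes>\<^sub>M hd.\<nu>) (f n)) \<longlonglongrightarrow>
     (\<integral>(x, y). of_real (riesz_kernel a x y) * (u y * cnj (u x)) \<partial>(hd.\<nu> \<Otimes>\<^sub>M hd.\<nu>))"
  proof (rule integral_dominated_convergence)
    let ?w = "\<lambda>z. exp (s * (2 * C + 2 * \<delta>)) * norm (case z of (x, y) \<Rightarrow> of_real (riesz_kernel a x y) * (u y * cnj (u x)))"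
    show "integrable (hd.\<nu> \<Otimes>\<^sub>M hd.\<nu>) ?w"
      by (intro integrable_mult_right integrable_norm K.K_form_integrable u)
    show "(\<lambda>(x, y). of_real (riesz_kernel a x y) * (u y * cnj (u x))) \<in> borel_measurable (hd.\<nu> \<Otimes>\<^sub>M hd.\<nu>)"
      using K.K_form_integrable[OF u u] by (rule borel_measurable_integrable)
    show "f n \<in> borel_measurable (hd.\<nu> \<Otimes>\<^sub>M hd.\<nu>)" for n
      unfolding f_def by measurable
    show "AE z in hd.\<nu> \<Otimes>\<^sub>M hd.\<nu>. (\<lambda>n. f n z) \<longlonglongrightarrow> (case z of (x, y) \<Rightarrow> of_real (riesz_kernel a x y) * (u y * cnj (u x)))"
      using off_diagonal AE_space
    proof eventually_elim
      case (elim z)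
      obtain x y where z: "z = (x, y)" by (cases z)
      then have "(\<lambda>n. L n (idx n x) (idx n y)) \<longlonglongrightarrow> riesz_kernel a x y"
        using elim by (intro lim) (auto simp: space_pair_measure)
      then show ?case unfolding f_def z prod.case by (intro tendsto_intros)
    qed
    show "AE z in hd.\<nu> \<Otimes>\<^sub>M hd.\<nu>. norm (f n z) \<le> ?w z" for n
      using off_diagonal AE_space
    proof eventually_elim
      case (elim z)
      obtain x y where z: "z = (x, y)" by (cases z)
      have "L n (idx n x) (idx n y) \<le> exp (s * (2 * C + 2 * \<delta>)) * riesz_kernel a x y"
        using elim z by (intro dom) (auto simp: space_pair_measure)
      moreover have "0 \<le> L n (idx n x) (idx n y)" by (simp add: L_def)
      ultimately have "L n (idx n x) (idx n y) * norm (u y * cnj (u x))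
          \<le> exp (s * (2 * C + 2 * \<delta>)) * riesz_kernel a x y * norm (u y * cnj (u x))"
        by (intro mult_right_mono) auto
      then show ?case
        using \<open>0 \<le> L n (idx n x) (idx n y)\<close> K.K_nonneg[of x y]
        unfolding f_def z prod.case norm_mult[of "of_real _"] norm_of_real by (simp add: mult.assoc)
    qed
  qed
  then show ?thesis
    by (rule LIMSEQ_le_const[OF tendsto_Re]) (use f_nonneg in auto)
qed

lemma boundary_measure_eq: "boundary_measure b \<epsilon> D = hd.\<nu>"
  by (simp add: boundary_measure_def Let_def hd.\<nu>_def)

lemma riesz_operator_positive:
  assumes cnt: "cond_negative_type (dist :: 'x \<Rightarrow> 'x \<Rightarrow> real)" and t: "0 < t" "t \<le> 1 / 2"
  shows "L2_positive (boundary_measure b \<epsilon> D) (riesz_operator b \<epsilon> D t)"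
proof -
  define a where "a = (1 - 2 * t) * D"
  have a: "0 \<le> a" "a < D" using t D_pos by (auto simp: a_def algebra_simps)
  obtain C where "bounded_degree_kernel hd.\<nu> (riesz_kernel a) 1 C"
    using riesz_kernel_bounded_degree[OF a] by blast
  then interpret K: bounded_degree_kernel hd.\<nu> "riesz_kernel a" 1 C .
  have "riesz_potential b \<epsilon> D t v \<xi> = K.pot v \<xi>" for v \<xi>
    unfolding riesz_potential_def boundary_measure_eq K.pot_def riesz_kernel_def a_def[symmetric]
    by (simp add: of_real_divide)
  then have "riesz_operator b \<epsilon> D t = K.averaging"
    by (intro ext) (simp add: riesz_operator_def K.averaging_def)
  then show ?thesis
    unfolding boundary_measure_eq using K.L2_positive_averaging[OF riesz_form_nonneg[OF cnt a]] by simp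
qed

end

lemma growth_exponent_nonneg: "0 \<le> growth_exponent G \<phi> x0"
proof -
  have "0 \<le> Limsup at_top (\<lambda>r::real. ereal (ln (real (card (orbit G \<phi> x0 \<inter> ball x0 r))) / r))"
  proof (rule le_Limsup)
    show "eventually (\<lambda>r::real. 0 \<le> ereal (ln (real (card (orbit G \<phi> x0 \<inter> ball x0 r))) / r)) at_top"
      using eventually_gt_at_top[of 0]
    proof eventually_elim
      case (elim r)
      have "0 \<le> ln (real (card (orbit G \<phi> x0 \<inter> ball x0 r)))"
        by (cases "card (orbit G \<phi> x0 \<inter> ball x0 r)") auto
      then show ?case using elim by simp
    qed
  qed simp
  then show ?thesis by (simp add: growth_exponent_def real_of_ereal_pos)
qed

lemma L2_positive_riesz_operator_zero:
  assumes "\<And>v \<xi>. riesz_potential b \<epsilon> D t v \<xi> = 0"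
  shows "L2_positive M (riesz_operator b \<epsilon> D t)"
proof -
  have "riesz_operator b \<epsilon> D t = (\<lambda>_ _. 0)"
    by (intro ext) (simp add: riesz_operator_def assms)
  then show ?thesis by (simp add: L2_positive_zero)
qed

lemma riesz_potential_null:
  assumes "emeasure (hausdorff_measure gromov_boundary (visual_dist b \<epsilon>) D)
      (space (hausdorff_measure gromov_boundary (visual_dist b \<epsilon>) D)) \<in> {0, \<infinity>}"
  shows "riesz_potential b \<epsilon> D t v \<xi> = 0"
proof -
  have "emeasure (boundary_measure b \<epsilon> D) (space (boundary_measure b \<epsilon> D)) = 0"
    using assms by (auto simp: boundary_measure_def Let_def divide_ennreal_def)
  then have "AE \<eta> in boundary_measure b \<epsilon> D. P \<eta>" for P
    by (intro AE_I[of _ _ "space (boundary_measure b \<epsilon> D)"]) auto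
  then show ?thesis unfolding riesz_potential_def by (rule integral_eq_zero_AE)
qed

theorem proposition1p11:
  fixes G :: "('g, 'm) monoid_scheme"
    and \<phi> :: "'g \<Rightarrow> 'x \<Rightarrow> 'x::metric_space"
    and x0 :: 'x
    and \<delta> \<epsilon> D t :: real
  assumes "hyperbolic_group G" and "\<not> elementary_group G"
    and "isometric_action G \<phi>" and "properly_discontinuous G \<phi>" and "cocompact G \<phi>"
    and "proper_metric TYPE('x)"
    and "hyperbolic_on UNIV (dist :: 'x \<Rightarrow> 'x \<Rightarrow> real) x0 \<delta>"
    and "roughly_geodesic TYPE('x)"
    and "eps_good TYPE('x) \<epsilon>"
    and "cond_negative_type (dist :: 'x \<Rightarrow> 'x \<Rightarrow> real)"
    and "D = growth_exponent G \<phi> x0 / \<epsilon>"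
    and "0 < t" and "t \<le> 1 / 2"
  shows "L2_positive (boundary_measure x0 \<epsilon> D) (riesz_operator x0 \<epsilon> D t)"
proof -
  interpret good_space_action x0 \<delta> \<epsilon> G \<phi>
    by unfold_locales (use assms in auto)
  have D_nonneg: "0 \<le> D"
    using growth_exponent_nonneg[of G \<phi> x0] eps_pos by (simp add: assms(11))
  let ?H = "hausdorff_measure gromov_boundary (visual_dist x0 \<epsilon>) D"
  show ?thesis
  proof (cases "emeasure ?H (space ?H) \<in> {0, \<infinity>}")
    case True
    \<comment> \<open>Here the normalization divides by \<open>0\<close> or \<open>\<infinity>\<close>, and both give the null measure.\<close>
    then show ?thesis
      by (intro L2_positive_riesz_operator_zero riesz_potential_null)
  next
    case False
    interpret hd: finite_hausdorff gromov_boundary "visual_dist x0 \<epsilon>" D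
      using False D_nonneg
      by (intro finite_hausdorff.intro finite_hausdorff_axioms.intro Metric_space_visual)
         (auto simp: space_hausdorff_measure[OF Metric_space_visual])
    show ?thesis
    proof (cases "D = 0")
      case True
      \<comment> \<open>Two boundary points would carry atoms, and the kernel, which is \<open>0\<close> on the diagonal and \<open>1\<close>
        off it, would have the negative eigenvalue \<open>- 1\<close> up to scaling. The group excludes this.\<close>
      have "\<xi> = \<eta>" if "\<xi> \<in> gromov_boundary" "\<eta> \<in> gromov_boundary" for \<xi> \<eta> :: "(nat \<Rightarrow> 'x) set"
        using elementary_of_finite_boundary[OF assms(4,6) hd.finite_carrier_of_zero_dim[OF True] that] assms(2)
        by blast
      then have "visual_dist x0 \<epsilon> \<xi> \<eta> = 0" for \<xi> \<eta>
        using hd.zero by (cases "\<xi> \<in> gromov_boundary \<and> \<eta> \<in> gromov_boundary") (auto simp: visual_dist_def)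
      then show ?thesis
        by (intro L2_positive_riesz_operator_zero) (simp add: riesz_potential_def)
    next
      case False
      then interpret hausdorff_boundary x0 \<delta> \<epsilon> G \<phi> D
        using D_nonneg assms(5,8) by unfold_locales auto
      show ?thesis
        by (rule riesz_operator_positive[OF assms(10,12,13)])
    qed
  qed
qed

end
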